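(* Let $G$ be a finite group, let $u\in Z(G)$ with $u^2=1$, and take the finite-dimensional quasitriangular Hopf algebra $\Bbbk G$ with $R$-matrix $R_u=\frac12(1\otimes1+1\otimes u+u\otimes1-u\otimes u)$. Then: (a) The left coideal subalgebras of $\Bbbk G$ are of the form $\Bbbk L$, for $L$ a subgroup of $G$. (b) For a subgroup $L\le G$, a $K$-matrix of $\Bbbk L$ is of the form $a\otimes 1$, for $a$ in the centralizer $C_G(L)$ of $L$ in $G$. (c) Let $L,L'\le G$ be subgroups, $a\in C_G(L)$ and $a'\in C_G(L')$. The quasitriangular left $\Bbbk G$-comodule algebras $(\Bbbk L,a\otimes1)$ and $(\Bbbk L',a'\otimes1)$ are braided Morita equivalent if and only if they are conjugate, i.e., there exists $g\in G$ with $L'=gLg^{-1}$ and $a'=gag^{-1}$.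
   Context: $\Bbbk$ is an algebraically closed field of characteristic zero; all algebras, categories and functors are $\Bbbk$-linear, $\otimes=\otimes_\Bbbk$. $A\text{-}\mathsf{Mod}$ is the category of left $A$-modules. $\Bbbk G$ has its usual Hopf structure, $\Delta(g)=g\otimes g$. A quasitriangular Hopf algebra $(H,R)$: $R=\sum_i R_i\otimes R^i\in H\otimes H$ is invertible with $(\Delta\otimes\mathrm{id})(R)=R_{13}R_{23}$, $(\mathrm{id}\otimes\Delta)(R)=R_{13}R_{12}$, $R\Delta(h)=\Delta^{\mathrm{op}}(h)R$. Then $H\text{-}\mathsf{Mod}$ is braided by $c_{X,Y}(x\otimes y)=\sum_i(R^i\cdot y)\otimes(R_i\cdot x)$. A left coideal subalgebra of $H$ is a subalgebra $B$ with $\Delta(B)\subseteq H\otimes B$, regarded as a left $H$-comodule algebra with $\delta=\Delta|_B$. A $K$-matrix of a left $H$-comodule algebra $(B,\delta)$ is an invertible $K=\sum_iK_i\otimes K^i\in H\otimes B$ with $(\Delta\otimes\mathrm{id}_B)(K)=K_{23}R_{21}K_{13}R_{21}^{-1}$, $(\mathrm{id}_H\otimes\delta)(K)=R_{21}K_{13}R_{12}$, $K\delta(b)=\delta(b)K$ for all $b\in B$; then $(B,K)$ is called quasitriangular. $B\text{-}\mathsf{Mod}$ is a left $(H\text{-}\mathsf{Mod})$-module category via $X\triangleright M=X\otimes M$ with $B$ acting through $\delta$, braided by $e_{X,M}(x\otimes m)=\sum_i(K_i\cdot x)\otimes(K^i\cdot m)$. $(B,K)$ and $(B',K')$ are braided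 Morita equivalent if there is a left $(H\text{-}\mathsf{Mod})$-module functor $(F,s):B\text{-}\mathsf{Mod}\to B'\text{-}\mathsf{Mod}$, with natural isomorphism $s_{X,M}:F(X\triangleright M)\to X\triangleright F(M)$ satisfying the usual pentagon and triangle axioms, such that $F$ is an equivalence of categories and $e'_{X,F(M)}s_{X,M}=s_{X,M}F(e_{X,M})$ for all $X,M$. *)

theory Defs
  imports
    "HOL-Algebra.Group"
    "HOL-Library.Function_Algebras"
    "HOL-Computational_Algebra.Polynomial"
begin

section \<open>Vector spaces and tensor products\<close>

text \<open>
  All vector spaces over the field \<open>'k\<close> are realised as subspaces of a function space
  \<open>'i idx \<Rightarrow> 'k\<close>. Every vector space has such a realisation (use coordinates with respect to a
  basis \<open>'i\<close>). The index type is closed under pairing, so the tensor product of two subspaces is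
  again a subspace of the same function space: it is spanned by the functions
  \<open>Node p q \<mapsto> x p * y q\<close>, and these satisfy no relations other than bilinearity
  (see \<open>tensor_lift_unique\<close> below). The index \<open>Triv\<close> carries the ground field as unit object.
\<close>

datatype 'i idx = Triv | Base 'i | Node "'i idx" "'i idx"

type_synonym ('i, 'k) vec = "'i idx \<Rightarrow> 'k"

definition scale :: "'k::field \<Rightarrow> ('a \<Rightarrow> 'k) \<Rightarrow> ('a \<Rightarrow> 'k)" where
  "scale c x = (\<lambda>p. c * x p)"

interpretation vec: vector_space "scale :: 'k::field \<Rightarrow> ('a \<Rightarrow> 'k) \<Rightarrow> ('a \<Rightarrow> 'k)"
  by standard (auto simp: scale_def fun_eq_iff algebra_simps)

definition single :: "'i idx \<Rightarrow> ('i, 'k::field) vec" where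
  "single p = (\<lambda>q. if q = p then 1 else 0)"

definition linear_on :: "('a \<Rightarrow> 'k::field) set \<Rightarrow> (('a \<Rightarrow> 'k) \<Rightarrow> ('b \<Rightarrow> 'k)) \<Rightarrow> bool" where
  "linear_on V f \<longleftrightarrow>
     (\<forall>x\<in>V. \<forall>y\<in>V. f (x + y) = f x + f y) \<and> (\<forall>c. \<forall>x\<in>V. f (scale c x) = scale c (f x))"

definition bilinear_on ::
  "('a \<Rightarrow> 'k::field) set \<Rightarrow> ('b \<Rightarrow> 'k) set \<Rightarrow> (('a \<Rightarrow> 'k) \<Rightarrow> ('b \<Rightarrow> 'k) \<Rightarrow> ('c \<Rightarrow> 'k)) \<Rightarrow> bool" where
  "bilinear_on V W \<beta> \<longleftrightarrow>
     (\<forall>x\<in>V. linear_on W (\<beta> x)) \<and> (\<forall>y\<in>W. linear_on V (\<lambda>x. \<beta> x y))"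

definition tens :: "('i, 'k::field) vec \<Rightarrow> ('i, 'k) vec \<Rightarrow> ('i, 'k) vec" (infixr "\<odot>" 75) where
  "x \<odot> y = (\<lambda>r. case r of Node p q \<Rightarrow> x p * y q | _ \<Rightarrow> 0)"

definition tensor_space ::
  "('i, 'k::field) vec set \<Rightarrow> ('i, 'k) vec set \<Rightarrow> ('i, 'k) vec set" (infixr "\<boxtimes>" 75) where
  "V \<boxtimes> W = vec.span {x \<odot> y | x y. x \<in> V \<and> y \<in> W}"

text \<open>
  The linear map on \<open>V \<boxtimes> W\<close> induced by a bilinear map \<open>\<beta>\<close>; as for all maps between subspaces
  below, it is made unique as a HOL function by requiring it to be extensional.
\<close>

definition tensor_lift ::
  "('i, 'k::field) vec set \<Rightarrow> ('i, 'k) vec set \<Rightarrow> (('i, 'k) vec \<Rightarrow> ('i, 'k) vec \<Rightarrow> ('a \<Rightarrow> 'k))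
     \<Rightarrow> ('i, 'k) vec \<Rightarrow> ('a \<Rightarrow> 'k)" where
  "tensor_lift V W \<beta> = (THE f. f \<in> extensional (V \<boxtimes> W) \<and> linear_on (V \<boxtimes> W) f \<and>
     (\<forall>x\<in>V. \<forall>y\<in>W. f (x \<odot> y) = \<beta> x y))"

definition tensor_map ::
  "('i, 'k::field) vec set \<Rightarrow> ('i, 'k) vec set \<Rightarrow> (('i, 'k) vec \<Rightarrow> ('j, 'k) vec)
     \<Rightarrow> (('i, 'k) vec \<Rightarrow> ('j, 'k) vec) \<Rightarrow> ('i, 'k) vec \<Rightarrow> ('j, 'k) vec" where
  "tensor_map V W f g = tensor_lift V W (\<lambda>x y. f x \<odot> g y)"

lemma linear_onD:
  "linear_on V f \<Longrightarrow> x \<in> V \<Longrightarrow> y \<in> V \<Longrightarrow> f (x + y) = f x + f y"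
  "linear_on V f \<Longrightarrow> x \<in> V \<Longrightarrow> f (scale c x) = scale c (f x)"
  unfolding linear_on_def by auto

lemma tens_in_tensor_space: "x \<in> V \<Longrightarrow> y \<in> W \<Longrightarrow> x \<odot> y \<in> V \<boxtimes> W"
  unfolding tensor_space_def by (rule vec.span_base) auto

lemma subspace_tensor_space: "vec.subspace (V \<boxtimes> W)"
  unfolding tensor_space_def by (rule vec.subspace_span)

lemma tens_add_left: "(x + y) \<odot> z = x \<odot> z + y \<odot> z"
  and tens_add_right: "z \<odot> (x + y) = z \<odot> x + z \<odot> y"
  and tens_scale_left: "scale c x \<odot> y = scale c (x \<odot> y)"
  and tens_scale_right: "x \<odot> scale c y = scale c (x \<odot> y)"
  by (auto simp: tens_def scale_def fun_eq_iff algebra_simps split: idx.split)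

lemma sum_vec_apply: "(\<Sum>i\<in>I. f i) p = (\<Sum>i\<in>I. f i p)"
  for f :: "'i \<Rightarrow> 'a \<Rightarrow> 'k::field"
  by (induction I rule: infinite_finite_induct) auto

lemma tens_coefficients_zero:
  fixes A B :: "('i, 'k::field) vec set"
  assumes A: "finite A" "vec.independent A" and B: "finite B" "vec.independent B"
    and z: "(\<Sum>a\<in>A. \<Sum>b\<in>B. scale (c a b) (a \<odot> b)) = 0"
    and ab: "a \<in> A" "b \<in> B"
  shows "c a b = 0"
proof -
  have *: "(\<Sum>a\<in>A. c a b * a p) = 0" if "b \<in> B" for b p
  proof -
    have "(\<Sum>b\<in>B. scale (\<Sum>a\<in>A. c a b * a p) b) = 0"
    proof
      fix q
      have "(\<Sum>b\<in>B. scale (\<Sum>a\<in>A. c a b * a p) b) q = (\<Sum>b\<in>B. \<Sum>a\<in>A. c a b * a p * b q)"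
        by (simp add: sum_vec_apply scale_def sum_distrib_right)
      also have "\<dots> = (\<Sum>a\<in>A. \<Sum>b\<in>B. c a b * a p * b q)" by (rule sum.swap)
      also have "\<dots> = (\<Sum>a\<in>A. \<Sum>b\<in>B. scale (c a b) (a \<odot> b)) (Node p q)"
        by (simp add: sum_vec_apply scale_def tens_def mult.assoc)
      finally show "(\<Sum>b\<in>B. scale (\<Sum>a\<in>A. c a b * a p) b) q = 0 q" using z by simp
    qed
    with B that show ?thesis
      by (auto dest: vec.independentD[OF B(2) B(1) subset_refl])
  qed
  have "(\<Sum>a\<in>A. scale (c a b) a) = 0"
    by (rule ext) (use *[OF ab(2)] in \<open>simp add: sum_vec_apply scale_def\<close>)
  then show ?thesis
    using A(1,2) ab(1) by (auto dest: vec.independentD[OF A(2) A(1) subset_refl])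
qed

lemma inj_tens:
  fixes A B :: "('i, 'k::field) vec set"
  assumes "vec.independent A" "vec.independent B"
  shows "inj_on (\<lambda>(a, b). a \<odot> b) (A \<times> B)"
proof (rule inj_onI, clarify, rule ccontr)
  fix a b a' b'
  assume m: "a \<in> A" "b \<in> B" "a' \<in> A" "b' \<in> B" and eq: "a \<odot> b = a' \<odot> b'"
    and ne: "\<not> (a = a' \<and> b = b')"
  let ?c = "\<lambda>x y. if x = a \<and> y = b then 1 else if x = a' \<and> y = b' then - 1 else (0::'k)"
  have "(\<Sum>x\<in>{a, a'}. \<Sum>y\<in>{b, b'}. scale (?c x y) (x \<odot> y)) = 0"
    using ne eq by (cases "a = a'"; cases "b = b'") auto
  moreover have "vec.independent {a, a'}" "vec.independent {b, b'}"
    using vec.independent_mono[OF assms(1)] vec.independent_mono[OF assms(2)] m by auto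
  ultimately have "?c a b = 0"
    by (intro tens_coefficients_zero[of "{a, a'}" "{b, b'}" ?c a b]) auto
  then show False by simp
qed

lemma independent_tens:
  fixes A B :: "('i, 'k::field) vec set"
  assumes A: "vec.independent A" and B: "vec.independent B"
  shows "vec.independent ((\<lambda>(a, b). a \<odot> b) ` (A \<times> B))"
  unfolding vec.independent_explicit_module
proof (intro allI impI)
  fix T u v
  assume T: "finite T" "T \<subseteq> (\<lambda>(a, b). a \<odot> b) ` (A \<times> B)"
    and z: "(\<Sum>v\<in>T. scale (u v) v) = 0" and v: "v \<in> T"
  obtain S where S: "S \<subseteq> A \<times> B" "finite S" "T = (\<lambda>(a, b). a \<odot> b) ` S"
    using finite_subset_image[OF T] by blast
  let ?A = "fst ` S" and ?B = "snd ` S"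
  let ?c = "\<lambda>a b. if (a, b) \<in> S then u (a \<odot> b) else 0"
  have sub: "?A \<subseteq> A" "?B \<subseteq> B" using S(1) by auto
  have inj: "inj_on (\<lambda>(a, b). a \<odot> b) S"
    using inj_tens[OF A B] S(1) by (rule inj_on_subset)
  have "(\<Sum>a\<in>?A. \<Sum>b\<in>?B. scale (?c a b) (a \<odot> b)) =
      (\<Sum>p\<in>?A \<times> ?B. if p \<in> S then scale (u (fst p \<odot> snd p)) (fst p \<odot> snd p) else 0)"
    unfolding sum.cartesian_product by (rule sum.cong) auto
  also have "\<dots> = (\<Sum>p\<in>S. scale (u (fst p \<odot> snd p)) (fst p \<odot> snd p))"
    using S(2) by (intro sum.mono_neutral_cong_right) (auto intro: rev_image_eqI)
  also have "\<dots> = (\<Sum>v\<in>T. scale (u v) v)"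
    unfolding S(3) by (subst sum.reindex[OF inj]) (simp add: case_prod_beta)
  finally have "(\<Sum>a\<in>?A. \<Sum>b\<in>?B. scale (?c a b) (a \<odot> b)) = 0" using z by simp
  moreover obtain a b where ab: "(a, b) \<in> S" "v = a \<odot> b" using v S(3) by auto
  ultimately have "?c a b = 0"
    using S(2) vec.independent_mono[OF A sub(1)] vec.independent_mono[OF B sub(2)]
    by (intro tens_coefficients_zero[of ?A ?B ?c a b]) (auto intro: rev_image_eqI)
  then show "u v = 0" using ab by simp
qed

text \<open>The universal property of the tensor product.\<close>

lemma tensor_lift_unique:
  fixes V W :: "('i, 'k::field) vec set" and \<beta> :: "('i, 'k) vec \<Rightarrow> ('i, 'k) vec \<Rightarrow> ('a \<Rightarrow> 'k)"
  assumes V: "vec.subspace V" and W: "vec.subspace W" and \<beta>: "bilinear_on V W \<beta>"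
  shows "\<exists>!f. f \<in> extensional (V \<boxtimes> W) \<and> linear_on (V \<boxtimes> W) f \<and>
     (\<forall>x\<in>V. \<forall>y\<in>W. f (x \<odot> y) = \<beta> x y)"
proof -
  interpret P: vector_space_pair "scale :: 'k \<Rightarrow> ('i, 'k) vec \<Rightarrow> ('i, 'k) vec"
    "scale :: 'k \<Rightarrow> ('a \<Rightarrow> 'k) \<Rightarrow> ('a \<Rightarrow> 'k)" by unfold_locales
  obtain A where A: "A \<subseteq> V" "vec.independent A" "V \<subseteq> vec.span A"
    using vec.maximal_independent_subset by blast
  obtain B where B: "B \<subseteq> W" "vec.independent B" "W \<subseteq> vec.span B"
    using vec.maximal_independent_subset by blast
  have spA: "vec.span A = V" and spB: "vec.span B = W"
    using A B V W by (auto simp: vec.span_minimal subset_antisym)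
  define s where "s = the_inv_into (A \<times> B) (\<lambda>(a, b :: ('i, 'k) vec). a \<odot> b)"
  obtain g where g: "Vector_Spaces.linear scale scale g"
    "\<And>v. v \<in> (\<lambda>(a, b). a \<odot> b) ` (A \<times> B) \<Longrightarrow> g v = \<beta> (fst (s v)) (snd (s v))"
    using P.linear_independent_extend[OF independent_tens[OF A(2) B(2)],
      of "\<lambda>v. \<beta> (fst (s v)) (snd (s v))"] by blast
  interpret g: Vector_Spaces.linear scale scale g by fact
  have gAB: "g (a \<odot> b) = \<beta> a b" if "a \<in> A" "b \<in> B" for a b
    using g(2)[of "a \<odot> b"] that the_inv_into_f_f[OF inj_tens[OF A(2) B(2)], of "(a, b)"]
    by (force simp: s_def)
  have \<beta>l: "linear_on W (\<beta> x)" if "x \<in> V" for x using \<beta> that by (auto simp: bilinear_on_def)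
  have \<beta>r: "linear_on V (\<lambda>x. \<beta> x y)" if "y \<in> W" for y using \<beta> that by (auto simp: bilinear_on_def)
  have zero: "f 0 = 0" if "vec.subspace U" "linear_on U f"
    for f :: "('i, 'k) vec \<Rightarrow> ('a \<Rightarrow> 'k)" and U
    using linear_onD(2)[OF that(2) vec.subspace_0[OF that(1)], of 0] by simp
  have g1: "g (a \<odot> y) = \<beta> a y" if a: "a \<in> A" and "y \<in> W" for a y
  proof -
    have aV: "a \<in> V" using a A by auto
    from \<open>y \<in> W\<close> have "y \<in> vec.span B" using spB by simp
    then have "y \<in> W \<and> g (a \<odot> y) = \<beta> a y"
    proof (induction rule: vec.span_induct_alt)
      case base
      have "a \<odot> 0 = 0" by (auto simp: tens_def fun_eq_iff split: idx.split)
      then show ?case using zero[OF W \<beta>l[OF aV]] g.zero vec.subspace_0[OF W] by metis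
    next
      case (step c b y)
      then have "b \<in> W" "y \<in> W" "scale c b \<in> W"
        using B vec.subspace_scale[OF W] by auto
      then have "scale c b + y \<in> W \<and> g (a \<odot> (scale c b + y)) = \<beta> a (scale c b + y)"
        using step gAB[OF a] linear_onD[OF \<beta>l[OF aV]] vec.subspace_add[OF W]
        by (simp add: tens_add_right tens_scale_right g.add g.scale)
      then show ?case .
    qed
    then show ?thesis ..
  qed
  have g2: "g (x \<odot> y) = \<beta> x y" if "x \<in> V" and y: "y \<in> W" for x y
  proof -
    from \<open>x \<in> V\<close> have "x \<in> vec.span A" using spA by simp
    then have "x \<in> V \<and> g (x \<odot> y) = \<beta> x y"
    proof (induction rule: vec.span_induct_alt)
      case base
      have "0 \<odot> y = 0" by (auto simp: tens_def fun_eq_iff split: idx.split)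
      then show ?case using zero[OF V \<beta>r[OF y]] g.zero vec.subspace_0[OF V] by metis
    next
      case (step c b x)
      then have "b \<in> V" "x \<in> V" "scale c b \<in> V"
        using A vec.subspace_scale[OF V] by auto
      then have "scale c b + x \<in> V \<and> g ((scale c b + x) \<odot> y) = \<beta> (scale c b + x) y"
        using step g1[OF _ y] linear_onD[OF \<beta>r[OF y]] vec.subspace_add[OF V]
        by (simp add: tens_add_left tens_scale_left g.add g.scale)
      then show ?case .
    qed
    then show ?thesis ..
  qed
  show ?thesis
  proof (rule ex1I[of _ "restrict g (V \<boxtimes> W)"], intro conjI)
    show "linear_on (V \<boxtimes> W) (restrict g (V \<boxtimes> W))"
      by (simp add: linear_on_def g.add g.scale vec.subspace_add[OF subspace_tensor_space]
          vec.subspace_scale[OF subspace_tensor_space])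
    show "\<forall>x\<in>V. \<forall>y\<in>W. restrict g (V \<boxtimes> W) (x \<odot> y) = \<beta> x y"
      using g2 by (simp add: tens_in_tensor_space)
  next
    fix f
    assume f: "f \<in> extensional (V \<boxtimes> W) \<and> linear_on (V \<boxtimes> W) f \<and>
      (\<forall>x\<in>V. \<forall>y\<in>W. f (x \<odot> y) = \<beta> x y)"
    have "t \<in> V \<boxtimes> W \<and> f t = g t" if "t \<in> vec.span {x \<odot> y | x y. x \<in> V \<and> y \<in> W}" for t
      using that
    proof (induction rule: vec.span_induct_alt)
      case base
      show ?case using zero[OF subspace_tensor_space] vec.subspace_0[OF subspace_tensor_space] f g.zero by metis
    next
      case (step c z t)
      then have "z \<in> V \<boxtimes> W" "t \<in> V \<boxtimes> W" "scale c z \<in> V \<boxtimes> W" "f z = g z"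
        using f g2
        by (auto intro!: tens_in_tensor_space vec.subspace_scale[OF subspace_tensor_space])
      then have "scale c z + t \<in> V \<boxtimes> W \<and> f (scale c z + t) = g (scale c z + t)"
        using step f linear_onD[of "V \<boxtimes> W" f]
        by (simp add: g.add g.scale vec.subspace_add[OF subspace_tensor_space])
      then show ?case .
    qed
    then have "f t = g t" if "t \<in> V \<boxtimes> W" for t using that by (simp add: tensor_space_def)
    then show "f = restrict g (V \<boxtimes> W)"
      using f by (intro extensionalityI[of f "V \<boxtimes> W"]) auto
  qed simp
qed

lemma tensor_lift:
  assumes "vec.subspace V" "vec.subspace W" "bilinear_on V W \<beta>"
  shows "tensor_lift V W \<beta> \<in> extensional (V \<boxtimes> W)" "linear_on (V \<boxtimes> W) (tensor_lift V W \<beta>)"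
    "x \<in> V \<Longrightarrow> y \<in> W \<Longrightarrow> tensor_lift V W \<beta> (x \<odot> y) = \<beta> x y"
  using theI'[OF tensor_lift_unique[OF assms]] unfolding tensor_lift_def by auto


section \<open>Algebras and Hopf algebras\<close>

text \<open>
  An algebra is a monoid in the sense of HOL-Algebra whose carrier is a vector space and whose
  multiplication is bilinear. Multiplication is written \<open>a \<otimes>\<^bsub>A\<^esub> b\<close>, following HOL-Algebra;
  tensors are written \<open>a \<odot> b\<close>.
\<close>

definition is_algebra :: "(('i, 'k::field) vec, 'm) monoid_scheme \<Rightarrow> bool" where
  "is_algebra A \<longleftrightarrow> monoid A \<and> vec.subspace (carrier A) \<and>
     bilinear_on (carrier A) (carrier A) (\<lambda>a b. a \<otimes>\<^bsub>A\<^esub> b)"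

definition algebra_hom ::
  "(('i, 'k::field) vec, 'm) monoid_scheme \<Rightarrow> (('j, 'k) vec, 'n) monoid_scheme
     \<Rightarrow> (('i, 'k) vec \<Rightarrow> ('j, 'k) vec) \<Rightarrow> bool" where
  "algebra_hom A B f \<longleftrightarrow> f \<in> hom A B \<and> linear_on (carrier A) f \<and> f \<one>\<^bsub>A\<^esub> = \<one>\<^bsub>B\<^esub>"

definition tensor_algebra ::
  "(('i, 'k::field) vec, 'm) monoid_scheme \<Rightarrow> (('i, 'k) vec, 'n) monoid_scheme
     \<Rightarrow> ('i, 'k) vec monoid" where
  "tensor_algebra A B =
     \<lparr>carrier = carrier A \<boxtimes> carrier B,
      monoid.mult = (\<lambda>v w. tensor_lift (carrier A) (carrier B)
        (\<lambda>a b. tensor_map (carrier A) (carrier B) (\<lambda>a'. a \<otimes>\<^bsub>A\<^esub> a') (\<lambda>b'. b \<otimes>\<^bsub>B\<^esub> b') w) v),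
      monoid.one = \<one>\<^bsub>A\<^esub> \<odot> \<one>\<^bsub>B\<^esub>\<rparr>"

record ('i, 'k) hopf = "('i, 'k) vec monoid" +
  comult :: "('i, 'k) vec \<Rightarrow> ('i, 'k) vec"
  counit :: "('i, 'k) vec \<Rightarrow> 'k"
  antipode :: "('i, 'k) vec \<Rightarrow> ('i, 'k) vec"

text \<open>Iterated tensor products are associated to the right.\<close>

definition tensor_assoc ::
  "('i, 'k::field) vec set \<Rightarrow> ('i, 'k) vec set \<Rightarrow> ('i, 'k) vec set
     \<Rightarrow> ('i, 'k) vec \<Rightarrow> ('i, 'k) vec" where
  "tensor_assoc U V W =
     tensor_lift (U \<boxtimes> V) W (\<lambda>t z. tensor_lift U V (\<lambda>x y. x \<odot> y \<odot> z) t)"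

definition hopf_algebra :: "('i, 'k::field) hopf \<Rightarrow> bool" where
  "hopf_algebra H \<longleftrightarrow>
     is_algebra H \<and>
     algebra_hom H (tensor_algebra H H) (comult H) \<and>
     (\<forall>x\<in>carrier H. \<forall>y\<in>carrier H. counit H (x + y) = counit H x + counit H y) \<and>
     (\<forall>c. \<forall>x\<in>carrier H. counit H (scale c x) = c * counit H x) \<and>
     (\<forall>x\<in>carrier H. \<forall>y\<in>carrier H. counit H (x \<otimes>\<^bsub>H\<^esub> y) = counit H x * counit H y) \<and>
     counit H \<one>\<^bsub>H\<^esub> = 1 \<and>
     (\<forall>h\<in>carrier H.
        tensor_assoc (carrier H) (carrier H) (carrier H)
          (tensor_map (carrier H) (carrier H) (comult H) (\<lambda>x. x) (comult H h)) =
        tensor_map (carrier H) (carrier H) (\<lambda>x. x) (comult H) (comult H h) \<and>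
        tensor_lift (carrier H) (carrier H) (\<lambda>x y. scale (counit H x) y) (comult H h) = h \<and>
        tensor_lift (carrier H) (carrier H) (\<lambda>x y. scale (counit H y) x) (comult H h) = h) \<and>
     antipode H \<in> carrier H \<rightarrow> carrier H \<and> linear_on (carrier H) (antipode H) \<and>
     (\<forall>h\<in>carrier H.
        tensor_lift (carrier H) (carrier H) (\<lambda>x y. antipode H x \<otimes>\<^bsub>H\<^esub> y) (comult H h) =
          scale (counit H h) \<one>\<^bsub>H\<^esub> \<and>
        tensor_lift (carrier H) (carrier H) (\<lambda>x y. x \<otimes>\<^bsub>H\<^esub> antipode H y) (comult H h) =
          scale (counit H h) \<one>\<^bsub>H\<^esub>)"

definition flip :: "('i, 'k::field) hopf \<Rightarrow> ('i, 'k) vec \<Rightarrow> ('i, 'k) vec" where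
  "flip H = tensor_lift (carrier H) (carrier H) (\<lambda>x y. y \<odot> x)"

text \<open>
  Leg numbering in \<open>H \<boxtimes> H \<boxtimes> B\<close>: the elements \<open>T\<^sub>1\<^sub>2\<close> and \<open>T\<^sub>2\<^sub>1\<close> for \<open>T \<in> H \<boxtimes> H\<close>, and
  \<open>T\<^sub>1\<^sub>3\<close> and \<open>T\<^sub>2\<^sub>3\<close> for \<open>T \<in> H \<boxtimes> B\<close>.
\<close>

definition leg12 ::
  "('i, 'k::field) hopf \<Rightarrow> (('i, 'k) vec, 'n) monoid_scheme \<Rightarrow> ('i, 'k) vec \<Rightarrow> ('i, 'k) vec" where
  "leg12 H B = tensor_lift (carrier H) (carrier H) (\<lambda>x y. x \<odot> y \<odot> \<one>\<^bsub>B\<^esub>)"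

definition leg21 ::
  "('i, 'k::field) hopf \<Rightarrow> (('i, 'k) vec, 'n) monoid_scheme \<Rightarrow> ('i, 'k) vec \<Rightarrow> ('i, 'k) vec" where
  "leg21 H B = tensor_lift (carrier H) (carrier H) (\<lambda>x y. y \<odot> x \<odot> \<one>\<^bsub>B\<^esub>)"

definition leg13 ::
  "('i, 'k::field) hopf \<Rightarrow> (('i, 'k) vec, 'n) monoid_scheme \<Rightarrow> ('i, 'k) vec \<Rightarrow> ('i, 'k) vec" where
  "leg13 H B = tensor_lift (carrier H) (carrier B) (\<lambda>x b. x \<odot> \<one>\<^bsub>H\<^esub> \<odot> b)"

definition leg23 ::
  "('i, 'k::field) hopf \<Rightarrow> (('i, 'k) vec, 'n) monoid_scheme \<Rightarrow> ('i, 'k) vec \<Rightarrow> ('i, 'k) vec" where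
  "leg23 H B = tensor_lift (carrier H) (carrier B) (\<lambda>x b. \<one>\<^bsub>H\<^esub> \<odot> x \<odot> b)"

definition quasitriangular :: "('i, 'k::field) hopf \<Rightarrow> ('i, 'k) vec \<Rightarrow> bool" where
  "quasitriangular H R \<longleftrightarrow>
     hopf_algebra H \<and>
     R \<in> Units (tensor_algebra H H) \<and>
     (let H3 = tensor_algebra H (tensor_algebra H H) in
       tensor_assoc (carrier H) (carrier H) (carrier H)
         (tensor_map (carrier H) (carrier H) (comult H) (\<lambda>x. x) R) =
         leg13 H H R \<otimes>\<^bsub>H3\<^esub> leg23 H H R \<and>
       tensor_map (carrier H) (carrier H) (\<lambda>x. x) (comult H) R =
         leg13 H H R \<otimes>\<^bsub>H3\<^esub> leg12 H H R) \<and>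
     (\<forall>h\<in>carrier H.
        R \<otimes>\<^bsub>tensor_algebra H H\<^esub> comult H h = flip H (comult H h) \<otimes>\<^bsub>tensor_algebra H H\<^esub> R)"

section \<open>Comodule algebras, coideal subalgebras and K-matrices\<close>

record ('i, 'k) comodule_alg = "('i, 'k) vec monoid" +
  coact :: "('i, 'k) vec \<Rightarrow> ('i, 'k) vec"

definition comodule_algebra :: "('i, 'k::field) hopf \<Rightarrow> ('i, 'k) comodule_alg \<Rightarrow> bool" where
  "comodule_algebra H B \<longleftrightarrow>
     is_algebra B \<and>
     algebra_hom B (tensor_algebra H B) (coact B) \<and>
     (\<forall>b\<in>carrier B.
        tensor_assoc (carrier H) (carrier H) (carrier B)
          (tensor_map (carrier H) (carrier B) (comult H) (\<lambda>x. x) (coact B b)) =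
        tensor_map (carrier H) (carrier B) (\<lambda>x. x) (coact B) (coact B b) \<and>
        tensor_lift (carrier H) (carrier B) (\<lambda>x y. scale (counit H x) y) (coact B b) = b)"

definition left_coideal_subalgebra :: "('i, 'k::field) hopf \<Rightarrow> ('i, 'k) vec set \<Rightarrow> bool" where
  "left_coideal_subalgebra H B \<longleftrightarrow>
     B \<subseteq> carrier H \<and> vec.subspace B \<and> \<one>\<^bsub>H\<^esub> \<in> B \<and> (\<forall>x\<in>B. \<forall>y\<in>B. x \<otimes>\<^bsub>H\<^esub> y \<in> B) \<and>
     comult H ` B \<subseteq> carrier H \<boxtimes> B"

definition coideal_alg :: "('i, 'k::field) hopf \<Rightarrow> ('i, 'k) vec set \<Rightarrow> ('i, 'k) comodule_alg" where
  "coideal_alg H B = \<lparr>carrier = B, monoid.mult = monoid.mult H, monoid.one = \<one>\<^bsub>H\<^esub>, coact = comult H\<rparr>"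

definition K_matrix ::
  "('i, 'k::field) hopf \<Rightarrow> ('i, 'k) vec \<Rightarrow> ('i, 'k) comodule_alg \<Rightarrow> ('i, 'k) vec \<Rightarrow> bool" where
  "K_matrix H R B K \<longleftrightarrow>
     quasitriangular H R \<and> comodule_algebra H B \<and>
     K \<in> Units (tensor_algebra H B) \<and>
     (let HHB = tensor_algebra H (tensor_algebra H B);
          R_inv = inv\<^bsub>tensor_algebra H H\<^esub> R
      in
       tensor_assoc (carrier H) (carrier H) (carrier B)
         (tensor_map (carrier H) (carrier B) (comult H) (\<lambda>b. b) K) =
         leg23 H B K \<otimes>\<^bsub>HHB\<^esub> leg21 H B R \<otimes>\<^bsub>HHB\<^esub> leg13 H B K \<otimes>\<^bsub>HHB\<^esub> leg21 H B R_inv \<and>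
       tensor_map (carrier H) (carrier B) (\<lambda>x. x) (coact B) K =
         leg21 H B R \<otimes>\<^bsub>HHB\<^esub> leg13 H B K \<otimes>\<^bsub>HHB\<^esub> leg12 H B R) \<and>
     (\<forall>b\<in>carrier B.
        K \<otimes>\<^bsub>tensor_algebra H B\<^esub> coact B b = coact B b \<otimes>\<^bsub>tensor_algebra H B\<^esub> K)"

section \<open>Categories of modules\<close>

text \<open>
  The objects of the category of left \<open>A\<close>-modules are all left \<open>A\<close>-modules whose underlying
  vector space is a subspace of \<open>'u idx \<Rightarrow> 'k\<close>. The type \<open>'u\<close> bounds the size of the modules in the
  way a universe does; it is arbitrary throughout. Modules need not be finite-dimensional.
\<close>

record ('i, 'u, 'k) left_mod =
  space :: "('u, 'k) vec set"
  act :: "('i, 'k) vec \<Rightarrow> ('u, 'k) vec \<Rightarrow> ('u, 'k) vec"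

definition is_left_module ::
  "(('i, 'k::field) vec, 'm) monoid_scheme \<Rightarrow> ('i, 'u, 'k) left_mod \<Rightarrow> bool" where
  "is_left_module A M \<longleftrightarrow>
     vec.subspace (space M) \<and>
     (\<forall>a\<in>carrier A. act M a \<in> space M \<rightarrow> space M) \<and>
     bilinear_on (carrier A) (space M) (act M) \<and>
     (\<forall>m\<in>space M. act M \<one>\<^bsub>A\<^esub> m = m) \<and>
     (\<forall>a\<in>carrier A. \<forall>b\<in>carrier A. \<forall>m\<in>space M. act M (a \<otimes>\<^bsub>A\<^esub> b) m = act M a (act M b m))"

definition mod_hom ::
  "(('i, 'k::field) vec, 'm) monoid_scheme \<Rightarrow> ('i, 'u, 'k) left_mod \<Rightarrow> ('i, 'u, 'k) left_mod
     \<Rightarrow> (('u, 'k) vec \<Rightarrow> ('u, 'k) vec) set" where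
  "mod_hom A M N =
     {f \<in> space M \<rightarrow>\<^sub>E space N. linear_on (space M) f \<and>
        (\<forall>a\<in>carrier A. \<forall>m\<in>space M. f (act M a m) = act N a (f m))}"

abbreviation mod_id :: "('i, 'u, 'k) left_mod \<Rightarrow> ('u, 'k) vec \<Rightarrow> ('u, 'k) vec" where
  "mod_id M \<equiv> (\<lambda>m\<in>space M. m)"

text \<open>The composition \<open>g \<circ> f\<close> of morphisms out of \<open>M\<close> is \<open>compose (space M) g f\<close>.\<close>

definition mod_iso ::
  "(('i, 'k::field) vec, 'm) monoid_scheme \<Rightarrow> ('i, 'u, 'k) left_mod \<Rightarrow> ('i, 'u, 'k) left_mod
     \<Rightarrow> (('u, 'k) vec \<Rightarrow> ('u, 'k) vec) \<Rightarrow> bool" where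
  "mod_iso A M N f \<longleftrightarrow> f \<in> mod_hom A M N \<and>
     (\<exists>g\<in>mod_hom A N M. compose (space M) g f = mod_id M \<and> compose (space N) f g = mod_id N)"

record ('i, 'j, 'u, 'k) mod_functor =
  ob :: "('i, 'u, 'k) left_mod \<Rightarrow> ('j, 'u, 'k) left_mod"
  ar :: "('i, 'u, 'k) left_mod \<Rightarrow> ('i, 'u, 'k) left_mod
           \<Rightarrow> (('u, 'k) vec \<Rightarrow> ('u, 'k) vec) \<Rightarrow> (('u, 'k) vec \<Rightarrow> ('u, 'k) vec)"

definition is_linear_functor ::
  "(('i, 'k::field) vec, 'm) monoid_scheme \<Rightarrow> (('j, 'k) vec, 'n) monoid_scheme
     \<Rightarrow> ('i, 'j, 'u, 'k) mod_functor \<Rightarrow> bool" where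
  "is_linear_functor A B F \<longleftrightarrow>
     (\<forall>M. is_left_module A M \<longrightarrow>
        is_left_module B (ob F M) \<and> ar F M M (mod_id M) = mod_id (ob F M)) \<and>
     (\<forall>M N. is_left_module A M \<longrightarrow> is_left_module A N \<longrightarrow>
        ar F M N \<in> mod_hom A M N \<rightarrow> mod_hom B (ob F M) (ob F N) \<and>
        (\<forall>f\<in>mod_hom A M N. \<forall>g\<in>mod_hom A M N.
           ar F M N (\<lambda>m\<in>space M. f m + g m) =
             (\<lambda>m\<in>space (ob F M). ar F M N f m + ar F M N g m)) \<and>
        (\<forall>c. \<forall>f\<in>mod_hom A M N.
           ar F M N (\<lambda>m\<in>space M. scale c (f m)) =
             (\<lambda>m\<in>space (ob F M). scale c (ar F M N f m)))) \<and>
     (\<forall>M N P. is_left_module A M \<longrightarrow> is_left_module A N \<longrightarrow> is_left_module A P \<longrightarrow>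
        (\<forall>f\<in>mod_hom A M N. \<forall>g\<in>mod_hom A N P.
           ar F M P (compose (space M) g f) =
             compose (space (ob F M)) (ar F N P g) (ar F M N f)))"

definition id_functor :: "('i, 'i, 'u, 'k) mod_functor" where
  "id_functor = \<lparr>ob = (\<lambda>M. M), ar = (\<lambda>M N f. f)\<rparr>"

definition comp_functor ::
  "('j, 'l, 'u, 'k) mod_functor \<Rightarrow> ('i, 'j, 'u, 'k) mod_functor \<Rightarrow> ('i, 'l, 'u, 'k) mod_functor" where
  "comp_functor F' F =
     \<lparr>ob = (\<lambda>M. ob F' (ob F M)), ar = (\<lambda>M N f. ar F' (ob F M) (ob F N) (ar F M N f))\<rparr>"

definition nat_iso ::
  "(('i, 'k::field) vec, 'm) monoid_scheme \<Rightarrow> (('j, 'k) vec, 'n) monoid_scheme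
     \<Rightarrow> ('i, 'j, 'u, 'k) mod_functor \<Rightarrow> ('i, 'j, 'u, 'k) mod_functor
     \<Rightarrow> (('i, 'u, 'k) left_mod \<Rightarrow> ('u, 'k) vec \<Rightarrow> ('u, 'k) vec) \<Rightarrow> bool" where
  "nat_iso A B F F' \<eta> \<longleftrightarrow>
     (\<forall>M. is_left_module A M \<longrightarrow> mod_iso B (ob F M) (ob F' M) (\<eta> M)) \<and>
     (\<forall>M N. is_left_module A M \<longrightarrow> is_left_module A N \<longrightarrow>
        (\<forall>f\<in>mod_hom A M N.
           compose (space (ob F M)) (\<eta> N) (ar F M N f) =
           compose (space (ob F M)) (ar F' M N f) (\<eta> M)))"

definition is_equivalence ::
  "(('i, 'k::field) vec, 'm) monoid_scheme \<Rightarrow> (('j, 'k) vec, 'n) monoid_scheme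
     \<Rightarrow> ('i, 'j, 'u, 'k) mod_functor \<Rightarrow> bool" where
  "is_equivalence A B F \<longleftrightarrow>
     is_linear_functor A B F \<and>
     (\<exists>E \<eta> \<epsilon>. is_linear_functor B A E \<and>
        nat_iso A A id_functor (comp_functor E F) \<eta> \<and>
        nat_iso B B (comp_functor F E) id_functor \<epsilon>)"

section \<open>Module categories and braided Morita equivalence\<close>

text \<open>
  An element \<open>w = \<Sum>i. h i \<odot> b i\<close> of \<open>H \<boxtimes> B\<close> acts on \<open>X \<boxtimes> M\<close> by
  \<open>x \<odot> m \<mapsto> \<Sum>i. act X (h i) x \<odot> act M (b i) m\<close>. Applied to \<open>coact B b\<close> this is the \<open>B\<close>-module
  structure, applied to a K-matrix it is the module braiding.
\<close>

definition tensor_act ::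
  "('i, 'k::field) hopf \<Rightarrow> (('i, 'k) vec, 'n) monoid_scheme
     \<Rightarrow> ('i, 'u, 'k) left_mod \<Rightarrow> ('i, 'u, 'k) left_mod
     \<Rightarrow> ('i, 'k) vec \<Rightarrow> ('u, 'k) vec \<Rightarrow> ('u, 'k) vec" where
  "tensor_act H B X M w t =
     tensor_lift (carrier H) (carrier B)
       (\<lambda>h b. tensor_map (space X) (space M) (act X h) (act M b) t) w"

definition act_mod ::
  "('i, 'k::field) hopf \<Rightarrow> ('i, 'k) comodule_alg
     \<Rightarrow> ('i, 'u, 'k) left_mod \<Rightarrow> ('i, 'u, 'k) left_mod \<Rightarrow> ('i, 'u, 'k) left_mod" where
  "act_mod H B X M =
     \<lparr>space = space X \<boxtimes> space M, act = (\<lambda>b. tensor_act H B X M (coact B b))\<rparr>"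

definition tensor_mod ::
  "('i, 'k::field) hopf \<Rightarrow> ('i, 'u, 'k) left_mod \<Rightarrow> ('i, 'u, 'k) left_mod \<Rightarrow> ('i, 'u, 'k) left_mod" where
  "tensor_mod H = act_mod H (coideal_alg H (carrier H))"

definition unit_mod :: "('i, 'k::field) hopf \<Rightarrow> ('i, 'u, 'k) left_mod" where
  "unit_mod H = \<lparr>space = vec.span {single Triv}, act = (\<lambda>h. scale (counit H h))\<rparr>"

definition unitor :: "('i, 'k::field) hopf \<Rightarrow> ('i, 'u, 'k) left_mod \<Rightarrow> ('u, 'k) vec \<Rightarrow> ('u, 'k) vec" where
  "unitor H M =
     tensor_lift (space (unit_mod H :: ('i, 'u, 'k) left_mod)) (space M) (\<lambda>c m. scale (c Triv) m)"

text \<open>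
  The action of \<open>H\<close>-modules is associative and unital only up to \<open>tensor_assoc\<close> and \<open>unitor\<close>; the last
  two conditions below are the pentagon and triangle axioms for \<open>s\<close>, the two before them say that
  \<open>s\<close> is invertible and natural in both arguments.
\<close>

definition is_module_functor ::
  "('i, 'k::field) hopf \<Rightarrow> ('i, 'k) comodule_alg \<Rightarrow> ('i, 'k) comodule_alg
     \<Rightarrow> ('i, 'i, 'u, 'k) mod_functor
     \<Rightarrow> (('i, 'u, 'k) left_mod \<Rightarrow> ('i, 'u, 'k) left_mod \<Rightarrow> ('u, 'k) vec \<Rightarrow> ('u, 'k) vec) \<Rightarrow> bool" where
  "is_module_functor H B B' F s \<longleftrightarrow>
     is_linear_functor B B' F \<and>
     (\<forall>X M. is_left_module H X \<longrightarrow> is_left_module B M \<longrightarrow>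
        mod_iso B' (ob F (act_mod H B X M)) (act_mod H B' X (ob F M)) (s X M)) \<and>
     (\<forall>X X' M M'. is_left_module H X \<longrightarrow> is_left_module H X' \<longrightarrow>
        is_left_module B M \<longrightarrow> is_left_module B M' \<longrightarrow>
        (\<forall>f\<in>mod_hom H X X'. \<forall>g\<in>mod_hom B M M'.
           compose (space (ob F (act_mod H B X M))) (s X' M')
             (ar F (act_mod H B X M) (act_mod H B X' M') (tensor_map (space X) (space M) f g)) =
           compose (space (ob F (act_mod H B X M)))
             (tensor_map (space X) (space (ob F M)) f (ar F M M' g)) (s X M))) \<and>
     (\<forall>X Y M. is_left_module H X \<longrightarrow> is_left_module H Y \<longrightarrow> is_left_module B M \<longrightarrow>
        compose (space (ob F (act_mod H B (tensor_mod H X Y) M)))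
          (tensor_assoc (space X) (space Y) (space (ob F M))) (s (tensor_mod H X Y) M) =
        compose (space (ob F (act_mod H B (tensor_mod H X Y) M)))
          (tensor_map (space X) (space (ob F (act_mod H B Y M))) (\<lambda>x. x) (s Y M))
          (compose (space (ob F (act_mod H B (tensor_mod H X Y) M)))
            (s X (act_mod H B Y M))
            (ar F (act_mod H B (tensor_mod H X Y) M) (act_mod H B X (act_mod H B Y M))
              (tensor_assoc (space X) (space Y) (space M))))) \<and>
     (\<forall>M. is_left_module B M \<longrightarrow>
        compose (space (ob F (act_mod H B (unit_mod H) M)))
          (unitor H (ob F M)) (s (unit_mod H) M) =
        ar F (act_mod H B (unit_mod H) M) M (unitor H M))"

definition module_braiding ::
  "('i, 'k::field) hopf \<Rightarrow> ('i, 'k) comodule_alg \<Rightarrow> ('i, 'k) vec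
     \<Rightarrow> ('i, 'u, 'k) left_mod \<Rightarrow> ('i, 'u, 'k) left_mod \<Rightarrow> ('u, 'k) vec \<Rightarrow> ('u, 'k) vec" where
  "module_braiding H B K X M = (\<lambda>t\<in>space X \<boxtimes> space M. tensor_act H B X M K t)"

definition braided_morita_equivalent ::
  "'u itself \<Rightarrow> ('i, 'k::field) hopf
     \<Rightarrow> ('i, 'k) comodule_alg \<Rightarrow> ('i, 'k) vec \<Rightarrow> ('i, 'k) comodule_alg \<Rightarrow> ('i, 'k) vec \<Rightarrow> bool" where
  "braided_morita_equivalent _ H B K B' K' \<longleftrightarrow>
     (\<exists>(F :: ('i, 'i, 'u, 'k) mod_functor) s.
        is_module_functor H B B' F s \<and> is_equivalence B B' F \<and>
        (\<forall>X M. is_left_module H X \<longrightarrow> is_left_module B M \<longrightarrow>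
           compose (space (ob F (act_mod H B X M)))
             (module_braiding H B' K' X (ob F M)) (s X M) =
           compose (space (ob F (act_mod H B X M)))
             (s X M)
             (ar F (act_mod H B X M) (act_mod H B X M) (module_braiding H B K X M))))"

section \<open>Group algebras\<close>

definition grp :: "'g \<Rightarrow> ('g, 'k::field) vec" where
  "grp g = single (Base g)"

definition group_span :: "'g set \<Rightarrow> ('g, 'k::field) vec set" where
  "group_span L = vec.span (grp ` L)"

text \<open>
  The usual Hopf algebra structure of the group algebra of a finite group, with basis \<open>grp g\<close>;
  the coefficient of \<open>grp g\<close> in \<open>x\<close> is \<open>x (Base g)\<close>.
\<close>

definition group_algebra :: "('g, 'm) monoid_scheme \<Rightarrow> ('g, 'k::field) hopf" where
  "group_algebra G =
     \<lparr>carrier = group_span (carrier G),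
      monoid.mult = (\<lambda>x y. \<Sum>g\<in>carrier G. \<Sum>h\<in>carrier G.
        scale (x (Base g) * y (Base h)) (grp (g \<otimes>\<^bsub>G\<^esub> h))),
      monoid.one = grp \<one>\<^bsub>G\<^esub>,
      comult = (\<lambda>x. \<Sum>g\<in>carrier G. scale (x (Base g)) (grp g \<odot> grp g)),
      counit = (\<lambda>x. \<Sum>g\<in>carrier G. x (Base g)),
      antipode = (\<lambda>x. \<Sum>g\<in>carrier G. scale (x (Base g)) (grp (inv\<^bsub>G\<^esub> g)))\<rparr>"

definition R_matrix :: "('g, 'm) monoid_scheme \<Rightarrow> 'g \<Rightarrow> ('g, 'k::field) vec" where
  "R_matrix G u =
     scale (1 / 2) (grp \<one>\<^bsub>G\<^esub> \<odot> grp \<one>\<^bsub>G\<^esub> + grp \<one>\<^bsub>G\<^esub> \<odot> grp u + grp u \<odot> grp \<one>\<^bsub>G\<^esub> - grp u \<odot> grp u)"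

definition subgroup_algebra :: "('g, 'm) monoid_scheme \<Rightarrow> 'g set \<Rightarrow> ('g, 'k::field) comodule_alg" where
  "subgroup_algebra G L = coideal_alg (group_algebra G) (group_span L)"

definition center :: "('g, 'm) monoid_scheme \<Rightarrow> 'g set" where
  "center G = {z \<in> carrier G. \<forall>g\<in>carrier G. z \<otimes>\<^bsub>G\<^esub> g = g \<otimes>\<^bsub>G\<^esub> z}"

definition centralizer :: "('g, 'm) monoid_scheme \<Rightarrow> 'g set \<Rightarrow> 'g set" where
  "centralizer G L = {a \<in> carrier G. \<forall>l\<in>L. a \<otimes>\<^bsub>G\<^esub> l = l \<otimes>\<^bsub>G\<^esub> a}"

end

(*
  (a) If B is a left coideal subalgebra and x is in B, then slicing the comultiplication of x shows
  that x_g g is in B for every g, so B is spanned by group elements.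

  (b) R_21 = R_12 is a central involution, so the axioms for K reduce to
  (Delta (x) 1) K = K_23 K_13 and (1 (x) delta) K = K_13. The second forces K = k (x) 1, the first
  makes k group-like.

  (c) Conjugation by g gives the equivalence "twist by g^-1" with constraint g (x) 1. Conversely, let
  (F, s) be a braided equivalence. The regular G-module A, with basis d_x, is a coalgebra in kG-Mod in
  which every d_x is group-like, and the regular L-module V is an A-comodule by d_l |-> d_l (x) d_l;
  in other words V is graded by G, with support L. The module functor structure transports the
  coaction to F V, which thus decomposes into components indexed by G, compatibly with L' acting from
  the left and with L acting from the right. As F is full and faithful, F V is simple as a graded
  module, so it is supported on one coset L' g, and comparing the right translations that extend to
  endomorphisms gives L' = g L g^-1. Finally the braiding of V agrees on the image of the coaction
  with right translation by a^-1; applying F gives a' g = g a.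
*)
theory Submission
  imports Defs
begin

section \<open>Linear maps on tensor products and on coordinate spaces\<close>

text \<open>The functor in (c) is given only by its axioms, and nothing is known about the space of
  \<open>F V\<close>. What can be carried along \<open>F\<close> and \<open>s\<close> are morphisms
  of modules and equations between them; this is why the grading of \<open>V\<close> is written as a
  morphism from \<open>V\<close> to the action of \<open>A\<close> on \<open>V\<close>.
  Coassociativity and the counit law of this coaction are equations of that kind. The pentagon and
  the triangle carry them to \<open>F V\<close>, where they say that the homogeneous parts come from
  orthogonal idempotents with sum the identity. Degree shifts by elements outside \<open>L\<close>
  are no endomorphisms of \<open>V\<close>, but right translation still acts on \<open>A\<close>,
  and \<open>s\<close> keeps the factor \<open>A\<close>. A shift on \<open>F V\<close> is thus
  expressed by pairing a translation of \<open>A\<close> with an endomorphism of \<open>F V\<close>;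
  fullness and faithfulness move this equation to \<open>V\<close>, where it can be solved on the
  basis. A second constraint is the universe: \<open>'u\<close> is arbitrary, perhaps a single
  point, so the regular modules have to be realised on an injective image of \<open>G\<close> in
  \<open>'u idx\<close>, which is infinite because indices can be nested.\<close>

lemma linear_on_zero:
  assumes "vec.subspace V" "linear_on V f"
  shows "f 0 = 0"
  using linear_onD(2)[OF assms(2) vec.subspace_0[OF assms(1)], of 0] by simp

lemma linear_on_sum:
  assumes "vec.subspace V" "linear_on V f" "\<And>i. i \<in> I \<Longrightarrow> g i \<in> V"
  shows "f (\<Sum>i\<in>I. g i) = (\<Sum>i\<in>I. f (g i))"
  using assms(3)
proof (induction I rule: infinite_finite_induct)
  case (insert i I)
  then have "f (\<Sum>i\<in>insert i I. g i) = (\<Sum>i\<in>insert i I. f (g i))"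
    using linear_onD(1)[OF assms(2)] vec.subspace_sum[OF assms(1), of I g] by simp
  then show ?case .
qed (use linear_on_zero[OF assms(1,2)] in auto)

lemma linear_on_compose:
  assumes "linear_on V f" "f \<in> V \<rightarrow> W" "linear_on W g"
  shows "linear_on V (\<lambda>x. g (f x))"
  using assms by (auto simp: linear_on_def Pi_iff)

lemma linear_on_cong:
  assumes "vec.subspace V" "\<And>x. x \<in> V \<Longrightarrow> f x = g x"
  shows "linear_on V f \<longleftrightarrow> linear_on V g"
  using assms by (simp add: linear_on_def vec.subspace_add vec.subspace_scale)

lemma linear_on_id: "linear_on V (\<lambda>x. x)"
  and linear_on_const_zero: "linear_on V (\<lambda>x. 0)"
  by (auto simp: linear_on_def scale_def fun_eq_iff)

lemma linear_on_add:
  "linear_on V f \<Longrightarrow> linear_on V g \<Longrightarrow> linear_on V (\<lambda>x. f x + g x)"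
  by (simp add: linear_on_def vec.scale_right_distrib)

lemma linear_on_scale: "linear_on V f \<Longrightarrow> linear_on V (\<lambda>x. scale c (f x))"
  by (simp add: linear_on_def vec.scale_right_distrib mult.commute)

lemma linear_on_sum_fun:
  "(\<And>i. i \<in> I \<Longrightarrow> linear_on V (f i)) \<Longrightarrow> linear_on V (\<lambda>x. \<Sum>i\<in>I. f i x)"
proof (induction I rule: infinite_finite_induct)
  case (insert i I)
  then have "linear_on V (\<lambda>x. \<Sum>i\<in>insert i I. f i x)" by (simp add: linear_on_add)
  then show ?case .
qed (auto simp: linear_on_const_zero)

lemma linear_on_eval_scale: "linear_on V (\<lambda>x. scale (x p) y)"
  by (simp add: linear_on_def scale_def fun_eq_iff algebra_simps)

lemma linear_on_span_eq:
  assumes f: "linear_on (vec.span S) f" and g: "linear_on (vec.span S) g"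
    and eq: "\<And>x. x \<in> S \<Longrightarrow> f x = g x" and x: "x \<in> vec.span S"
  shows "f x = g x"
proof -
  \<comment> \<open>Both maps are linear only on the span, so the induction has to carry membership
    along with the equality.\<close>
  have "x \<in> vec.span S \<and> f x = g x"
    using x
  proof (induction rule: vec.span_induct_alt)
    case base
    have "0 \<in> vec.span S \<and> f 0 = g 0"
      using linear_on_zero[OF vec.subspace_span f] linear_on_zero[OF vec.subspace_span g]
      by (simp add: vec.span_zero)
    then show ?case .
  next
    case (step c y z)
    then have "y \<in> vec.span S" "z \<in> vec.span S" "scale c y \<in> vec.span S"
      by (auto intro: vec.span_base vec.span_scale)
    then have "scale c y + z \<in> vec.span S \<and> f (scale c y + z) = g (scale c y + z)"
      using step eq by (simp add: linear_onD[OF f] linear_onD[OF g] vec.span_add)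
    then show ?case .
  qed
  then show ?thesis ..
qed

lemma linear_on_span_image:
  assumes f: "linear_on (vec.span S) f" and U: "vec.subspace U"
    and S: "\<And>x. x \<in> S \<Longrightarrow> f x \<in> U" and x: "x \<in> vec.span S"
  shows "f x \<in> U"
proof -
  have "x \<in> vec.span S \<and> f x \<in> U"
    using x
  proof (induction rule: vec.span_induct_alt)
    case base
    have "0 \<in> vec.span S \<and> f 0 \<in> U"
      using linear_on_zero[OF vec.subspace_span f] vec.subspace_0[OF U]
      by (simp add: vec.span_zero)
    then show ?case .
  next
    case (step c y z)
    then have "y \<in> vec.span S" "z \<in> vec.span S" "scale c y \<in> vec.span S"
      by (auto intro: vec.span_base vec.span_scale)
    then have "scale c y + z \<in> vec.span S \<and> f (scale c y + z) \<in> U"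
      using step S U
      by (simp add: linear_onD[OF f] vec.span_add vec.subspace_add vec.subspace_scale)
    then show ?case .
  qed
  then show ?thesis ..
qed

text \<open>Pure tensors generate \<open>V \<boxtimes> W\<close>, and lifts are known only through
  their values there. Nearly every identity between maps out of a tensor product is reduced to
  generators in this way.\<close>

lemma tensor_eqI:
  assumes "linear_on (V \<boxtimes> W) f" "linear_on (V \<boxtimes> W) g"
    and "\<And>x y. x \<in> V \<Longrightarrow> y \<in> W \<Longrightarrow> f (x \<odot> y) = g (x \<odot> y)" and "t \<in> V \<boxtimes> W"
  shows "f t = g t"
  by (rule linear_on_span_eq[OF assms(1,2)[unfolded tensor_space_def] _
      assms(4)[unfolded tensor_space_def]]) (use assms(3) in auto)

lemma tensor_image:
  assumes "linear_on (V \<boxtimes> W) f" "vec.subspace U"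
    and "\<And>x y. x \<in> V \<Longrightarrow> y \<in> W \<Longrightarrow> f (x \<odot> y) \<in> U" and "t \<in> V \<boxtimes> W"
  shows "f t \<in> U"
  by (rule linear_on_span_image[OF assms(1)[unfolded tensor_space_def] assms(2) _
      assms(4)[unfolded tensor_space_def]]) (use assms(3) in auto)

lemma linear_on_tens_left: "linear_on V (\<lambda>x. x \<odot> y)"
  and linear_on_tens_right: "linear_on V (\<lambda>y. x \<odot> y)"
  by (simp_all add: linear_on_def tens_add_left tens_add_right tens_scale_left tens_scale_right)

text \<open>For the domain of \<open>tensor_assoc\<close>, bracketed to the left: with
  \<open>z\<close> fixed, both sides are linear in the tensor from \<open>U \<boxtimes> V\<close>,
  so \<open>tensor_eqI\<close> applies a second time.\<close>

lemma tensor_eqI3: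
  assumes f: "linear_on ((U \<boxtimes> V) \<boxtimes> W) f" and g: "linear_on ((U \<boxtimes> V) \<boxtimes> W) g"
    and eq: "\<And>x y z. x \<in> U \<Longrightarrow> y \<in> V \<Longrightarrow> z \<in> W \<Longrightarrow> f ((x \<odot> y) \<odot> z) = g ((x \<odot> y) \<odot> z)"
    and t: "t \<in> (U \<boxtimes> V) \<boxtimes> W"
  shows "f t = g t"
proof (rule tensor_eqI[OF f g _ t])
  fix r z assume r: "r \<in> U \<boxtimes> V" and z: "z \<in> W"
  have *: "(\<lambda>r. r \<odot> z) \<in> (U \<boxtimes> V) \<rightarrow> (U \<boxtimes> V) \<boxtimes> W"
    using z by (auto intro: tens_in_tensor_space)
  show "f (r \<odot> z) = g (r \<odot> z)"
    by (rule tensor_eqI[OF _ _ _ r, of "\<lambda>r. f (r \<odot> z)" "\<lambda>r. g (r \<odot> z)"])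
      (auto intro!: linear_on_compose[OF linear_on_tens_left *] f g eq z)
qed

lemma bilinear_onI:
  assumes "\<And>x. x \<in> V \<Longrightarrow> linear_on W (\<beta> x)" "\<And>y. y \<in> W \<Longrightarrow> linear_on V (\<lambda>x. \<beta> x y)"
  shows "bilinear_on V W \<beta>"
  using assms by (simp add: bilinear_on_def)

lemma bilinear_onD:
  "bilinear_on V W \<beta> \<Longrightarrow> x \<in> V \<Longrightarrow> linear_on W (\<beta> x)"
  "bilinear_on V W \<beta> \<Longrightarrow> y \<in> W \<Longrightarrow> linear_on V (\<lambda>x. \<beta> x y)"
  by (simp_all add: bilinear_on_def)

lemma bilinear_on_tens_maps:
  "linear_on V f \<Longrightarrow> linear_on W g \<Longrightarrow> bilinear_on V W (\<lambda>x y. f x \<odot> g y)"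
  by (simp add: bilinear_on_def linear_on_def tens_add_left tens_add_right
      tens_scale_left tens_scale_right)

context
  fixes V W :: "('i, 'k::field) vec set" and f g :: "('i, 'k) vec \<Rightarrow> ('j, 'k) vec"
  assumes V: "vec.subspace V" and W: "vec.subspace W"
    and f: "linear_on V f" and g: "linear_on W g"
begin

lemma tensor_map_extensional: "tensor_map V W f g \<in> extensional (V \<boxtimes> W)"
  and linear_on_tensor_map: "linear_on (V \<boxtimes> W) (tensor_map V W f g)"
  and tensor_map_tens: "x \<in> V \<Longrightarrow> y \<in> W \<Longrightarrow> tensor_map V W f g (x \<odot> y) = f x \<odot> g y"
  unfolding tensor_map_def
  using tensor_lift[OF V W bilinear_on_tens_maps[OF f g]] by auto

lemma tensor_map_in:
  assumes "\<And>x. x \<in> V \<Longrightarrow> f x \<in> V'" "\<And>y. y \<in> W \<Longrightarrow> g y \<in> W'" "t \<in> V \<boxtimes> W"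
  shows "tensor_map V W f g t \<in> V' \<boxtimes> W'"
  by (rule tensor_image[OF linear_on_tensor_map subspace_tensor_space _ assms(3)])
    (simp add: tensor_map_tens assms tens_in_tensor_space)

end

lemma tensor_map_cong:
  fixes V W :: "('i, 'k::field) vec set" and f g f' g' :: "('i, 'k) vec \<Rightarrow> ('j, 'k) vec"
  assumes V: "vec.subspace V" and W: "vec.subspace W"
    and f: "linear_on V f" and g: "linear_on W g"
    and eq: "\<And>x. x \<in> V \<Longrightarrow> f x = f' x" "\<And>y. y \<in> W \<Longrightarrow> g y = g' y"
  shows "tensor_map V W f g = tensor_map V W f' g'"
proof (rule extensionalityI[of _ "V \<boxtimes> W"])
  have f': "linear_on V f'" and g': "linear_on W g'"
    using f g eq linear_on_cong[OF V] linear_on_cong[OF W] by blast+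
  show "tensor_map V W f g \<in> extensional (V \<boxtimes> W)" "tensor_map V W f' g' \<in> extensional (V \<boxtimes> W)"
    using tensor_map_extensional[OF V W f g] tensor_map_extensional[OF V W f' g'] by auto
  show "tensor_map V W f g t = tensor_map V W f' g' t" if "t \<in> V \<boxtimes> W" for t
    by (rule tensor_eqI[OF linear_on_tensor_map[OF V W f g] linear_on_tensor_map[OF V W f' g'] _ that])
      (simp add: eq tensor_map_tens[OF V W f g] tensor_map_tens[OF V W f' g'])
qed

lemma tensor_map_comp:
  fixes V W V' W' :: "('i, 'k::field) vec set"
  assumes V: "vec.subspace V" and W: "vec.subspace W"
    and f: "linear_on V f" "f \<in> V \<rightarrow> V'" and g: "linear_on W g" "g \<in> W \<rightarrow> W'"
    and V': "vec.subspace V'" and W': "vec.subspace W'"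
    and f': "linear_on V' f'" and g': "linear_on W' g'" and t: "t \<in> V \<boxtimes> W"
  shows "tensor_map V' W' f' g' (tensor_map V W f g t) =
    tensor_map V W (\<lambda>x. f' (f x)) (\<lambda>y. g' (g y)) t"
proof -
  note l = linear_on_compose[OF f f'] linear_on_compose[OF g g']
  have *: "tensor_map V W f g \<in> V \<boxtimes> W \<rightarrow> V' \<boxtimes> W'"
    using tensor_map_in[OF V W f(1) g(1)] f(2) g(2) by blast
  show ?thesis
    by (rule tensor_eqI[OF linear_on_compose[OF linear_on_tensor_map[OF V W f(1) g(1)] *
          linear_on_tensor_map[OF V' W' f' g']] linear_on_tensor_map[OF V W l] _ t])
      (use f(2) g(2) in \<open>simp add: tensor_map_tens[OF V W f(1) g(1)]
        tensor_map_tens[OF V' W' f' g'] tensor_map_tens[OF V W l] Pi_iff\<close>)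
qed

text \<open>Meant for use inside a further \<open>tensor_lift\<close>: the product of a tensor
  algebra and the action of \<open>H \<boxtimes> B\<close> both lift a tensor map whose factors
  depend on the acting elements, and this dependence must itself be linear.\<close>

lemma tensor_map_linear_left:
  fixes V W :: "('i, 'k::field) vec set" and f :: "('a \<Rightarrow> 'k) \<Rightarrow> ('i, 'k) vec \<Rightarrow> ('j, 'k) vec"
  assumes V: "vec.subspace V" and W: "vec.subspace W" and U: "vec.subspace U"
    and f: "bilinear_on U V f" and g: "linear_on W g" and t: "t \<in> V \<boxtimes> W"
  shows "linear_on U (\<lambda>h. tensor_map V W (f h) g t)"
proof -
  have f1: "linear_on V (f h)" if "h \<in> U" for h using f that by (simp add: bilinear_on_def)
  note l = linear_on_tensor_map[OF V W f1 g] and p = tensor_map_tens[OF V W f1 g]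
  have f2: "linear_on U (\<lambda>h. f h x)" if "x \<in> V" for x using f that by (simp add: bilinear_on_def)
  show ?thesis
    unfolding linear_on_def
  proof (intro conjI ballI allI)
    fix h h' assume h: "h \<in> U" "h' \<in> U"
    then have s: "h + h' \<in> U" using U by (simp add: vec.subspace_add)
    show "tensor_map V W (f (h + h')) g t = tensor_map V W (f h) g t + tensor_map V W (f h') g t"
      by (rule tensor_eqI[OF l[OF s] linear_on_add[OF l[OF h(1)] l[OF h(2)]] _ t])
        (simp add: p h s linear_onD(1)[OF f2] tens_add_left)
  next
    fix c h assume h: "h \<in> U"
    then have s: "scale c h \<in> U" using U by (simp add: vec.subspace_scale)
    show "tensor_map V W (f (scale c h)) g t = scale c (tensor_map V W (f h) g t)"
      by (rule tensor_eqI[OF l[OF s] linear_on_scale[OF l[OF h]] _ t])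
        (simp add: p h s linear_onD(2)[OF f2] tens_scale_left)
  qed
qed

lemma tensor_map_linear_right:
  fixes V W :: "('i, 'k::field) vec set" and g :: "('a \<Rightarrow> 'k) \<Rightarrow> ('i, 'k) vec \<Rightarrow> ('j, 'k) vec"
  assumes V: "vec.subspace V" and W: "vec.subspace W" and U: "vec.subspace U"
    and f: "linear_on V f" and g: "bilinear_on U W g" and t: "t \<in> V \<boxtimes> W"
  shows "linear_on U (\<lambda>h. tensor_map V W f (g h) t)"
proof -
  have g1: "linear_on W (g h)" if "h \<in> U" for h using g that by (simp add: bilinear_on_def)
  note l = linear_on_tensor_map[OF V W f g1] and p = tensor_map_tens[OF V W f g1]
  have g2: "linear_on U (\<lambda>h. g h x)" if "x \<in> W" for x using g that by (simp add: bilinear_on_def)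
  show ?thesis
    unfolding linear_on_def
  proof (intro conjI ballI allI)
    fix h h' assume h: "h \<in> U" "h' \<in> U"
    then have s: "h + h' \<in> U" using U by (simp add: vec.subspace_add)
    show "tensor_map V W f (g (h + h')) t = tensor_map V W f (g h) t + tensor_map V W f (g h') t"
      by (rule tensor_eqI[OF l[OF s] linear_on_add[OF l[OF h(1)] l[OF h(2)]] _ t])
        (simp add: p h s linear_onD(1)[OF g2] tens_add_right)
  next
    fix c h assume h: "h \<in> U"
    then have s: "scale c h \<in> U" using U by (simp add: vec.subspace_scale)
    show "tensor_map V W f (g (scale c h)) t = scale c (tensor_map V W f (g h) t)"
      by (rule tensor_eqI[OF l[OF s] linear_on_scale[OF l[OF h]] _ t])
        (simp add: p h s linear_onD(2)[OF g2] tens_scale_right)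
  qed
qed

lemma bilinear_on_tensor_map:
  fixes V W :: "('i, 'k::field) vec set"
    and f :: "('a \<Rightarrow> 'k) \<Rightarrow> ('i, 'k) vec \<Rightarrow> ('j, 'k) vec"
    and g :: "('b \<Rightarrow> 'k) \<Rightarrow> ('i, 'k) vec \<Rightarrow> ('j, 'k) vec"
  assumes "vec.subspace V" "vec.subspace W" "vec.subspace S" "vec.subspace T"
    and "bilinear_on S V f" "bilinear_on T W g" and "t \<in> V \<boxtimes> W"
  shows "bilinear_on S T (\<lambda>h b. tensor_map V W (f h) (g b) t)"
  using assms
  by (intro bilinear_onI tensor_map_linear_left tensor_map_linear_right)
    (auto simp: bilinear_on_def)

context
  fixes U V W :: "('i, 'k::field) vec set"
  assumes U: "vec.subspace U" and V: "vec.subspace V" and W: "vec.subspace W"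
begin

lemma bilinear_on_assoc_inner: "bilinear_on U V (\<lambda>x y. x \<odot> y \<odot> z)"
  by (simp add: bilinear_on_def linear_on_def tens_add_left tens_add_right
      tens_scale_left tens_scale_right)

text \<open>\<open>tensor_assoc\<close> is a lift of a lift. Linearity of the inner lift in the
  outer argument \<open>z\<close> is compared on the generators of
  \<open>U \<boxtimes> V\<close>.\<close>

lemma bilinear_on_assoc_outer:
  "bilinear_on (U \<boxtimes> V) W (\<lambda>t z. tensor_lift U V (\<lambda>x y. x \<odot> y \<odot> z) t)"
proof (rule bilinear_onI)
  note l = tensor_lift(2)[OF U V bilinear_on_assoc_inner]
    and p = tensor_lift(3)[OF U V bilinear_on_assoc_inner]
  fix t assume t: "t \<in> U \<boxtimes> V"
  show "linear_on W (\<lambda>z. tensor_lift U V (\<lambda>x y. x \<odot> y \<odot> z) t)"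
    unfolding linear_on_def
  proof (intro conjI ballI allI)
    fix z z'
    show "tensor_lift U V (\<lambda>x y. x \<odot> y \<odot> (z + z')) t =
      tensor_lift U V (\<lambda>x y. x \<odot> y \<odot> z) t + tensor_lift U V (\<lambda>x y. x \<odot> y \<odot> z') t"
      by (rule tensor_eqI[OF l linear_on_add[OF l l] _ t]) (simp only: p, simp add: tens_add_right)
  next
    fix c z
    show "tensor_lift U V (\<lambda>x y. x \<odot> y \<odot> scale c z) t =
      scale c (tensor_lift U V (\<lambda>x y. x \<odot> y \<odot> z) t)"
      by (rule tensor_eqI[OF l linear_on_scale[OF l] _ t]) (simp only: p, simp add: tens_scale_right)
  qed
qed (rule tensor_lift(2)[OF U V bilinear_on_assoc_inner])

lemma tensor_assoc_extensional: "tensor_assoc U V W \<in> extensional ((U \<boxtimes> V) \<boxtimes> W)"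
  and linear_on_tensor_assoc: "linear_on ((U \<boxtimes> V) \<boxtimes> W) (tensor_assoc U V W)"
  unfolding tensor_assoc_def
  using tensor_lift(1,2)[OF subspace_tensor_space W bilinear_on_assoc_outer] by auto

lemma tensor_assoc_tens:
  "x \<in> U \<Longrightarrow> y \<in> V \<Longrightarrow> z \<in> W \<Longrightarrow> tensor_assoc U V W ((x \<odot> y) \<odot> z) = x \<odot> y \<odot> z"
  unfolding tensor_assoc_def
  using tensor_lift(3)[OF subspace_tensor_space W bilinear_on_assoc_outer]
    tensor_lift(3)[OF U V bilinear_on_assoc_inner] by (simp add: tens_in_tensor_space)

lemma tensor_assoc_in:
  assumes t: "t \<in> (U \<boxtimes> V) \<boxtimes> W"
  shows "tensor_assoc U V W t \<in> U \<boxtimes> V \<boxtimes> W"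
proof (rule tensor_image[OF linear_on_tensor_assoc subspace_tensor_space _ t])
  fix r z assume r: "r \<in> U \<boxtimes> V" and z: "z \<in> W"
  have *: "(\<lambda>r. r \<odot> z) \<in> (U \<boxtimes> V) \<rightarrow> (U \<boxtimes> V) \<boxtimes> W"
    using z by (auto intro: tens_in_tensor_space)
  show "tensor_assoc U V W (r \<odot> z) \<in> U \<boxtimes> V \<boxtimes> W"
    by (rule tensor_image[OF linear_on_compose[OF linear_on_tens_left * linear_on_tensor_assoc]
          subspace_tensor_space _ r])
      (auto simp: tensor_assoc_tens z intro!: tens_in_tensor_space)
qed

end

subsection \<open>Coordinate spaces\<close>

text \<open>Subspaces with a basis of coordinate vectors. Group algebras, their tensor powers, the
  unit object and the regular modules have this form; the space of an arbitrary module need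
  not.\<close>

definition coord_space :: "'i idx set \<Rightarrow> ('i, 'k::field) vec set" where
  "coord_space S = vec.span (single ` S)"

lemma subspace_coord_space: "vec.subspace (coord_space S)"
  by (simp add: coord_space_def)

lemma single_in_coord_space: "p \<in> S \<Longrightarrow> single p \<in> coord_space S"
  by (simp add: coord_space_def vec.span_base)

lemma group_span_eq: "group_span L = coord_space (Base ` L)"
  by (simp add: group_span_def coord_space_def image_image grp_def[abs_def])

lemma inj_single: "inj (single :: 'i idx \<Rightarrow> ('i, 'k::field) vec)"
  by (rule injI) (auto simp: single_def fun_eq_iff split: if_splits)

lemma single_eq_iff: "(single p :: ('i, 'k::field) vec) = single q \<longleftrightarrow> p = q"
  by (auto dest: injD[OF inj_single])

lemma coord_space_eqI:
  assumes "linear_on (coord_space S) f" "linear_on (coord_space S) g"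
    and "\<And>p. p \<in> S \<Longrightarrow> f (single p) = g (single p)" and "x \<in> coord_space S"
  shows "f x = g x"
  by (rule linear_on_span_eq[OF assms(1,2)[unfolded coord_space_def] _
      assms(4)[unfolded coord_space_def]]) (use assms(3) in auto)

lemma coord_space_image:
  assumes "linear_on (coord_space S) f" "vec.subspace U"
    and "\<And>p. p \<in> S \<Longrightarrow> f (single p) \<in> U" and "x \<in> coord_space S"
  shows "f x \<in> U"
  by (rule linear_on_span_image[OF assms(1)[unfolded coord_space_def] assms(2) _
      assms(4)[unfolded coord_space_def]]) (use assms(3) in auto)

lemma tens_single: "single p \<odot> single q = single (Node p q)"
  by (auto simp: tens_def single_def fun_eq_iff split: idx.split)

lemma tensor_coord_space:
  "(coord_space S \<boxtimes> coord_space T :: ('i, 'k::field) vec set) =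
    coord_space {Node p q | p q. p \<in> S \<and> q \<in> T}" (is "?V \<boxtimes> ?W = coord_space ?N")
proof
  have 1: "x \<odot> single q \<in> coord_space ?N" if "x \<in> ?V" "q \<in> T" for x q
    by (rule coord_space_image[OF linear_on_tens_left subspace_coord_space _ that(1)])
      (use that in \<open>auto simp: tens_single intro!: single_in_coord_space\<close>)
  have 2: "x \<odot> y \<in> coord_space ?N" if "x \<in> ?V" "y \<in> ?W" for x y
    by (rule coord_space_image[OF linear_on_tens_right subspace_coord_space _ that(2)])
      (rule 1[OF that(1)])
  show "?V \<boxtimes> ?W \<subseteq> coord_space ?N"
    unfolding tensor_space_def by (rule vec.span_minimal) (use 2 subspace_coord_space in auto)
  show "coord_space ?N \<subseteq> ?V \<boxtimes> ?W"
    unfolding coord_space_def[of ?N]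
    by (rule vec.span_minimal)
      (auto simp: tens_single[symmetric] subspace_tensor_space
        intro!: tens_in_tensor_space single_in_coord_space)
qed

lemma coord_space_zero_outside: "x \<in> coord_space S \<Longrightarrow> p \<notin> S \<Longrightarrow> x p = 0"
proof -
  assume x: "x \<in> coord_space S" and p: "p \<notin> S"
  have "(\<lambda>x. scale (x p) (single p)) x = (0 :: ('a, 'b) vec)"
    by (rule coord_space_eqI[OF linear_on_eval_scale linear_on_const_zero _ x])
      (use p in \<open>auto simp: single_def scale_def fun_eq_iff\<close>)
  then have "scale (x p) (single p) p = (0 :: ('a, 'b) vec) p" by (rule fun_cong)
  then show ?thesis by (simp add: scale_def single_def)
qed

lemma coord_space_expand:
  assumes S: "finite S" and x: "x \<in> coord_space S"
  shows "x = (\<Sum>p\<in>S. scale (x p) (single p))"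
proof (rule coord_space_eqI[OF linear_on_id linear_on_sum_fun[OF linear_on_eval_scale] _ x])
  fix p assume p: "p \<in> S"
  have "(\<Sum>q\<in>S. scale (single p q) (single q)) = (\<Sum>q\<in>S. if q = p then single p else (0::('a,'b) vec))"
    by (rule sum.cong) (auto simp: single_def scale_def fun_eq_iff)
  with S p show "single p = (\<Sum>q\<in>S. scale (single p q) (single q :: ('a,'b) vec))"
    by simp
qed

lemma sum_scale_single:
  "finite S \<Longrightarrow> p \<in> S \<Longrightarrow> (\<Sum>q\<in>S. scale (single p q) (f q)) = f p"
  for f :: "'i idx \<Rightarrow> ('a \<Rightarrow> 'k::field)"
proof -
  assume S: "finite S" "p \<in> S"
  have "(\<Sum>q\<in>S. scale (single p q) (f q)) = (\<Sum>q\<in>S. if q = p then f p else 0)"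
    by (rule sum.cong) (auto simp: single_def scale_def fun_eq_iff)
  with S show ?thesis by simp
qed

text \<open>Extension from a finite basis, restricted to its span because elements of
  \<open>mod_hom\<close> are extensional.\<close>

definition lin_ext :: "'i idx set \<Rightarrow> ('i idx \<Rightarrow> ('a \<Rightarrow> 'k::field)) \<Rightarrow> ('i, 'k) vec \<Rightarrow> ('a \<Rightarrow> 'k)" where
  "lin_ext S f = (\<lambda>x\<in>coord_space S. \<Sum>p\<in>S. scale (x p) (f p))"

lemma lin_ext_extensional: "lin_ext S f \<in> extensional (coord_space S)"
  by (simp add: lin_ext_def)

lemma linear_on_lin_ext: "linear_on (coord_space S) (lin_ext S f)"
proof -
  have "linear_on (coord_space S) (\<lambda>x. \<Sum>p\<in>S. scale (x p) (f p))"
    by (intro linear_on_sum_fun linear_on_eval_scale)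
  then show ?thesis
    by (subst linear_on_cong[OF subspace_coord_space, of _ _ "\<lambda>x. \<Sum>p\<in>S. scale (x p) (f p)"])
      (simp_all add: lin_ext_def)
qed

lemma lin_ext_single: "finite S \<Longrightarrow> p \<in> S \<Longrightarrow> lin_ext S f (single p) = f p"
  by (simp add: lin_ext_def single_in_coord_space sum_scale_single)

lemma lin_ext_in:
  "vec.subspace U \<Longrightarrow> (\<And>p. p \<in> S \<Longrightarrow> f p \<in> U) \<Longrightarrow> x \<in> coord_space S \<Longrightarrow> lin_ext S f x \<in> U"
  by (simp add: lin_ext_def vec.subspace_sum vec.subspace_scale)

text \<open>Pairing of the first tensor factor with the coordinate functional at \<open>p\<close>:
  the coefficient of \<open>single p\<close>, as a vector of the second factor.\<close>

definition slice :: "'i idx \<Rightarrow> ('i, 'k::field) vec \<Rightarrow> ('i, 'k) vec" where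
  "slice p t = (\<lambda>q. t (Node p q))"

lemma linear_on_slice: "linear_on V (slice p)"
  by (simp add: linear_on_def slice_def scale_def fun_eq_iff)

lemma slice_tens: "slice p (x \<odot> y) = scale (x p) y"
  by (simp add: slice_def tens_def scale_def)

lemma slice_in: "vec.subspace W \<Longrightarrow> t \<in> V \<boxtimes> W \<Longrightarrow> slice p t \<in> W"
  by (rule tensor_image[OF linear_on_slice]) (auto simp: slice_tens vec.subspace_scale)

text \<open>Coordinates are used in the first factor alone, so the expansion is available when the
  second factor is the space of an unknown module, such as the value of a functor.\<close>

lemma tensor_coord_expand:
  assumes S: "finite S" and t: "t \<in> coord_space S \<boxtimes> W"
  shows "t = (\<Sum>p\<in>S. single p \<odot> slice p t)"
proof (rule tensor_eqI[OF linear_on_id linear_on_sum_fun _ t])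
  show "linear_on (coord_space S \<boxtimes> W) (\<lambda>t. single p \<odot> slice p t)" for p
    by (rule linear_on_compose[OF linear_on_slice _ linear_on_tens_right]) auto
  fix x y assume x: "x \<in> coord_space S"
  show "x \<odot> y = (\<Sum>p\<in>S. single p \<odot> slice p (x \<odot> y))"
  proof (rule coord_space_eqI[OF linear_on_tens_left linear_on_sum_fun _ x])
    show "linear_on (coord_space S) (\<lambda>x. single p \<odot> slice p (x \<odot> y))" for p
      unfolding slice_tens tens_scale_right by (rule linear_on_eval_scale)
  qed (use S in \<open>simp add: slice_tens tens_scale_right sum_scale_single\<close>)
qed

section \<open>Tensor products of algebras\<close>

text \<open>On pure tensors the lift is \<open>\<beta> t x y\<close>, linear in \<open>t\<close> by
  assumption, and generators decide. This gives linearity of an operation defined by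
  \<open>tensor_lift\<close> in the argument that is not lifted.\<close>

lemma tensor_lift_linear_param:
  fixes V W :: "('i, 'k::field) vec set"
    and \<beta> :: "('b \<Rightarrow> 'k) \<Rightarrow> ('i, 'k) vec \<Rightarrow> ('i, 'k) vec \<Rightarrow> ('a \<Rightarrow> 'k)"
  assumes V: "vec.subspace V" and W: "vec.subspace W" and T: "vec.subspace T"
    and \<beta>: "\<And>t. t \<in> T \<Longrightarrow> bilinear_on V W (\<beta> t)"
    and lin: "\<And>x y. x \<in> V \<Longrightarrow> y \<in> W \<Longrightarrow> linear_on T (\<lambda>t. \<beta> t x y)" and w: "w \<in> V \<boxtimes> W"
  shows "linear_on T (\<lambda>t. tensor_lift V W (\<beta> t) w)"
  unfolding linear_on_def
proof (intro conjI ballI allI)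
  note l = tensor_lift(2)[OF V W \<beta>] and p = tensor_lift(3)[OF V W \<beta>]
  fix t t' assume t: "t \<in> T" "t' \<in> T"
  then have s: "t + t' \<in> T" using T by (simp add: vec.subspace_add)
  show "tensor_lift V W (\<beta> (t + t')) w = tensor_lift V W (\<beta> t) w + tensor_lift V W (\<beta> t') w"
    by (rule tensor_eqI[OF l[OF s] linear_on_add[OF l[OF t(1)] l[OF t(2)]] _ w])
      (simp add: p t s linear_onD(1)[OF lin])
next
  note l = tensor_lift(2)[OF V W \<beta>] and p = tensor_lift(3)[OF V W \<beta>]
  fix c t assume t: "t \<in> T"
  then have s: "scale c t \<in> T" using T by (simp add: vec.subspace_scale)
  show "tensor_lift V W (\<beta> (scale c t)) w = scale c (tensor_lift V W (\<beta> t) w)"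
    by (rule tensor_eqI[OF l[OF s] linear_on_scale[OF l[OF t]] _ w])
      (simp add: p t s linear_onD(2)[OF lin])
qed

lemma is_algebraD:
  assumes "is_algebra A"
  shows "monoid A" "vec.subspace (carrier A)" "bilinear_on (carrier A) (carrier A) (\<lambda>a b. a \<otimes>\<^bsub>A\<^esub> b)"
  using assms by (auto simp: is_algebra_def)

context
  fixes A :: "(('i, 'k::field) vec, 'm) monoid_scheme" and B :: "(('i, 'k) vec, 'n) monoid_scheme"
  assumes A: "is_algebra A" and B: "is_algebra B"
begin

lemma bilinear_on_tensor_mult_aux:
  assumes "w \<in> carrier A \<boxtimes> carrier B"
  shows "bilinear_on (carrier A) (carrier B) (\<lambda>a b. tensor_map (carrier A) (carrier B)
    (\<lambda>a'. a \<otimes>\<^bsub>A\<^esub> a') (\<lambda>b'. b \<otimes>\<^bsub>B\<^esub> b') w)"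
  by (rule bilinear_on_tensor_map) (use assms is_algebraD[OF A] is_algebraD[OF B] in auto)

lemma bilinear_on_tensor_mult:
  "bilinear_on (carrier A \<boxtimes> carrier B) (carrier A \<boxtimes> carrier B)
    (\<lambda>v w. v \<otimes>\<^bsub>tensor_algebra A B\<^esub> w)"
proof (rule bilinear_onI)
  note bA = bilinear_onD(1)[OF is_algebraD(3)[OF A]] and bB = bilinear_onD(1)[OF is_algebraD(3)[OF B]]
  fix v assume "v \<in> carrier A \<boxtimes> carrier B"
  then show "linear_on (carrier A \<boxtimes> carrier B) (\<lambda>w. v \<otimes>\<^bsub>tensor_algebra A B\<^esub> w)"
    unfolding tensor_algebra_def monoid.select_convs
    by (intro tensor_lift_linear_param is_algebraD(2)[OF A] is_algebraD(2)[OF B]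
        subspace_tensor_space bilinear_on_tensor_mult_aux linear_on_tensor_map bA bB)
next
  fix w assume w: "w \<in> carrier A \<boxtimes> carrier B"
  show "linear_on (carrier A \<boxtimes> carrier B) (\<lambda>v. v \<otimes>\<^bsub>tensor_algebra A B\<^esub> w)"
    unfolding tensor_algebra_def monoid.select_convs
    by (rule tensor_lift(2)[OF is_algebraD(2)[OF A] is_algebraD(2)[OF B]
          bilinear_on_tensor_mult_aux[OF w]])
qed

lemma tensor_mult_tens:
  assumes "a \<in> carrier A" "a' \<in> carrier A" "b \<in> carrier B" "b' \<in> carrier B"
  shows "(a \<odot> b) \<otimes>\<^bsub>tensor_algebra A B\<^esub> (a' \<odot> b') = (a \<otimes>\<^bsub>A\<^esub> a') \<odot> (b \<otimes>\<^bsub>B\<^esub> b')"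
proof -
  note bA = bilinear_onD(1)[OF is_algebraD(3)[OF A]] and bB = bilinear_onD(1)[OF is_algebraD(3)[OF B]]
  show ?thesis
    unfolding tensor_algebra_def monoid.select_convs
    using assms tensor_lift(3)[OF is_algebraD(2)[OF A] is_algebraD(2)[OF B]
        bilinear_on_tensor_mult_aux[OF tens_in_tensor_space[OF assms(2,4)]] assms(1,3)]
      tensor_map_tens[OF is_algebraD(2)[OF A] is_algebraD(2)[OF B] bA bB, of a b a' b'] by simp
qed

end

lemma tensor_algebra_simps [simp]:
  "carrier (tensor_algebra A B) = carrier A \<boxtimes> carrier B"
  "\<one>\<^bsub>tensor_algebra A B\<^esub> = \<one>\<^bsub>A\<^esub> \<odot> \<one>\<^bsub>B\<^esub>"
  by (simp_all add: tensor_algebra_def)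

text \<open>The monoid algebra of \<open>P\<close>, in abstract form: the algebra axioms and
  multiplicativity of linear maps reduce to \<open>P\<close>. The class contains the group and
  subgroup algebras and is closed under tensor products, so it covers every algebra in which a
  product is computed below.\<close>

locale basis_algebra = P: monoid P
  for P :: "('i idx, 'l) monoid_scheme" and A :: "(('i, 'k::field) vec, 'm) monoid_scheme" +
  assumes carrier_eq: "carrier A = coord_space (carrier P)"
    and bilinear: "bilinear_on (carrier A) (carrier A) (\<lambda>a b. a \<otimes>\<^bsub>A\<^esub> b)"
    and mult_single: "p \<in> carrier P \<Longrightarrow> q \<in> carrier P \<Longrightarrow>
      single p \<otimes>\<^bsub>A\<^esub> single q = single (p \<otimes>\<^bsub>P\<^esub> q)"
    and one_eq: "\<one>\<^bsub>A\<^esub> = single \<one>\<^bsub>P\<^esub>"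
begin

lemma subspace_carrier: "vec.subspace (carrier A)"
  by (simp add: carrier_eq subspace_coord_space)

lemma single_carrier: "p \<in> carrier P \<Longrightarrow> single p \<in> carrier A"
  by (simp add: carrier_eq single_in_coord_space)

lemmas linear_mult_right = bilinear_onD(1)[OF bilinear]
lemmas linear_mult_left = bilinear_onD(2)[OF bilinear]

lemma mult_closed:
  assumes x: "x \<in> carrier A" and y: "y \<in> carrier A"
  shows "x \<otimes>\<^bsub>A\<^esub> y \<in> carrier A"
proof -
  have 1: "x \<otimes>\<^bsub>A\<^esub> single q \<in> carrier A" if q: "q \<in> carrier P" for q
    by (rule coord_space_image[OF linear_mult_left[unfolded carrier_eq] subspace_carrier _
          x[unfolded carrier_eq]])
      (simp_all add: q single_in_coord_space mult_single single_carrier)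
  show ?thesis
    by (rule coord_space_image[OF linear_mult_right[unfolded carrier_eq] subspace_carrier _
          y[unfolded carrier_eq]])
      (use x 1 in \<open>simp_all add: carrier_eq\<close>)
qed

lemma eqI:
  assumes "linear_on (carrier A) f" "linear_on (carrier A) g"
    and "\<And>p. p \<in> carrier P \<Longrightarrow> f (single p) = g (single p)" and "x \<in> carrier A"
  shows "f x = g x"
  using coord_space_eqI[of "carrier P" f g x] assms by (simp add: carrier_eq)

lemma is_algebra: "is_algebra A"
  unfolding is_algebra_def
proof (intro conjI subspace_carrier bilinear monoidI mult_closed)
  note ll = linear_on_compose[OF linear_mult_left _ linear_mult_left]
    and rr = linear_on_compose[OF linear_mult_right _ linear_mult_right]
    and lr = linear_on_compose[OF linear_mult_left _ linear_mult_right]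
    and rl = linear_on_compose[OF linear_mult_right _ linear_mult_left]
  \<comment> \<open>Associativity is trilinear: basis vectors are replaced by general elements one
    argument at a time, from left to right.\<close>
  have a1: "(x \<otimes>\<^bsub>A\<^esub> single q) \<otimes>\<^bsub>A\<^esub> single r = x \<otimes>\<^bsub>A\<^esub> (single q \<otimes>\<^bsub>A\<^esub> single r)"
    if "x \<in> carrier A" "q \<in> carrier P" "r \<in> carrier P" for x q r
    by (rule eqI[OF ll linear_mult_left _ that(1)])
      (use that in \<open>auto simp: single_carrier mult_closed mult_single P.m_assoc\<close>)
  have a2: "(x \<otimes>\<^bsub>A\<^esub> y) \<otimes>\<^bsub>A\<^esub> single r = x \<otimes>\<^bsub>A\<^esub> (y \<otimes>\<^bsub>A\<^esub> single r)"
    if "x \<in> carrier A" "y \<in> carrier A" "r \<in> carrier P" for x y r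
    by (rule eqI[OF rl lr _ that(2)])
      (use that in \<open>auto simp: single_carrier mult_closed a1\<close>)
  show "(x \<otimes>\<^bsub>A\<^esub> y) \<otimes>\<^bsub>A\<^esub> z = x \<otimes>\<^bsub>A\<^esub> (y \<otimes>\<^bsub>A\<^esub> z)"
    if "x \<in> carrier A" "y \<in> carrier A" "z \<in> carrier A" for x y z
    by (rule eqI[OF linear_mult_right rr _ that(3)])
      (use that in \<open>auto simp: single_carrier mult_closed a2\<close>)
  show "\<one>\<^bsub>A\<^esub> \<in> carrier A" by (simp add: one_eq single_carrier)
  show "\<one>\<^bsub>A\<^esub> \<otimes>\<^bsub>A\<^esub> x = x" if "x \<in> carrier A" for x
    by (rule eqI[OF linear_mult_right linear_on_id _ that])
      (simp_all add: one_eq single_carrier mult_single)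
  show "x \<otimes>\<^bsub>A\<^esub> \<one>\<^bsub>A\<^esub> = x" if "x \<in> carrier A" for x
    by (rule eqI[OF linear_mult_left linear_on_id _ that])
      (simp_all add: one_eq single_carrier mult_single)
qed

lemma algebra_homI:
  assumes B: "is_algebra B" and f: "linear_on (carrier A) f"
    and c: "\<And>p. p \<in> carrier P \<Longrightarrow> f (single p) \<in> carrier B"
    and m: "\<And>p q. p \<in> carrier P \<Longrightarrow> q \<in> carrier P \<Longrightarrow>
      f (single (p \<otimes>\<^bsub>P\<^esub> q)) = f (single p) \<otimes>\<^bsub>B\<^esub> f (single q)"
    and o: "f (single \<one>\<^bsub>P\<^esub>) = \<one>\<^bsub>B\<^esub>"
  shows "algebra_hom A B f"
  unfolding algebra_hom_def
proof (intro conjI f homI)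
  interpret B: monoid B by (rule is_algebraD(1)[OF B])
  show fc: "f x \<in> carrier B" if "x \<in> carrier A" for x
    by (rule coord_space_image[OF f[unfolded carrier_eq] is_algebraD(2)[OF B] c])
      (use that in \<open>simp_all add: carrier_eq\<close>)
  have fc': "f \<in> carrier A \<rightarrow> carrier B" using fc by blast
  have 1: "f (x \<otimes>\<^bsub>A\<^esub> single q) = f x \<otimes>\<^bsub>B\<^esub> f (single q)"
    if x: "x \<in> carrier A" and q: "q \<in> carrier P" for x q
    by (rule eqI[OF linear_on_compose[OF linear_mult_left _ f]
          linear_on_compose[OF f fc' bilinear_onD(2)[OF is_algebraD(3)[OF B]]] _ x])
      (use q c in \<open>auto simp: single_carrier mult_closed mult_single m\<close>)
  show "f (x \<otimes>\<^bsub>A\<^esub> y) = f x \<otimes>\<^bsub>B\<^esub> f y" if x: "x \<in> carrier A" and y: "y \<in> carrier A" for x y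
    by (rule eqI[OF linear_on_compose[OF linear_mult_right _ f]
          linear_on_compose[OF f fc' bilinear_onD(1)[OF is_algebraD(3)[OF B]]] _ y])
      (use x fc in \<open>auto simp: mult_closed 1\<close>)
  show "f \<one>\<^bsub>A\<^esub> = \<one>\<^bsub>B\<^esub>" using o by (simp add: one_eq)
qed

end

text \<open>The product monoid, carried by the indices that label the basis of a tensor
  product.\<close>

definition node_monoid ::
  "('i idx, 'l) monoid_scheme \<Rightarrow> ('i idx, 'm) monoid_scheme \<Rightarrow> 'i idx monoid" where
  "node_monoid P Q = \<lparr>carrier = {Node p q | p q. p \<in> carrier P \<and> q \<in> carrier Q},
     monoid.mult = (\<lambda>r r'. case r of Node p q \<Rightarrow>
       (case r' of Node p' q' \<Rightarrow> Node (p \<otimes>\<^bsub>P\<^esub> p') (q \<otimes>\<^bsub>Q\<^esub> q') | _ \<Rightarrow> r) | _ \<Rightarrow> r),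
     monoid.one = Node \<one>\<^bsub>P\<^esub> \<one>\<^bsub>Q\<^esub>\<rparr>"

lemma basis_algebra_tensor:
  assumes "basis_algebra P A" "basis_algebra Q B"
  shows "basis_algebra (node_monoid P Q) (tensor_algebra A B)"
proof -
  interpret A: basis_algebra P A by fact
  interpret B: basis_algebra Q B by fact
  show ?thesis
  proof
    show "bilinear_on (carrier (tensor_algebra A B)) (carrier (tensor_algebra A B))
        (\<lambda>a b. a \<otimes>\<^bsub>tensor_algebra A B\<^esub> b)"
      using bilinear_on_tensor_mult[OF A.is_algebra B.is_algebra] by simp
    show "single p \<otimes>\<^bsub>tensor_algebra A B\<^esub> single q = single (p \<otimes>\<^bsub>node_monoid P Q\<^esub> q)"
      if "p \<in> carrier (node_monoid P Q)" "q \<in> carrier (node_monoid P Q)" for p q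
      using that tensor_mult_tens[OF A.is_algebra B.is_algebra]
      by (auto simp: node_monoid_def tens_single[symmetric] A.single_carrier B.single_carrier
          A.mult_single B.mult_single)
  qed (auto simp: node_monoid_def A.P.m_assoc B.P.m_assoc A.one_eq B.one_eq tens_single
      A.carrier_eq B.carrier_eq tensor_coord_space)
qed

section \<open>Group algebras\<close>

definition base_monoid :: "('g, 'm) monoid_scheme \<Rightarrow> 'g set \<Rightarrow> 'g idx monoid" where
  "base_monoid G L = \<lparr>carrier = Base ` L,
     monoid.mult = (\<lambda>p q. case p of Base x \<Rightarrow> (case q of Base y \<Rightarrow> Base (x \<otimes>\<^bsub>G\<^esub> y) | _ \<Rightarrow> p) | _ \<Rightarrow> p),
     monoid.one = Base \<one>\<^bsub>G\<^esub>\<rparr>"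

lemma base_monoid_simps [simp]:
  "carrier (base_monoid G L) = Base ` L" "\<one>\<^bsub>base_monoid G L\<^esub> = Base \<one>\<^bsub>G\<^esub>"
  "Base x \<otimes>\<^bsub>base_monoid G L\<^esub> Base y = Base (x \<otimes>\<^bsub>G\<^esub> y)"
  by (simp_all add: base_monoid_def)

lemma grp_apply: "grp x (Base y) = (if y = x then 1 else 0)"
  by (simp add: grp_def single_def)

lemma grp_in_group_span: "x \<in> L \<Longrightarrow> grp x \<in> group_span L"
  by (simp add: group_span_def vec.span_base)

lemma subspace_group_span: "vec.subspace (group_span L)"
  by (simp add: group_span_def)

lemma group_span_eqI:
  assumes "linear_on (group_span L) f" "linear_on (group_span L) g"
    and "\<And>x. x \<in> L \<Longrightarrow> f (grp x) = g (grp x)" and "v \<in> group_span L"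
  shows "f v = g v"
  by (rule linear_on_span_eq[OF assms(1,2)[unfolded group_span_def] _
      assms(4)[unfolded group_span_def]]) (use assms(3) in auto)

lemma group_span_image:
  assumes "linear_on (group_span L) f" "vec.subspace U"
    and "\<And>x. x \<in> L \<Longrightarrow> f (grp x) \<in> U" and "v \<in> group_span L"
  shows "f v \<in> U"
  by (rule linear_on_span_image[OF assms(1)[unfolded group_span_def] assms(2) _
      assms(4)[unfolded group_span_def]]) (use assms(3) in auto)

lemma group_algebra_simps [simp]:
  "carrier (group_algebra G) = group_span (carrier G)"
  "\<one>\<^bsub>group_algebra G\<^esub> = grp \<one>\<^bsub>G\<^esub>"
  by (simp_all add: group_algebra_def)

lemma subgroup_algebra_simps [simp]:
  "carrier (subgroup_algebra G L) = group_span L"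
  "\<one>\<^bsub>subgroup_algebra G L\<^esub> = grp \<one>\<^bsub>G\<^esub>"
  "x \<otimes>\<^bsub>subgroup_algebra G L\<^esub> y = x \<otimes>\<^bsub>group_algebra G\<^esub> y"
  "coact (subgroup_algebra G L) = comult (group_algebra G)"
  by (simp_all add: subgroup_algebra_def coideal_alg_def)

locale finite_group = group G for G (structure) +
  assumes fin: "finite (carrier G)"
begin

abbreviation "kG \<equiv> group_algebra G"
abbreviation "kS \<equiv> subgroup_algebra G"

lemma sum_grp_apply:
  fixes f :: "'a \<Rightarrow> 'c \<Rightarrow> 'k::field"
  assumes "x \<in> carrier G"
  shows "(\<Sum>g\<in>carrier G. scale (grp x (Base g)) (f g)) = f x"
proof -
  have "(\<Sum>g\<in>carrier G. scale (grp x (Base g)) (f g)) = (\<Sum>g\<in>carrier G. if g = x then f x else 0)"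
    by (rule sum.cong) (auto simp: grp_apply)
  then show ?thesis using fin assms by simp
qed

lemma bilinear_on_group_mult:
  "bilinear_on V W (\<lambda>x y. x \<otimes>\<^bsub>(kG :: ('a, 'k::field) hopf)\<^esub> y)"
proof (rule bilinear_onI)
  have l: "linear_on V (\<lambda>x. scale (x p * c) y)" "linear_on V (\<lambda>x. scale (c * x p) y)"
    for V and p :: "'a idx" and c and y :: "('a, 'k) vec"
    by (simp_all add: linear_on_def scale_def fun_eq_iff algebra_simps)
  show "linear_on W (\<lambda>y. x \<otimes>\<^bsub>(kG :: ('a, 'k) hopf)\<^esub> y)" for x
    unfolding group_algebra_def monoid.select_convs by (intro linear_on_sum_fun l)
  show "linear_on V (\<lambda>x. x \<otimes>\<^bsub>(kG :: ('a, 'k) hopf)\<^esub> y)" for y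
    unfolding group_algebra_def monoid.select_convs by (intro linear_on_sum_fun l)
qed

lemma grp_mult:
  assumes "x \<in> carrier G" "y \<in> carrier G"
  shows "grp x \<otimes>\<^bsub>kG\<^esub> grp y = (grp (x \<otimes> y) :: ('a, 'k::field) vec)"
proof -
  have "grp x \<otimes>\<^bsub>kG\<^esub> grp y = (\<Sum>g\<in>carrier G. scale (grp x (Base g))
      (\<Sum>h\<in>carrier G. scale (grp y (Base h)) (grp (g \<otimes> h) :: ('a, 'k) vec)))"
    by (simp add: group_algebra_def vec.scale_sum_right)
  also have "\<dots> = grp (x \<otimes> y)"
    using assms by (simp add: sum_grp_apply)
  finally show ?thesis .
qed

lemma linear_on_comult: "linear_on V (comult (kG :: ('a, 'k::field) hopf))"
  unfolding group_algebra_def by (simp add: linear_on_sum_fun linear_on_eval_scale)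

lemma comult_grp: "x \<in> carrier G \<Longrightarrow> comult kG (grp x) = grp x \<odot> grp x"
  by (simp add: group_algebra_def sum_grp_apply)

lemma linear_on_antipode: "linear_on V (antipode (kG :: ('a, 'k::field) hopf))"
  unfolding group_algebra_def by (simp add: linear_on_sum_fun linear_on_eval_scale)

lemma antipode_grp: "x \<in> carrier G \<Longrightarrow> antipode kG (grp x) = grp (inv x)"
  by (simp add: group_algebra_def sum_grp_apply)

lemma counit_grp: "x \<in> carrier G \<Longrightarrow> counit kG (grp x) = 1"
  using fin by (simp add: group_algebra_def grp_apply)

lemma counit_add: "counit kG (x + y) = counit kG x + counit kG y"
  and counit_scale: "counit kG (scale c x) = c * counit kG x"
  by (simp_all add: group_algebra_def sum.distrib scale_def sum_distrib_left)

lemma linear_on_counit_scale: "linear_on V (\<lambda>x. scale (counit kG x) y)"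
  by (simp add: linear_on_def counit_add counit_scale vec.scale_left_distrib)

lemma subgroup_basis_algebra:
  assumes "subgroup L G"
  shows "basis_algebra (base_monoid G L) (kS L :: ('a, 'k::field) comodule_alg)"
proof -
  interpret L: subgroup L G by fact
  show ?thesis
  proof
    show "bilinear_on (carrier (kS L)) (carrier (kS L))
       (\<lambda>a b. a \<otimes>\<^bsub>(kS L :: ('a, 'k) comodule_alg)\<^esub> b)"
      using bilinear_on_group_mult by simp
    show "single p \<otimes>\<^bsub>(kS L :: ('a, 'k) comodule_alg)\<^esub> single q =
        single (p \<otimes>\<^bsub>base_monoid G L\<^esub> q)"
      if "p \<in> carrier (base_monoid G L)" "q \<in> carrier (base_monoid G L)" for p q
      using that grp_mult[where ?'k = 'k] L.mem_carrier by (auto simp: grp_def)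
  qed (auto simp: group_span_eq grp_def m_assoc)
qed

lemma group_basis_algebra:
  "basis_algebra (base_monoid G (carrier G)) (kG :: ('a, 'k::field) hopf)"
proof
  show "bilinear_on (carrier kG) (carrier kG)
     (\<lambda>a b. a \<otimes>\<^bsub>(kG :: ('a, 'k) hopf)\<^esub> b)"
    using bilinear_on_group_mult by simp
  show "single p \<otimes>\<^bsub>(kG :: ('a, 'k) hopf)\<^esub> single q =
      single (p \<otimes>\<^bsub>base_monoid G (carrier G)\<^esub> q)"
    if "p \<in> carrier (base_monoid G (carrier G))" "q \<in> carrier (base_monoid G (carrier G))" for p q
    using that grp_mult[where ?'k = 'k] by (auto simp: grp_def)
qed (auto simp: group_span_eq grp_def m_assoc)

lemmas is_algebra_group = basis_algebra.is_algebra[OF group_basis_algebra]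
lemmas is_algebra_subgroup = basis_algebra.is_algebra[OF subgroup_basis_algebra]
lemmas group_group_basis = basis_algebra_tensor[OF group_basis_algebra group_basis_algebra]
lemmas group_subgroup_basis = basis_algebra_tensor[OF group_basis_algebra subgroup_basis_algebra]
lemmas group_group_subgroup_basis = basis_algebra_tensor[OF group_basis_algebra group_subgroup_basis]

lemma tensor_group_span_eqI:
  assumes f: "linear_on (group_span L \<boxtimes> group_span L') f"
    and g: "linear_on (group_span L \<boxtimes> group_span L') g"
    and eq: "\<And>x y. x \<in> L \<Longrightarrow> y \<in> L' \<Longrightarrow> f (grp x \<odot> grp y) = g (grp x \<odot> grp y)"
    and t: "t \<in> group_span L \<boxtimes> group_span L'"
  shows "f t = g t"
  by (rule coord_space_eqI[OF f[unfolded group_span_eq tensor_coord_space]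
        g[unfolded group_span_eq tensor_coord_space] _ t[unfolded group_span_eq tensor_coord_space]])
    (use eq in \<open>auto simp: grp_def tens_single\<close>)

lemma comult_in_tensor:
  assumes L: "L \<subseteq> carrier G" and b: "b \<in> group_span L"
  shows "comult kG b \<in> group_span (carrier G) \<boxtimes> group_span L"
  by (rule group_span_image[OF linear_on_comult subspace_tensor_space _ b])
    (use L in \<open>auto simp: comult_grp intro!: tens_in_tensor_space grp_in_group_span\<close>)

text \<open>Everything is linear in \<open>b\<close> and group elements are group-like: at
  \<open>grp x\<close> both sides of coassociativity become
  \<open>grp x \<odot> grp x \<odot> grp x\<close>.\<close>

lemma comodule_algebra_subgroup:
  assumes L: "subgroup L G"
  shows "comodule_algebra kG (kS L :: ('a, 'k::field) comodule_alg)"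
proof -
  let ?H = "kG :: ('a, 'k) hopf" and ?B = "kS L :: ('a, 'k) comodule_alg"
  interpret L: subgroup L G by fact
  interpret B: basis_algebra "base_monoid G L" ?B by (rule subgroup_basis_algebra[OF L])
  interpret HB: basis_algebra "node_monoid (base_monoid G (carrier G)) (base_monoid G L)"
    "tensor_algebra ?H ?B" by (rule group_subgroup_basis[OF L])
  have c: "comult ?H \<in> group_span (carrier G) \<rightarrow> group_span (carrier G) \<boxtimes> group_span (carrier G)"
    using comult_in_tensor[OF subset_refl] by blast
  have cL: "comult ?H \<in> group_span L \<rightarrow> group_span (carrier G) \<boxtimes> group_span L"
    using comult_in_tensor[OF L.subset] by blast
  have tm1: "tensor_map (group_span (carrier G)) (group_span L) (comult ?H) (\<lambda>x. x) \<in>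
    group_span (carrier G) \<boxtimes> group_span L \<rightarrow>
    (group_span (carrier G) \<boxtimes> group_span (carrier G)) \<boxtimes> group_span L"
    using tensor_map_in[OF subspace_group_span subspace_group_span linear_on_comult linear_on_id] c
    by blast
  have bl: "bilinear_on (group_span (carrier G)) (group_span L) (\<lambda>x y. scale (counit ?H x) y)"
    by (simp add: bilinear_on_def linear_on_counit_scale linear_on_scale linear_on_id)
  note t = tensor_map_tens[OF subspace_group_span subspace_group_span linear_on_comult linear_on_id]
    tensor_map_tens[OF subspace_group_span subspace_group_span linear_on_id linear_on_comult]
    tensor_assoc_tens[OF subspace_group_span subspace_group_span subspace_group_span]
    tensor_lift(3)[OF subspace_group_span subspace_group_span bl]
  note lc = linear_on_compose[OF linear_on_comult cL]
  show ?thesis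
    unfolding comodule_algebra_def
  proof (intro conjI ballI B.is_algebra)
    show "algebra_hom ?B (tensor_algebra ?H ?B) (coact ?B)"
    proof (rule B.algebra_homI[OF HB.is_algebra])
      fix p q assume "p \<in> carrier (base_monoid G L)" "q \<in> carrier (base_monoid G L)"
      then obtain x y where xy: "p = Base x" "q = Base y" "x \<in> L" "y \<in> L" by auto
      then show "coact ?B (single (p \<otimes>\<^bsub>base_monoid G L\<^esub> q)) =
          coact ?B (single p) \<otimes>\<^bsub>tensor_algebra ?H ?B\<^esub> coact ?B (single q)"
        using tensor_mult_tens[OF is_algebra_group is_algebra_subgroup[OF L],
            of "grp x :: ('a, 'k) vec" "grp y" "grp x" "grp y"]
        by (simp add: grp_def[symmetric] comult_grp grp_mult grp_in_group_span)
    qed (auto simp: linear_on_comult grp_def[symmetric] comult_grp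
        intro!: tens_in_tensor_space grp_in_group_span)
  next
    fix b assume b: "b \<in> carrier ?B"
    show "tensor_assoc (carrier ?H) (carrier ?H) (carrier ?B)
            (tensor_map (carrier ?H) (carrier ?B) (comult ?H) (\<lambda>x. x) (coact ?B b)) =
          tensor_map (carrier ?H) (carrier ?B) (\<lambda>x. x) (coact ?B) (coact ?B b)"
      unfolding group_algebra_simps subgroup_algebra_simps
      by (rule group_span_eqI[OF lc[OF linear_on_compose[OF linear_on_tensor_map tm1
              linear_on_tensor_assoc]] lc[OF linear_on_tensor_map] _ b[unfolded subgroup_algebra_simps]])
        (auto simp: subspace_group_span linear_on_comult linear_on_id comult_grp t
          grp_in_group_span tens_in_tensor_space)
    show "tensor_lift (carrier ?H) (carrier ?B) (\<lambda>x y. scale (counit ?H x) y) (coact ?B b) = b"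
      unfolding group_algebra_simps subgroup_algebra_simps
      by (rule group_span_eqI[OF lc[OF tensor_lift(2)[OF _ _ bl]] linear_on_id _
            b[unfolded subgroup_algebra_simps]])
        (auto simp: subspace_group_span comult_grp t grp_in_group_span counit_grp)
  qed
qed

end

section \<open>The R-matrix and the K-matrices\<close>

text \<open>The shape of \<open>R_matrix\<close>, kept through all calculations: linear maps send
  \<open>comb\<close> to \<open>comb\<close>, and a product of two becomes a 4 by 4 table. With the
  idempotents p = (1 + u)/2 and q = (1 - u)/2 the R-matrix is p tensor 1 plus q tensor u, which
  shows why its square is 1.\<close>

definition comb :: "('a \<Rightarrow> 'k::field) \<Rightarrow> ('a \<Rightarrow> 'k) \<Rightarrow> ('a \<Rightarrow> 'k) \<Rightarrow> ('a \<Rightarrow> 'k) \<Rightarrow> ('a \<Rightarrow> 'k)" where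
  "comb a b c d = scale (1 / 2) (a + b + c - d)"

lemma comb_in:
  "vec.subspace V \<Longrightarrow> a \<in> V \<Longrightarrow> b \<in> V \<Longrightarrow> c \<in> V \<Longrightarrow> d \<in> V \<Longrightarrow> comb a b c d \<in> V"
  unfolding comb_def by (intro vec.subspace_scale vec.subspace_add vec.subspace_diff)

lemma linear_on_comb:
  assumes V: "vec.subspace V" and f: "linear_on V f" and m: "a \<in> V" "b \<in> V" "c \<in> V" "d \<in> V"
  shows "f (comb a b c d) = comb (f a) (f b) (f c) (f d)"
proof -
  have "comb a b c d = scale (1 / 2) (a + b + c + scale (- 1) d)"
    by (simp add: comb_def scale_def fun_eq_iff)
  then have "f (comb a b c d) = f (scale (1 / 2) (a + b + c + scale (- 1) d))"
    by (rule arg_cong)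
  also have "\<dots> = scale (1 / 2) (f a + f b + f c + scale (- 1) (f d))"
    using m V by (simp add: linear_onD[OF f] vec.subspace_add vec.subspace_scale del: vec.scale_minus_left)
  also have "\<dots> = comb (f a) (f b) (f c) (f d)"
    by (simp add: comb_def scale_def fun_eq_iff)
  finally show ?thesis .
qed

lemma comb_swap: "comb a b c d = comb a c b d"
  by (simp add: comb_def add_ac)

lemma bilinear_on_comb:
  assumes V: "vec.subspace V" and W: "vec.subspace W" and \<beta>: "bilinear_on V W \<beta>"
    and m: "a \<in> V" "b \<in> V" "c \<in> V" "d \<in> V" "a' \<in> W" "b' \<in> W" "c' \<in> W" "d' \<in> W"
  shows "\<beta> (comb a b c d) (comb a' b' c' d') =
    comb (comb (\<beta> a a') (\<beta> a b') (\<beta> a c') (\<beta> a d')) (comb (\<beta> b a') (\<beta> b b') (\<beta> b c') (\<beta> b d'))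
      (comb (\<beta> c a') (\<beta> c b') (\<beta> c c') (\<beta> c d')) (comb (\<beta> d a') (\<beta> d b') (\<beta> d c') (\<beta> d d'))"
  using linear_on_comb[OF V bilinear_onD(2)[OF \<beta>], of "comb a' b' c' d'" a b c d]
    linear_on_comb[OF W bilinear_onD(1)[OF \<beta>]] m comb_in[OF W m(5-8)] by simp

context finite_group
begin

text \<open>Lets facts about \<open>kS L\<close> cover \<open>kG\<close> by taking \<open>L\<close>
  to be the whole group, although the two are records of different types.\<close>

lemma tensor_algebra_group:
  "tensor_algebra A (kS (carrier G)) = tensor_algebra A kG"
  by (simp add: tensor_algebra_def)

lemma hopf_algebra_group: "hopf_algebra (kG :: ('a, 'k::field) hopf)"
proof -
  let ?H = "kG :: ('a, 'k) hopf"
  let ?V = "group_span (carrier G) :: ('a, 'k) vec set"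
  \<comment> \<open>For the whole group the coaction is the comultiplication, so the comodule axioms
    already contain multiplicativity, coassociativity and the left counit law.\<close>
  have com: "algebra_hom (kS (carrier G)) (tensor_algebra ?H ?H) (comult ?H)"
    "\<And>b. b \<in> ?V \<Longrightarrow> tensor_assoc ?V ?V ?V (tensor_map ?V ?V (comult ?H) (\<lambda>x. x) (comult ?H b)) =
        tensor_map ?V ?V (\<lambda>x. x) (comult ?H) (comult ?H b) \<and>
        tensor_lift ?V ?V (\<lambda>x y. scale (counit ?H x) y) (comult ?H b) = b"
    using comodule_algebra_subgroup[OF subgroup_self, where ?'k = 'k]
    unfolding comodule_algebra_def tensor_algebra_group by auto
  have hom: "algebra_hom ?H (tensor_algebra ?H ?H) (comult ?H)"
    using com(1) by (simp add: algebra_hom_def hom_def)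
  have sub: "vec.subspace ?V" by (rule subspace_group_span)
  have cm: "comult ?H \<in> ?V \<rightarrow> ?V \<boxtimes> ?V" using comult_in_tensor[OF subset_refl] by blast
  note lc = linear_on_compose[OF linear_on_comult cm]
  note bm = bilinear_onD(1)[OF bilinear_on_group_mult UNIV_I] bilinear_onD(2)[OF bilinear_on_group_mult UNIV_I]
  have b1: "bilinear_on ?V ?V (\<lambda>x y. scale (counit ?H y) x)"
    by (simp add: bilinear_on_def linear_on_counit_scale linear_on_scale linear_on_id)
  have b2: "bilinear_on ?V ?V (\<lambda>x y. antipode ?H x \<otimes>\<^bsub>?H\<^esub> y)"
    by (intro bilinear_onI bm linear_on_compose[OF linear_on_antipode _ bm(2)[of UNIV]]) auto
  have b3: "bilinear_on ?V ?V (\<lambda>x y. x \<otimes>\<^bsub>?H\<^esub> antipode ?H y)"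
    by (intro bilinear_onI bm linear_on_compose[OF linear_on_antipode _ bm(1)[of UNIV]]) auto
  have anti: "antipode ?H \<in> ?V \<rightarrow> ?V"
    by (rule Pi_I, rule group_span_image[OF linear_on_antipode sub])
      (simp_all add: antipode_grp grp_in_group_span)
  have ax: "tensor_lift ?V ?V (\<lambda>x y. scale (counit ?H y) x) (comult ?H h) = h"
    "tensor_lift ?V ?V (\<lambda>x y. antipode ?H x \<otimes>\<^bsub>?H\<^esub> y) (comult ?H h) = scale (counit ?H h) (grp \<one>)"
    "tensor_lift ?V ?V (\<lambda>x y. x \<otimes>\<^bsub>?H\<^esub> antipode ?H y) (comult ?H h) = scale (counit ?H h) (grp \<one>)"
    if h: "h \<in> ?V" for h
    by (rule group_span_eqI[OF lc[OF tensor_lift(2)[OF sub sub b1]] linear_on_id _ h],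
        simp add: comult_grp tensor_lift(3)[OF sub sub b1] grp_in_group_span counit_grp)
      (rule group_span_eqI[OF lc[OF tensor_lift(2)[OF sub sub b2]] linear_on_counit_scale _ h],
        simp add: comult_grp tensor_lift(3)[OF sub sub b2] grp_in_group_span counit_grp antipode_grp grp_mult,
       rule group_span_eqI[OF lc[OF tensor_lift(2)[OF sub sub b3]] linear_on_counit_scale _ h],
        simp add: comult_grp tensor_lift(3)[OF sub sub b3] grp_in_group_span counit_grp antipode_grp grp_mult)
  \<comment> \<open>The counit takes values in the field, whereas the comparison lemmas concern
    vectors. Both sides are therefore multiplied by \<open>grp \<one>\<close>, and the coefficient
    is read off at the end.\<close>
  have cmult: "counit ?H (x \<otimes>\<^bsub>?H\<^esub> y) = counit ?H x * counit ?H y"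
    if x: "x \<in> ?V" and y: "y \<in> ?V" for x y
  proof -
    have ls: "linear_on ?V (\<lambda>x. scale (c * counit ?H x) z)" "linear_on ?V (\<lambda>x. scale (counit ?H x * c) z)"
      for c and z :: "('a, 'k) vec"
      unfolding linear_on_def counit_add counit_scale
      by (simp_all add: scale_def fun_eq_iff algebra_simps)
    have lm: "linear_on ?V (\<lambda>x. scale (counit ?H (x \<otimes>\<^bsub>?H\<^esub> y)) z)"
      "linear_on ?V (\<lambda>y. scale (counit ?H (x \<otimes>\<^bsub>?H\<^esub> y)) z)" for x y and z :: "('a, 'k) vec"
      by (rule linear_on_compose[OF bm(2) _ linear_on_counit_scale[of UNIV]], simp)
        (rule linear_on_compose[OF bm(1) _ linear_on_counit_scale[of UNIV]], simp)
    have 1: "scale (counit ?H (grp g \<otimes>\<^bsub>?H\<^esub> y)) (grp \<one>) = scale (counit ?H (grp g) * counit ?H y) (grp \<one> :: ('a, 'k) vec)"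
      if "g \<in> carrier G" for g
      by (rule group_span_eqI[OF lm(2) ls(1) _ y]) (use that in \<open>simp add: grp_mult counit_grp\<close>)
    have "scale (counit ?H (x \<otimes>\<^bsub>?H\<^esub> y)) (grp \<one>) = scale (counit ?H x * counit ?H y) (grp \<one> :: ('a, 'k) vec)"
      by (rule group_span_eqI[OF lm(1) ls(2) _ x]) (rule 1)
    then have "scale (counit ?H (x \<otimes>\<^bsub>?H\<^esub> y)) (grp \<one>) (Base \<one>) =
        scale (counit ?H x * counit ?H y) (grp \<one> :: ('a, 'k) vec) (Base \<one>)" by (rule fun_cong)
    then show ?thesis by (simp add: scale_def grp_apply)
  qed
  show ?thesis
    unfolding hopf_algebra_def group_algebra_simps
    by (intro conjI ballI allI is_algebra_group hom counit_add counit_scale cmult anti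
        linear_on_antipode ax conjunct1[OF com(2)] conjunct2[OF com(2)] counit_grp one_closed)
qed

lemma tensor_mult_grp:
  assumes L: "subgroup L G" and m: "a \<in> carrier G" "c \<in> carrier G" "b \<in> L" "d \<in> L"
  shows "(grp a \<odot> grp b) \<otimes>\<^bsub>tensor_algebra kG (kS L)\<^esub> (grp c \<odot> grp d) =
    (grp (a \<otimes> c) \<odot> grp (b \<otimes> d) :: ('a, 'k::field) vec)"
  using tensor_mult_tens[OF is_algebra_group is_algebra_subgroup[OF L],
      of "grp a :: ('a, 'k) vec" "grp c" "grp b" "grp d"] m subgroup.subset[OF L]
  by (simp add: grp_in_group_span grp_mult subset_iff)

lemma tensor_mult_grp3:
  assumes L: "subgroup L G"
    and m: "a \<in> carrier G" "a' \<in> carrier G" "b \<in> carrier G" "b' \<in> carrier G" "c \<in> L" "c' \<in> L"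
  shows "(grp a \<odot> grp b \<odot> grp c) \<otimes>\<^bsub>tensor_algebra kG
      (tensor_algebra kG (kS L))\<^esub> (grp a' \<odot> grp b' \<odot> grp c') =
    (grp (a \<otimes> a') \<odot> grp (b \<otimes> b') \<odot> grp (c \<otimes> c') :: ('a, 'k::field) vec)"
  using tensor_mult_tens[OF is_algebra_group
      basis_algebra.is_algebra[OF group_subgroup_basis[OF L]],
      of "grp a :: ('a, 'k) vec" "grp a'" "grp b \<odot> grp c" "grp b' \<odot> grp c'"] m
  by (simp add: grp_in_group_span grp_mult tensor_mult_grp[OF L] tens_in_tensor_space)

context
  fixes L assumes L: "subgroup L G"
begin

lemma bilinear_on_legs:
  "bilinear_on V W (\<lambda>x y. x \<odot> y \<odot> z)" "bilinear_on V W (\<lambda>x y. y \<odot> x \<odot> z)"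
  "bilinear_on V W (\<lambda>x b. x \<odot> z \<odot> b)" "bilinear_on V W (\<lambda>x b. z \<odot> x \<odot> b)"
  for z :: "('a, 'k::field) vec"
  by (simp_all add: bilinear_on_def linear_on_def tens_add_left tens_add_right
      tens_scale_left tens_scale_right)

lemma leg_tens:
  assumes "x \<in> group_span (carrier G)" "y \<in> group_span (carrier G)"
  shows "leg12 kG (kS L) (x \<odot> y) = x \<odot> y \<odot> grp \<one>"
    and "leg21 kG (kS L) (x \<odot> y) = y \<odot> x \<odot> grp \<one>"
  unfolding leg12_def leg21_def group_algebra_simps subgroup_algebra_simps
  by (rule tensor_lift(3)[OF subspace_group_span subspace_group_span bilinear_on_legs(1) assms]
      tensor_lift(3)[OF subspace_group_span subspace_group_span bilinear_on_legs(2) assms])+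

lemma leg3_tens:
  assumes "x \<in> group_span (carrier G)" "y \<in> group_span L"
  shows "leg13 kG (kS L) (x \<odot> y) = x \<odot> grp \<one> \<odot> y"
    and "leg23 kG (kS L) (x \<odot> y) = grp \<one> \<odot> x \<odot> y"
  unfolding leg13_def leg23_def group_algebra_simps subgroup_algebra_simps
  by (rule tensor_lift(3)[OF subspace_group_span subspace_group_span bilinear_on_legs(3) assms]
      tensor_lift(3)[OF subspace_group_span subspace_group_span bilinear_on_legs(4) assms])+

lemma linear_on_legs:
  "linear_on (group_span (carrier G) \<boxtimes> group_span (carrier G)) (leg12 kG (kS L))"
  "linear_on (group_span (carrier G) \<boxtimes> group_span (carrier G)) (leg21 kG (kS L))"
  "linear_on (group_span (carrier G) \<boxtimes> group_span L) (leg13 kG (kS L))"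
  "linear_on (group_span (carrier G) \<boxtimes> group_span L) (leg23 kG (kS L))"
  unfolding leg12_def leg21_def leg13_def leg23_def group_algebra_simps subgroup_algebra_simps
  by (rule tensor_lift(2)[OF subspace_group_span subspace_group_span], rule bilinear_on_legs)+

end

end

section \<open>The R-matrix of a central element of square one\<close>

locale group_with_involution = finite_group +
  fixes u
  assumes u_center: "u \<in> center G" and u_u: "u \<otimes> u = \<one>"
begin

lemma u_closed [simp]: "u \<in> carrier G" and u_comm: "x \<in> carrier G \<Longrightarrow> x \<otimes> u = u \<otimes> x"
  using u_center by (simp_all add: center_def)

abbreviation "R \<equiv> R_matrix G u :: ('a, 'k::field_char_0) vec"

lemma R_eq_comb: "R = comb (grp \<one> \<odot> grp \<one>) (grp \<one> \<odot> grp u) (grp u \<odot> grp \<one>) (grp u \<odot> grp u)"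
  by (simp add: R_matrix_def comb_def)

lemma R_closed: "R \<in> group_span (carrier G) \<boxtimes> group_span (carrier G)"
  unfolding R_eq_comb
  by (intro comb_in subspace_tensor_space tens_in_tensor_space grp_in_group_span u_closed one_closed)

text \<open>The rows form the multiplication table of two commuting involutions, namely
  \<open>u\<close> in either leg; the signs cancel everything except \<open>x\<close>.\<close>

lemma comb_involution:
  "comb (comb x y z w) (comb y x w z) (comb z w x y) (comb w z y x) = x"
  for x y z w :: "'c \<Rightarrow> 'k::field_char_0"
  by (simp add: comb_def scale_def fun_eq_iff field_simps)

definition cop1 :: "'a set \<Rightarrow> ('a, 'k::field) vec \<Rightarrow> ('a, 'k) vec" where
  "cop1 L K = tensor_assoc (group_span (carrier G)) (group_span (carrier G)) (group_span L)
     (tensor_map (group_span (carrier G)) (group_span L) (comult kG) (\<lambda>b. b) K)"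

definition cop2 :: "'a set \<Rightarrow> ('a, 'k::field) vec \<Rightarrow> ('a, 'k) vec" where
  "cop2 L K = tensor_map (group_span (carrier G)) (group_span L) (\<lambda>x. x) (comult kG) K"

context
  fixes L assumes L: "subgroup L G"
begin

abbreviation "HB \<equiv> tensor_algebra kG (kS L) :: ('a, 'k::field_char_0) vec monoid"
abbreviation "HHB \<equiv> tensor_algebra kG HB :: ('a, 'k::field_char_0) vec monoid"
abbreviation "\<rho> \<equiv> leg21 kG (kS L) R :: ('a, 'k::field_char_0) vec"

interpretation L: subgroup L G by (rule L)

lemma is_algebra_HB: "is_algebra HB"
  by (rule basis_algebra.is_algebra[OF group_subgroup_basis[OF L]])

lemma is_algebra_HHB: "is_algebra HHB"
  by (rule basis_algebra.is_algebra[OF group_group_subgroup_basis[OF L]])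

lemma grp3_in: "a \<in> carrier G \<Longrightarrow> b \<in> carrier G \<Longrightarrow> c \<in> L \<Longrightarrow>
   grp a \<odot> grp b \<odot> grp c \<in> group_span (carrier G) \<boxtimes> group_span (carrier G) \<boxtimes> group_span L"
  by (intro tens_in_tensor_space grp_in_group_span)

text \<open>\<open>R\<close> is symmetric: a flip exchanges the two middle terms, which enter
  \<open>comb\<close> with the same sign.\<close>

lemma rho_eq_aux:
  defines "r \<equiv> R :: ('a, 'k::field_char_0) vec"
  shows "leg21 kG (kS L) r = comb (grp \<one> \<odot> grp \<one> \<odot> grp \<one>) (grp \<one> \<odot> grp u \<odot> grp \<one>)
    (grp u \<odot> grp \<one> \<odot> grp \<one>) (grp u \<odot> grp u \<odot> grp \<one>)" (is "_ = ?c")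
  and "leg12 kG (kS L) r = leg21 kG (kS L) r"
proof -
  note m = tens_in_tensor_space[OF grp_in_group_span grp_in_group_span]
  have "leg21 kG (kS L) r =
    comb (grp \<one> \<odot> grp \<one> \<odot> grp \<one>) (grp u \<odot> grp \<one> \<odot> grp \<one>)
    (grp \<one> \<odot> grp u \<odot> grp \<one>) (grp u \<odot> grp u \<odot> grp \<one>)"
    unfolding r_def R_eq_comb
    by (subst linear_on_comb[OF subspace_tensor_space linear_on_legs(2)[OF L]])
      (simp_all add: m leg_tens[OF L] grp_in_group_span)
  then show 1: "leg21 kG (kS L) r = ?c" by (subst comb_swap)
  have "leg12 kG (kS L) r = ?c"
    unfolding r_def R_eq_comb
    by (subst linear_on_comb[OF subspace_tensor_space linear_on_legs(1)[OF L]])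
      (simp_all add: m leg_tens[OF L] grp_in_group_span)
  with 1 show "leg12 kG (kS L) r = leg21 kG (kS L) r"
    by simp
qed

lemmas rho_eq = rho_eq_aux(1) and leg12_R = rho_eq_aux(2)

lemma rho_closed: "\<rho> \<in> carrier HHB"
  unfolding rho_eq by (simp add: comb_in subspace_tensor_space grp3_in)

lemma rho_rho: "\<rho> \<otimes>\<^bsub>HHB\<^esub> \<rho> = \<one>\<^bsub>HHB\<^esub>"
  unfolding rho_eq
  by (subst bilinear_on_comb[OF is_algebraD(2,2,3)[OF is_algebra_HHB]])
    (simp_all add: grp3_in tensor_mult_grp3[OF L] u_u comb_involution)

text \<open>Each leg of each term of \<open>\<rho>\<close> is \<open>\<one>\<close> or the central
  element \<open>u\<close>, so commutation can be tested on the basis of the triple tensor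
  product.\<close>

lemma rho_central:
  fixes w :: "('a, 'k::field_char_0) vec"
  assumes w: "w \<in> carrier HHB"
  shows "\<rho> \<otimes>\<^bsub>HHB\<^esub> w = w \<otimes>\<^bsub>HHB\<^esub> \<rho>"
proof -
  note bil = bilinear_onD[OF is_algebraD(3)[OF is_algebra_HHB]]
  interpret P: basis_algebra "node_monoid (base_monoid G (carrier G))
      (node_monoid (base_monoid G (carrier G)) (base_monoid G L))" HHB
    by (rule group_group_subgroup_basis[OF L])
  show ?thesis
  proof (rule P.eqI[OF bil(1)[OF rho_closed] bil(2)[OF rho_closed] _ w])
    fix p assume "p \<in> carrier (node_monoid (base_monoid G (carrier G))
      (node_monoid (base_monoid G (carrier G)) (base_monoid G L)))"
    then obtain a b c where p: "single p = grp a \<odot> grp b \<odot> (grp c :: ('a, 'k) vec)"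
      and abc: "a \<in> carrier G" "b \<in> carrier G" "c \<in> L"
      by (auto simp: node_monoid_def tens_single[symmetric] grp_def)
    have pc: "(single p :: ('a, 'k) vec) \<in> carrier HHB" unfolding p using abc by (simp add: grp3_in)
    show "\<rho> \<otimes>\<^bsub>HHB\<^esub> single p = single p \<otimes>\<^bsub>HHB\<^esub> (\<rho> :: ('a, 'k) vec)"
      unfolding rho_eq
      using abc L.subset
      by (subst linear_on_comb[OF is_algebraD(2)[OF is_algebra_HHB] bil(1)[OF pc]], simp_all add: grp3_in)
        (subst linear_on_comb[OF is_algebraD(2)[OF is_algebra_HHB] bil(2)[OF pc]],
          simp_all add: grp3_in p tensor_mult_grp3[OF L] u_comm subset_iff)
  qed
qed

lemma linear_on_cop1: "linear_on (group_span (carrier G) \<boxtimes> group_span L) (cop1 L)"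
proof -
  have "tensor_map (group_span (carrier G)) (group_span L) (comult kG) (\<lambda>x. x) \<in>
    group_span (carrier G) \<boxtimes> group_span L \<rightarrow>
    (group_span (carrier G) \<boxtimes> group_span (carrier G)) \<boxtimes> (group_span L :: ('a, 'k::field) vec set)"
    using tensor_map_in[OF subspace_group_span subspace_group_span linear_on_comult linear_on_id]
      comult_in_tensor[OF subset_refl] by blast
  then show ?thesis
    unfolding cop1_def[abs_def]
    by (rule linear_on_compose[OF linear_on_tensor_map[OF subspace_group_span subspace_group_span
            linear_on_comult linear_on_id] _ linear_on_tensor_assoc[OF subspace_group_span
            subspace_group_span subspace_group_span]])
qed

lemma linear_on_cop2: "linear_on (group_span (carrier G) \<boxtimes> group_span L) (cop2 L)"
  unfolding cop2_def[abs_def]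
  by (rule linear_on_tensor_map[OF subspace_group_span subspace_group_span linear_on_id linear_on_comult])

lemma cop_grp:
  assumes "x \<in> carrier G" "y \<in> L"
  shows "cop1 L (grp x \<odot> grp y) = grp x \<odot> grp x \<odot> grp y" "cop2 L (grp x \<odot> grp y) = grp x \<odot> grp y \<odot> grp y"
  unfolding cop1_def cop2_def
  using assms
  by (simp_all add: tensor_map_tens[OF subspace_group_span subspace_group_span linear_on_comult linear_on_id]
      tensor_map_tens[OF subspace_group_span subspace_group_span linear_on_id linear_on_comult]
      grp_in_group_span comult_grp
      tensor_assoc_tens[OF subspace_group_span subspace_group_span subspace_group_span])

text \<open>Group-like elements turn the three maps into statements about supports: on basis tensors
  they double the first leg, double the second leg, or insert \<open>\<one>\<close> in the middle.
  The equations for \<open>K\<close> can then be compared entry by entry.\<close>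

lemma triple_coordinates:
  fixes K :: "('a, 'k::field) vec"
  assumes K: "K \<in> group_span (carrier G) \<boxtimes> group_span L"
  shows "cop1 L K (Node p (Node q r)) = (if p = q then K (Node p r) else 0)"
    and "cop2 L K (Node p (Node q r)) = (if q = r then K (Node p r) else 0)"
    and "leg13 kG (kS L) K (Node p (Node q r)) =
      (if q = Base \<one> then K (Node p r) else 0)"
proof -
  let ?c = "\<lambda>P (K :: ('a, 'k) vec) t. case t of Node p (Node q r) \<Rightarrow> if P p q r then K (Node p r) else 0 | _ \<Rightarrow> 0"
  have l: "linear_on V (?c P)" for P V
    by (auto simp: linear_on_def scale_def fun_eq_iff split: idx.splits)
  have "cop1 L K = ?c (\<lambda>p q r. p = q) K"
    by (rule tensor_group_span_eqI[OF linear_on_cop1 l _ K])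
      (simp only: cop_grp, auto simp: grp_def single_def tens_def fun_eq_iff split: idx.splits)
  then show "cop1 L K (Node p (Node q r)) = (if p = q then K (Node p r) else 0)" by simp
  have "cop2 L K = ?c (\<lambda>p q r. q = r) K"
    by (rule tensor_group_span_eqI[OF linear_on_cop2 l _ K])
      (simp only: cop_grp, auto simp: grp_def single_def tens_def fun_eq_iff split: idx.splits)
  then show "cop2 L K (Node p (Node q r)) = (if q = r then K (Node p r) else 0)" by simp
  have "leg13 kG (kS L) K = ?c (\<lambda>p q r. q = Base \<one>) K"
    by (rule tensor_group_span_eqI[OF linear_on_legs(3)[OF L] l _ K])
      (simp only: leg3_tens[OF L] grp_in_group_span, auto simp: grp_def single_def tens_def fun_eq_iff split: idx.splits)
  then show "leg13 kG (kS L) K (Node p (Node q r)) =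
      (if q = Base \<one> then K (Node p r) else 0)" by simp
qed

lemma leg3_closed:
  assumes K: "K \<in> group_span (carrier G) \<boxtimes> group_span L"
  shows "leg13 kG (kS L) K \<in> carrier HHB"
    "leg23 kG (kS L) K \<in> carrier HHB"
  by (rule tensor_image[OF linear_on_legs(3)[OF L] _ _ K],
      auto simp: subspace_tensor_space leg3_tens[OF L] intro!: tens_in_tensor_space grp_in_group_span)
    (rule tensor_image[OF linear_on_legs(4)[OF L] _ _ K],
      auto simp: subspace_tensor_space leg3_tens[OF L] intro!: tens_in_tensor_space grp_in_group_span)

end

lemma R_R: "R \<otimes>\<^bsub>tensor_algebra kG kG\<^esub> R = grp \<one> \<odot> grp \<one>"
proof -
  have "R \<otimes>\<^bsub>tensor_algebra kG (kS (carrier G))\<^esub> R = grp \<one> \<odot> grp \<one>"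
    unfolding R_eq_comb
    by (subst bilinear_on_comb[OF is_algebraD(2,2,3)[OF is_algebra_HB[OF subgroup_self]]])
      (simp_all add: tens_in_tensor_space grp_in_group_span tensor_mult_grp[OF subgroup_self] u_u comb_involution)
  then show ?thesis by (simp add: tensor_algebra_group)
qed

lemma monoid_HH: "monoid (tensor_algebra kG (kG :: ('a, 'k::field) hopf))"
  by (rule is_algebraD(1)[OF basis_algebra.is_algebra[OF group_group_basis]])

lemma inv_R: "inv\<^bsub>tensor_algebra kG kG\<^esub> R = R"
  by (rule monoid.inv_unique'[OF monoid_HH, symmetric]) (simp_all add: R_R R_closed)

text \<open>The letters are the eight products of \<open>u\<close> in three legs: \<open>a\<close>
  is 1, while \<open>b\<close>, \<open>c\<close>, \<open>e\<close> carry \<open>u\<close> in the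
  third, second and first leg alone. The left sides are the tables for R13 R23 and for R13
  R12.\<close>

lemma comb_R_axioms:
  fixes a :: "'c \<Rightarrow> 'k::field_char_0"
  shows "comb (comb a b c d) (comb b a d c) (comb e f g h) (comb f e h g) = comb a b g h"
    and "comb (comb a c e g) (comb b d f h) (comb e g a c) (comb f h b d) = comb a d e h"
  by (simp_all add: comb_def scale_def fun_eq_iff field_simps)

text \<open>The computation takes place over \<open>kS (carrier G)\<close>, for which the leg lemmas
  are stated, and is transferred at the end by \<open>tensor_algebra_group\<close>.\<close>

lemma quasitriangular_R:
  "quasitriangular (kG :: ('a, 'k::field_char_0) hopf) (R :: ('a, 'k) vec)"
proof -
  let ?H = "kG :: ('a, 'k) hopf" and ?B = "kS (carrier G) :: ('a, 'k) comodule_alg"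
  let ?V = "group_span (carrier G) :: ('a, 'k) vec set"
  let ?R = "R :: ('a, 'k) vec"
  note S = subgroup_self
  note m = tens_in_tensor_space[OF grp_in_group_span grp_in_group_span]
  note comb3 = linear_on_comb[OF subspace_tensor_space]
  have bil: "bilinear_on (?V \<boxtimes> ?V \<boxtimes> ?V) (?V \<boxtimes> ?V \<boxtimes> ?V)
      (\<lambda>v w. v \<otimes>\<^bsub>tensor_algebra ?H (tensor_algebra ?H ?B)\<^esub> w)"
    using is_algebraD(3)[OF is_algebra_HHB[OF S]] by simp
  have bil2: "bilinear_on (?V \<boxtimes> ?V) (?V \<boxtimes> ?V) (\<lambda>v w. v \<otimes>\<^bsub>tensor_algebra ?H ?B\<^esub> w)"
    using is_algebraD(3)[OF is_algebra_HB[OF S]] by simp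
  note prod = bilinear_on_comb[OF subspace_tensor_space subspace_tensor_space bil]
  have l13: "leg13 ?H ?B ?R = comb (grp \<one> \<odot> grp \<one> \<odot> grp \<one>) (grp \<one> \<odot> grp \<one> \<odot> grp u)
      (grp u \<odot> grp \<one> \<odot> grp \<one>) (grp u \<odot> grp \<one> \<odot> grp u)"
    unfolding R_eq_comb
    by (subst comb3[OF linear_on_legs(3)[OF S]]) (simp_all add: m leg3_tens[OF S] grp_in_group_span)
  have l23: "leg23 ?H ?B ?R = comb (grp \<one> \<odot> grp \<one> \<odot> grp \<one>) (grp \<one> \<odot> grp \<one> \<odot> grp u)
      (grp \<one> \<odot> grp u \<odot> grp \<one>) (grp \<one> \<odot> grp u \<odot> grp u)"
    unfolding R_eq_comb
    by (subst comb3[OF linear_on_legs(4)[OF S]]) (simp_all add: m leg3_tens[OF S] grp_in_group_span)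
  have l12: "leg12 ?H ?B ?R = comb (grp \<one> \<odot> grp \<one> \<odot> grp \<one>) (grp \<one> \<odot> grp u \<odot> grp \<one>)
      (grp u \<odot> grp \<one> \<odot> grp \<one>) (grp u \<odot> grp u \<odot> grp \<one>)"
    by (simp only: leg12_R[OF S] rho_eq[OF S])
  have c1: "cop1 (carrier G) ?R = comb (grp \<one> \<odot> grp \<one> \<odot> grp \<one>) (grp \<one> \<odot> grp \<one> \<odot> grp u)
      (grp u \<odot> grp u \<odot> grp \<one>) (grp u \<odot> grp u \<odot> grp u)"
    unfolding R_eq_comb
    by (subst comb3[OF linear_on_cop1[OF S]]) (simp_all add: m cop_grp[OF S])
  have c2: "cop2 (carrier G) ?R = comb (grp \<one> \<odot> grp \<one> \<odot> grp \<one>) (grp \<one> \<odot> grp u \<odot> grp u)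
      (grp u \<odot> grp \<one> \<odot> grp \<one>) (grp u \<odot> grp u \<odot> grp u)"
    unfolding R_eq_comb
    by (subst comb3[OF linear_on_cop2[OF S]]) (simp_all add: m cop_grp[OF S])
  have e1: "cop1 (carrier G) ?R = leg13 ?H ?B ?R \<otimes>\<^bsub>tensor_algebra ?H (tensor_algebra ?H ?B)\<^esub> leg23 ?H ?B ?R"
    unfolding c1 l13 l23
    by (subst prod) (simp_all add: grp3_in[OF S] tensor_mult_grp3[OF S] u_u comb_R_axioms)
  have e2: "cop2 (carrier G) ?R = leg13 ?H ?B ?R \<otimes>\<^bsub>tensor_algebra ?H (tensor_algebra ?H ?B)\<^esub> leg12 ?H ?B ?R"
    unfolding c2 l13 l12
    by (subst prod) (simp_all add: grp3_in[OF S] tensor_mult_grp3[OF S] u_u comb_R_axioms)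
  have legs: "leg12 ?H ?B = leg12 ?H ?H" "leg13 ?H ?B = leg13 ?H ?H" "leg23 ?H ?B = leg23 ?H ?H"
    by (simp_all add: leg12_def leg13_def leg23_def)
  have fl: "bilinear_on ?V ?V (\<lambda>x y. y \<odot> x)"
    by (simp add: bilinear_on_def linear_on_tens_left linear_on_tens_right)
  have cm: "comult ?H \<in> ?V \<rightarrow> ?V \<boxtimes> ?V" using comult_in_tensor[OF subset_refl] by blast
  have lf: "linear_on (?V \<boxtimes> ?V) (flip ?H)"
    unfolding flip_def group_algebra_simps
    by (rule tensor_lift(2)[OF subspace_group_span subspace_group_span fl])
  have fg: "flip ?H (grp x \<odot> grp y) = grp y \<odot> grp x" if "x \<in> carrier G" "y \<in> carrier G" for x y
    using that unfolding flip_def group_algebra_simps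
    by (simp add: tensor_lift(3)[OF subspace_group_span subspace_group_span fl] grp_in_group_span)
  have fc: "flip ?H \<in> ?V \<boxtimes> ?V \<rightarrow> ?V \<boxtimes> ?V"
    unfolding flip_def group_algebra_simps
    by (rule Pi_I, rule tensor_image[OF tensor_lift(2)[OF subspace_group_span subspace_group_span fl]])
      (simp_all add: subspace_tensor_space tens_in_tensor_space
        tensor_lift(3)[OF subspace_group_span subspace_group_span fl])
  have ax: "?R \<otimes>\<^bsub>tensor_algebra ?H ?B\<^esub> comult ?H h = flip ?H (comult ?H h) \<otimes>\<^bsub>tensor_algebra ?H ?B\<^esub> ?R"
    if h: "h \<in> ?V" for h
  proof (rule group_span_eqI[OF linear_on_compose[OF linear_on_comult cm bilinear_onD(1)[OF bil2 R_closed]]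
        linear_on_compose[OF linear_on_compose[OF linear_on_comult cm lf] _ bilinear_onD(2)[OF bil2 R_closed]] _ h])
    show "(\<lambda>x. flip ?H (comult ?H x)) \<in> ?V \<rightarrow> ?V \<boxtimes> ?V" using cm fc by auto
    fix x assume x: "x \<in> carrier G"
    then show "?R \<otimes>\<^bsub>tensor_algebra ?H ?B\<^esub> comult ?H (grp x) =
        flip ?H (comult ?H (grp x)) \<otimes>\<^bsub>tensor_algebra ?H ?B\<^esub> ?R"
      unfolding R_eq_comb comult_grp[OF x] fg[OF x x]
      by (subst comb3[OF bilinear_onD(1)[OF bil2]], simp_all add: m,
          subst comb3[OF bilinear_onD(2)[OF bil2]], simp_all add: m tensor_mult_grp[OF S] u_comm)
  qed
  have "?R \<in> Units (tensor_algebra ?H ?H)"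
    using R_closed R_R by (auto simp: Units_def)
  then show ?thesis
    unfolding quasitriangular_def Let_def
    using e1 e2 ax hopf_algebra_group
    by (simp add: legs tensor_algebra_group cop1_def cop2_def)
qed

section \<open>K-matrices of subgroup algebras\<close>

lemma K_matrix_iff:
  fixes K :: "('a, 'k::field_char_0) vec"
  assumes L: "subgroup L G"
  defines "H \<equiv> kG :: ('a, 'k) hopf"
    and "B \<equiv> kS L :: ('a, 'k) comodule_alg"
  shows "K_matrix H R B K \<longleftrightarrow>
    K \<in> Units (tensor_algebra H B) \<and>
    cop1 L K = leg23 H B K \<otimes>\<^bsub>tensor_algebra H (tensor_algebra H B)\<^esub> leg13 H B K \<and>
    cop2 L K = leg13 H B K \<and>
    (\<forall>b\<in>group_span L. K \<otimes>\<^bsub>tensor_algebra H B\<^esub> comult H b = comult H b \<otimes>\<^bsub>tensor_algebra H B\<^esub> K)"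
\<comment> \<open>Invertibility occurs on both sides. Assuming it places \<open>K\<close> in the
  tensor space, so that its legs are elements of the monoid \<open>?M\<close>.\<close>
proof (cases "K \<in> Units (tensor_algebra H B)")
  case True
  let ?M = "tensor_algebra H (tensor_algebra H B)"
  interpret M: monoid ?M
    unfolding H_def B_def by (rule is_algebraD(1)[OF is_algebra_HHB[OF L]])
  have K: "K \<in> group_span (carrier G) \<boxtimes> group_span L"
    using True by (auto simp: Units_def H_def B_def)
  define r where "r = leg21 H B (R :: ('a, 'k) vec)"
  define x where "x = leg13 H B K"
  define y where "y = leg23 H B K"
  have c: "r \<in> carrier ?M" "x \<in> carrier ?M" "y \<in> carrier ?M"
    unfolding r_def x_def y_def H_def B_def
    by (rule rho_closed[OF L] leg3_closed[OF L K])+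
  have rr: "r \<otimes>\<^bsub>?M\<^esub> r = \<one>\<^bsub>?M\<^esub>"
    unfolding r_def H_def B_def by (rule rho_rho[OF L])
  have rx: "r \<otimes>\<^bsub>?M\<^esub> x = x \<otimes>\<^bsub>?M\<^esub> r"
    using c(2) unfolding r_def H_def B_def by (rule rho_central[OF L])
  have e: "y \<otimes>\<^bsub>?M\<^esub> r \<otimes>\<^bsub>?M\<^esub> x \<otimes>\<^bsub>?M\<^esub> r = y \<otimes>\<^bsub>?M\<^esub> x"
    "r \<otimes>\<^bsub>?M\<^esub> x \<otimes>\<^bsub>?M\<^esub> r = x"
    using c rr rx by (simp_all add: M.m_assoc del: tensor_algebra_simps)
  have i: "inv\<^bsub>tensor_algebra H H\<^esub> R = (R :: ('a, 'k) vec)"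
    unfolding H_def by (rule inv_R)
  have l: "leg12 H B R = r" unfolding r_def H_def B_def by (rule leg12_R[OF L])
  have qt: "quasitriangular H (R :: ('a, 'k) vec)" "comodule_algebra H B"
    unfolding H_def B_def by (rule quasitriangular_R comodule_algebra_subgroup[OF L])+
  have cop: "tensor_assoc (carrier H) (carrier H) (carrier B)
      (tensor_map (carrier H) (carrier B) (comult H) (\<lambda>b. b) K) = cop1 L K"
    "tensor_map (carrier H) (carrier B) (\<lambda>x. x) (coact B) K = cop2 L K"
    by (simp_all add: H_def B_def cop1_def cop2_def)
  show ?thesis
    unfolding K_matrix_def Let_def i l cop r_def[symmetric] x_def[symmetric] y_def[symmetric] e
    using True qt by (simp add: B_def H_def)
next
  case False
  then show ?thesis by (simp add: K_matrix_def)
qed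

text \<open>\<open>a\<close> is group-like, which settles both coproduct equations, and it commutes
  with the first leg of each \<open>comult kG (grp l)\<close> because it centralizes
  \<open>L\<close>.\<close>

lemma K_matrix_grp:
  assumes L: "subgroup L G" and a: "a \<in> centralizer G L"
  shows "K_matrix kG R (kS L)
    (grp a \<odot> grp \<one> :: ('a, 'k::field_char_0) vec)"
proof -
  let ?H = "kG :: ('a, 'k) hopf" and ?B = "kS L :: ('a, 'k) comodule_alg"
  let ?K = "grp a \<odot> grp \<one> :: ('a, 'k) vec"
  interpret L: subgroup L G by fact
  have aG: "a \<in> carrier G" and comm: "\<And>l. l \<in> L \<Longrightarrow> a \<otimes> l = l \<otimes> a"
    using a by (auto simp: centralizer_def)
  have in2: "grp x \<odot> grp y \<in> carrier (tensor_algebra ?H ?B)" if "x \<in> carrier G" "y \<in> L" for x y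
    using that by (simp add: tens_in_tensor_space grp_in_group_span)
  have U: "?K \<in> Units (tensor_algebra ?H ?B)"
    unfolding Units_def
    using in2[OF aG L.one_closed] in2[OF inv_closed[OF aG] L.one_closed] aG
    by (auto simp: tensor_mult_grp[OF L] intro!: bexI[of _ "grp (inv a) \<odot> grp \<one>"])
  note bil = bilinear_onD[OF is_algebraD(3)[OF is_algebra_HB[OF L]]]
  have cL: "comult ?H \<in> group_span L \<rightarrow> carrier (tensor_algebra ?H ?B)"
    using comult_in_tensor[OF L.subset] by auto
  have "?K \<otimes>\<^bsub>tensor_algebra ?H ?B\<^esub> comult ?H b = comult ?H b \<otimes>\<^bsub>tensor_algebra ?H ?B\<^esub> ?K"
    if b: "b \<in> group_span L" for b
    by (rule group_span_eqI[OF linear_on_compose[OF linear_on_comult cL bil(1)]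
          linear_on_compose[OF linear_on_comult cL bil(2)] _ b])
      (simp_all add: in2[simplified] aG comult_grp tensor_mult_grp[OF L] comm)
  then show ?thesis
    using U aG L.one_closed
    by (simp add: K_matrix_iff[OF L] cop_grp[OF L] leg3_tens[OF L] grp_in_group_span tensor_mult_grp3[OF L])
qed

lemma K_matrix_form:
  fixes K :: "('a, 'k::field_char_0) vec"
  assumes L: "subgroup L G"
    and K_mat: "K_matrix kG R (kS L) K"
  shows "\<exists>a\<in>centralizer G L. K = grp a \<odot> grp \<one>"
proof -
  let ?H = "kG :: ('a, 'k) hopf" and ?B = "kS L :: ('a, 'k) comodule_alg"
  let ?V = "group_span (carrier G) :: ('a, 'k) vec set" and ?W = "group_span L :: ('a, 'k) vec set"
  interpret L: subgroup L G by fact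
  have U: "K \<in> Units (tensor_algebra ?H ?B)"
    and c1: "cop1 L K = leg23 ?H ?B K \<otimes>\<^bsub>tensor_algebra ?H (tensor_algebra ?H ?B)\<^esub> leg13 ?H ?B K"
    and c2: "cop2 L K = leg13 ?H ?B K"
    and c3: "\<And>b. b \<in> ?W \<Longrightarrow> K \<otimes>\<^bsub>tensor_algebra ?H ?B\<^esub> comult ?H b = comult ?H b \<otimes>\<^bsub>tensor_algebra ?H ?B\<^esub> K"
    using K_mat by (simp_all add: K_matrix_iff[OF L])
  have K: "K \<in> ?V \<boxtimes> ?W" using U by (auto simp: Units_def)
  have K0: "K r = 0" if "\<nexists>p q. r = Node p q" for r
    using coord_space_zero_outside[OF K[unfolded group_span_eq tensor_coord_space], of r] that by auto
  \<comment> \<open>Entries with \<open>\<one>\<close> in the middle leg are compared: the second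
    coproduct lives where the last two legs agree, while \<open>leg13\<close> has all of
    \<open>K\<close> there.\<close>
  have K1: "K (Node p r) = 0" if "r \<noteq> Base \<one>" for p r
    using triple_coordinates(2,3)[OF L K, of p "Base \<one>" r] c2 that by simp
  define \<kappa> where "\<kappa> = (\<lambda>p. K (Node p (Base \<one>)))"
  have K_eq: "K = \<kappa> \<odot> grp \<one>"
  proof
    fix r show "K r = (\<kappa> \<odot> grp \<one>) r"
      using K0[of r] K1 by (cases r) (auto simp: tens_def \<kappa>_def grp_def single_def)
  qed
  have l: "linear_on X (\<lambda>K p. K (Node p (Base \<one>)))" for X :: "('a, 'k) vec set"
    by (simp add: linear_on_def scale_def fun_eq_iff)
  have \<kappa>_in: "\<kappa> \<in> ?V"
    unfolding \<kappa>_def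
  proof (rule tensor_image[OF l subspace_group_span _ K])
    fix x y :: "('a, 'k) vec" assume "x \<in> ?V"
    then have "scale (y (Base \<one>)) x \<in> ?V" by (rule vec.subspace_scale[OF subspace_group_span])
    moreover have "(\<lambda>p. (x \<odot> y) (Node p (Base \<one>))) = scale (y (Base \<one>)) x"
      by (simp add: tens_def scale_def fun_eq_iff)
    ultimately show "(\<lambda>p. (x \<odot> y) (Node p (Base \<one>))) \<in> ?V" by simp
  qed
  interpret H: monoid ?H by (rule is_algebraD(1)[OF is_algebra_group])
  have o: "grp \<one> \<otimes>\<^bsub>?H\<^esub> \<kappa> = \<kappa>" "\<kappa> \<otimes>\<^bsub>?H\<^esub> grp \<one> = \<kappa>"
    using H.l_one H.r_one \<kappa>_in by simp_all
  have 11: "grp \<one> \<in> ?V" "grp \<one> \<in> ?W" by (simp_all add: grp_in_group_span)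
  have "cop1 L K = \<kappa> \<odot> \<kappa> \<odot> grp \<one>"
    unfolding c1 unfolding K_eq leg3_tens[OF L \<kappa>_in 11(2)]
    using tensor_mult_tens[OF is_algebra_group is_algebra_HB[OF L], of "grp \<one>" \<kappa> "\<kappa> \<odot> grp \<one>" "grp \<one> \<odot> grp \<one>"]
      tensor_mult_tens[OF is_algebra_group is_algebra_subgroup[OF L], of \<kappa> "grp \<one>" "grp \<one>" "grp \<one>"]
      \<kappa>_in 11 o by (simp add: tens_in_tensor_space grp_mult)
  \<comment> \<open>Group-likeness in coordinates: every value of \<open>\<kappa>\<close> is
    idempotent and products of distinct values vanish. In a field this leaves zero or a single basis
    vector.\<close>
  then have \<kappa>2: "(if p = q then \<kappa> p else 0) = \<kappa> p * \<kappa> q" for p q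
    using triple_coordinates(1)[OF L K, of p q "Base \<one>"] by (simp add: tens_def \<kappa>_def grp_apply)
  \<comment> \<open>Zero solves the quadratic equations as well; invertibility of \<open>K\<close>
    excludes it.\<close>
  have "\<kappa> \<noteq> 0"
  proof
    assume "\<kappa> = 0"
    then have "K = 0" unfolding K_eq by (auto simp: tens_def fun_eq_iff split: idx.split)
    then obtain K' where K': "K' \<in> ?V \<boxtimes> ?W" "0 \<otimes>\<^bsub>tensor_algebra ?H ?B\<^esub> K' = grp \<one> \<odot> grp \<one>"
      using U by (auto simp: Units_def)
    have "0 \<otimes>\<^bsub>tensor_algebra ?H ?B\<^esub> K' = 0"
      by (rule linear_on_zero[OF subspace_tensor_space bilinear_onD(2)[OF bilinear_on_tensor_mult[OF
                is_algebra_group is_algebra_subgroup[OF L]], of K']]) (use K'(1) in simp)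
    then have "(grp \<one> \<odot> grp \<one> :: ('a, 'k) vec) (Node (Base \<one>) (Base \<one>)) = 0" using K'(2) by simp
    then show False by (simp add: tens_def grp_apply)
  qed
  then obtain p where p: "\<kappa> p \<noteq> 0" by (auto simp: fun_eq_iff)
  then have "\<kappa> p = 1" using \<kappa>2[of p p] by simp
  moreover have "\<kappa> q = 0" if "q \<noteq> p" for q using \<kappa>2[of p q] p that by simp
  ultimately have "\<kappa> = single p" by (auto simp: single_def)
  moreover obtain a where a: "p = Base a" "a \<in> carrier G"
    using coord_space_zero_outside[OF \<kappa>_in[unfolded group_span_eq], of p] p by blast
  ultimately have Ka: "K = grp a \<odot> grp \<one>" using K_eq by (simp add: grp_def)
  have "a \<otimes> l = l \<otimes> a" if l: "l \<in> L" for l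
  proof -
    have "(grp (a \<otimes> l) \<odot> grp l :: ('a, 'k) vec) = grp (l \<otimes> a) \<odot> grp l"
      using c3[of "grp l"] l a(2) unfolding Ka
      by (simp add: grp_in_group_span comult_grp tensor_mult_grp[OF L])
    then show ?thesis by (simp add: grp_def tens_single single_eq_iff)
  qed
  then show ?thesis using a(2) Ka by (auto simp: centralizer_def)
qed

end

section \<open>Left coideal subalgebras of a group algebra\<close>

context finite_group
begin

lemma comult_slice:
  assumes "x \<in> carrier G"
  shows "slice (Base x) (comult kG b) = scale (b (Base x)) (grp x)"
proof -
  have "slice (Base x) (comult kG b) =
      (\<Sum>g\<in>carrier G. slice (Base x) (scale (b (Base g)) (grp g \<odot> grp g)))"
    unfolding group_algebra_def by (simp add: linear_on_sum[OF vec.subspace_UNIV linear_on_slice])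
  also have "\<dots> = (\<Sum>g\<in>carrier G. if g = x then scale (b (Base x)) (grp x) else 0)"
    by (rule sum.cong) (auto simp: linear_onD(2)[OF linear_on_slice[of UNIV]] slice_tens grp_apply)
  finally show ?thesis using fin assms by simp
qed

lemma left_coideal_subalgebra_group_span:
  assumes L: "subgroup L G"
  shows "left_coideal_subalgebra (kG :: ('a, 'k::field) hopf) (group_span L)"
proof -
  interpret L: subgroup L G by fact
  interpret B: basis_algebra "base_monoid G L" "kS L :: ('a, 'k) comodule_alg"
    by (rule subgroup_basis_algebra[OF L])
  have "group_span L \<subseteq> (group_span (carrier G) :: ('a, 'k) vec set)"
    unfolding group_span_def by (intro vec.span_mono image_mono L.subset)
  then show ?thesis
    unfolding left_coideal_subalgebra_def
    using B.mult_closed comult_in_tensor[OF L.subset]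
    by (auto simp: subspace_group_span grp_in_group_span)
qed

lemma left_coideal_subalgebra_form:
  fixes B :: "('a, 'k::field) vec set"
  assumes B: "left_coideal_subalgebra kG B"
  shows "\<exists>L. subgroup L G \<and> B = group_span L"
proof -
  define L where "L = {x \<in> carrier G. grp x \<in> B}"
  have sub: "vec.subspace B" and BV: "B \<subseteq> group_span (carrier G)" and one: "grp \<one> \<in> B"
    and mult: "\<And>x y. x \<in> B \<Longrightarrow> y \<in> B \<Longrightarrow> x \<otimes>\<^bsub>kG\<^esub> y \<in> B"
    and com: "\<And>b. b \<in> B \<Longrightarrow> comult kG b \<in> group_span (carrier G) \<boxtimes> B"
    using B by (auto simp: left_coideal_subalgebra_def)
  have mL: "x \<otimes> y \<in> L" if "x \<in> L" "y \<in> L" for x y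
    using that mult[of "grp x" "grp y"] by (simp add: L_def grp_mult)
  have pow: "x [^] (n::nat) \<in> L" if "x \<in> L" for x n
    by (induction n) (use that one mL in \<open>auto simp: L_def\<close>)
  have "subgroup L G"
  proof (rule subgroupI)
    show "L \<subseteq> carrier G" by (auto simp: L_def)
    show "L \<noteq> {}" using one by (auto simp: L_def)
    fix x assume x: "x \<in> L"
    then have xG: "x \<in> carrier G" by (simp add: L_def)
    \<comment> \<open>A coideal subalgebra is closed under products by definition, while nothing is
      said about the antipode. Inverses are obtained as powers, from the finite order of
      \<open>x\<close>.\<close>
    obtain n :: nat where n: "n > 0" "x [^] n = \<one>"
    proof -
      have "\<not> inj_on (\<lambda>n. x [^] (n::nat)) UNIV"
      proof
        assume "inj_on (\<lambda>n. x [^] (n::nat)) UNIV"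
        moreover have "finite (range (\<lambda>n. x [^] (n::nat)))"
          by (rule finite_subset[OF _ fin]) (use xG in auto)
        ultimately show False using finite_imageD infinite_UNIV_nat by blast
      qed
      then obtain i j where ij: "x [^] (i::nat) = x [^] j" "i \<noteq> j" by (auto simp: inj_on_def)
      define m n where "m = min i j" and "n = max i j - min i j"
      have "x [^] m \<otimes> x [^] n = x [^] max i j"
        using xG by (simp add: m_def n_def nat_pow_mult)
      also have "\<dots> = x [^] m \<otimes> \<one>" using ij(1) xG by (simp add: m_def max_def min_def)
      finally have "x [^] m \<otimes> x [^] n = x [^] m \<otimes> \<one>" .
      then have "x [^] n = \<one>" using xG by (simp del: r_one)
      moreover have "n > 0" using ij(2) by (auto simp: n_def)
      ultimately show ?thesis using that by blast
    qed
    have "x [^] (n - 1) \<otimes> x = \<one>" using n xG nat_pow_Suc[of x "n - 1"] by simp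
    then have "inv x = x [^] (n - 1)" using xG by (intro inv_equality) auto
    then show "inv x \<in> L" using pow[OF x] by simp
  qed (rule mL)
  moreover have "B = group_span L"
  proof
    show "group_span L \<subseteq> B"
      unfolding group_span_def by (rule vec.span_minimal[OF _ sub]) (auto simp: L_def)
    show "B \<subseteq> group_span L"
    proof
      fix b assume b: "b \<in> B"
      have coeff: "scale (b (Base x)) (grp x) \<in> B" if "x \<in> carrier G" for x
        using slice_in[OF sub com[OF b], of "Base x"] comult_slice[OF that, of b] by simp
      have "scale (b (Base x)) (grp x) \<in> group_span L" if x: "x \<in> carrier G" for x
      proof (cases "b (Base x) = 0")
        case False
        then have "grp x \<in> B"
          using vec.subspace_scale[OF sub coeff[OF x], of "inverse (b (Base x))"] by simp
        then show ?thesis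
          using x by (intro vec.subspace_scale[OF subspace_group_span] grp_in_group_span) (simp add: L_def)
      qed (simp add: vec.subspace_0[OF subspace_group_span])
      then have "(\<Sum>x\<in>carrier G. scale (b (Base x)) (grp x)) \<in> group_span L"
        by (rule vec.subspace_sum[OF subspace_group_span])
      moreover have "b = (\<Sum>x\<in>carrier G. scale (b (Base x)) (grp x))"
        using coord_space_expand[of "Base ` carrier G" b] fin b BV
        by (auto simp: group_span_eq sum.reindex inj_on_def grp_def)
      ultimately show "b \<in> group_span L" by simp
    qed
  qed
  ultimately show ?thesis by blast
qed

end

section \<open>Modules over group algebras\<close>

lemma is_left_module_group_iff:
  "is_left_module (subgroup_algebra G (carrier G)) X \<longleftrightarrow> is_left_module (group_algebra G) X"
  by (simp add: is_left_module_def)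

lemma mod_hom_group: "mod_hom (subgroup_algebra G (carrier G)) = mod_hom (group_algebra G)"
  by (simp add: mod_hom_def fun_eq_iff)

lemma mod_homD:
  assumes "f \<in> mod_hom A M N"
  shows "f \<in> extensional (space M)" "m \<in> space M \<Longrightarrow> f m \<in> space N" "linear_on (space M) f"
    "b \<in> carrier A \<Longrightarrow> m \<in> space M \<Longrightarrow> f (act M b m) = act N b (f m)"
  using assms by (auto simp: mod_hom_def PiE_def)

lemma mod_hom_compose:
  assumes M: "is_left_module A M" and f: "f \<in> mod_hom A M N" and g: "g \<in> mod_hom A N P"
  shows "compose (space M) g f \<in> mod_hom A M P"
proof -
  have s: "vec.subspace (space M)" "\<And>b m. b \<in> carrier A \<Longrightarrow> m \<in> space M \<Longrightarrow> act M b m \<in> space M"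
    using M by (auto simp: is_left_module_def)
  have "linear_on (space M) (\<lambda>m. g (f m))"
    by (rule linear_on_compose[OF mod_homD(3)[OF f] _ mod_homD(3)[OF g]]) (use mod_homD(2)[OF f] in auto)
  then have "linear_on (space M) (compose (space M) g f)"
    by (subst linear_on_cong[OF s(1)]) (auto simp: compose_def)
  then show ?thesis
    using s mod_homD(2)[OF f] mod_homD(2)[OF g] mod_homD(4)[OF f] mod_homD(4)[OF g]
    by (auto simp: mod_hom_def compose_def)
qed

lemma mod_hom_id: "is_left_module A M \<Longrightarrow> mod_id M \<in> mod_hom A M M"
  unfolding mod_hom_def is_left_module_def
  by (auto simp: linear_on_def vec.subspace_add vec.subspace_scale)

lemma compose_eqI:
  "(\<And>x. x \<in> S \<Longrightarrow> f (g x) = f' (g' x)) \<Longrightarrow> compose S f g = compose S f' g'"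
  by (auto simp: compose_def)

lemma compose_eqD: "compose S f g = compose S f' g' \<Longrightarrow> x \<in> S \<Longrightarrow> f (g x) = f' (g' x)"
  by (metis compose_eq)

lemma act_mod_space: "space (act_mod H B X M) = space X \<boxtimes> space M"
  by (simp add: act_mod_def)

context finite_group
begin

lemma subgroup_moduleD:
  fixes M :: "('a, 'u, 'k::field) left_mod"
  assumes L: "subgroup L G" and M: "is_left_module (kS L) M"
  shows "vec.subspace (space M)"
    "b \<in> group_span L \<Longrightarrow> m \<in> space M \<Longrightarrow> act M b m \<in> space M"
    "bilinear_on (group_span L) (space M) (act M)"
    "m \<in> space M \<Longrightarrow> act M (grp \<one>) m = m"
    "x \<in> L \<Longrightarrow> y \<in> L \<Longrightarrow> m \<in> space M \<Longrightarrow>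
      act M (grp x) (act M (grp y) m) = act M (grp (x \<otimes> y)) m"
proof -
  show "x \<in> L \<Longrightarrow> y \<in> L \<Longrightarrow> m \<in> space M \<Longrightarrow>
      act M (grp x) (act M (grp y) m) = act M (grp (x \<otimes> y)) m"
    using M subgroup.mem_carrier[OF L] by (simp add: is_left_module_def grp_mult[symmetric] grp_in_group_span)
qed (use M in \<open>auto simp: is_left_module_def\<close>)

lemma subgroup_module_grp:
  fixes M :: "('a, 'u, 'k::field) left_mod"
  assumes L: "subgroup L G" and M: "is_left_module (kS L) M" and x: "x \<in> L"
  shows "linear_on (space M) (act M (grp x))"
    "m \<in> space M \<Longrightarrow> act M (grp x) m \<in> space M"
    "act M (grp x) \<in> space M \<rightarrow> space M"
  using subgroup_moduleD(2)[OF L M grp_in_group_span[OF x]]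
    bilinear_onD(1)[OF subgroup_moduleD(3)[OF L M] grp_in_group_span[OF x]] by auto

text \<open>Bilinearity extends an action of \<open>L\<close> by linear maps to
  \<open>group_span L\<close>; for the product axiom first the right and then the left algebra
  argument is made general.\<close>

lemma subgroup_moduleI:
  fixes M :: "('a, 'u, 'k::field) left_mod"
  assumes L: "subgroup L G" and sub: "vec.subspace (space M)"
    and bil: "bilinear_on (group_span L) (space M) (act M)"
    and cl: "\<And>x m. x \<in> L \<Longrightarrow> m \<in> space M \<Longrightarrow> act M (grp x) m \<in> space M"
    and one: "\<And>m. m \<in> space M \<Longrightarrow> act M (grp \<one>) m = m"
    and mult: "\<And>x y m. x \<in> L \<Longrightarrow> y \<in> L \<Longrightarrow> m \<in> space M \<Longrightarrow>
      act M (grp (x \<otimes> y)) m = act M (grp x) (act M (grp y) m)"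
  shows "is_left_module (kS L) M"
proof -
  interpret B: basis_algebra "base_monoid G L" "kS L :: ('a, 'k) comodule_alg"
    by (rule subgroup_basis_algebra[OF L])
  note bl = bilinear_onD(1)[OF bil] and br = bilinear_onD(2)[OF bil]
  have cl': "act M b m \<in> space M" if b: "b \<in> group_span L" and m: "m \<in> space M" for b m
    by (rule group_span_image[OF br[OF m] sub _ b]) (rule cl[OF _ m])
  have mc: "x \<otimes>\<^bsub>kG\<^esub> y \<in> group_span L" if "x \<in> group_span L" "y \<in> group_span L"
    for x y :: "('a, 'k) vec"
    using B.mult_closed that by simp
  have lm: "bilinear_on (group_span L) (group_span L) (\<lambda>x y. x \<otimes>\<^bsub>(kG :: ('a, 'k) hopf)\<^esub> y)"
    by (rule bilinear_on_group_mult)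
  have 1: "act M (grp x \<otimes>\<^bsub>kG\<^esub> b) m = act M (grp x) (act M b m)"
    if x: "x \<in> L" and b: "b \<in> group_span L" and m: "m \<in> space M" for x b m
    by (rule group_span_eqI[OF linear_on_compose[OF bilinear_onD(1)[OF lm] _ br[OF m]]
          linear_on_compose[OF br[OF m] _ bl] _ b])
      (use x m subgroup.mem_carrier[OF L] in
        \<open>auto simp: grp_in_group_span mc cl' grp_mult mult\<close>)
  have 2: "act M (c \<otimes>\<^bsub>kG\<^esub> b) m = act M c (act M b m)"
    if c: "c \<in> group_span L" and b: "b \<in> group_span L" and m: "m \<in> space M" for c b m
    by (rule group_span_eqI[OF linear_on_compose[OF bilinear_onD(2)[OF lm] _ br[OF m]] br _ c])
      (use b m in \<open>auto simp: mc cl' 1\<close>)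
  show ?thesis
    unfolding is_left_module_def using sub bil cl' one 2 by auto
qed

lemma subgroup_mod_homI:
  fixes M N :: "('a, 'u, 'k::field) left_mod"
  assumes L: "subgroup L G"
    and M: "is_left_module (kS L) M" and N: "is_left_module (kS L) N"
    and ext: "f \<in> extensional (space M)" and cl: "\<And>m. m \<in> space M \<Longrightarrow> f m \<in> space N"
    and lin: "linear_on (space M) f"
    and act: "\<And>x m. x \<in> L \<Longrightarrow> m \<in> space M \<Longrightarrow> f (act M (grp x) m) = act N (grp x) (f m)"
  shows "f \<in> mod_hom (kS L) M N"
proof -
  have "f (act M b m) = act N b (f m)" if b: "b \<in> group_span L" and m: "m \<in> space M" for b m
    by (rule group_span_eqI[OF linear_on_compose[OF bilinear_onD(2)[OF subgroup_moduleD(3)[OF L M] m] _ lin]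
          bilinear_onD(2)[OF subgroup_moduleD(3)[OF L N] cl[OF m]] act[OF _ m] b])
      (use subgroup_moduleD(2)[OF L M _ m] in auto)
  then show ?thesis using ext cl lin by (auto simp: mod_hom_def PiE_def)
qed

lemma mod_hom_grp:
  assumes "f \<in> mod_hom (kS L) M N" "x \<in> L" "m \<in> space M"
  shows "f (act M (grp x) m) = act N (grp x) (f m)"
  using mod_homD(4)[OF assms(1) _ assms(3), of "grp x"] assms(2) by (simp add: grp_in_group_span)

section \<open>The action of modules over the group algebra on modules over a subgroup
  algebra\<close>

context
  fixes L and X M :: "('a, 'u, 'k::field) left_mod"
  assumes L: "subgroup L G"
    and X: "is_left_module kG X" and M: "is_left_module (kS L) M"
begin

lemma subgroup_module_carrier: "is_left_module (kS (carrier G)) X"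
  using X by (simp add: is_left_module_group_iff)

lemmas modX = subgroup_moduleD[OF subgroup_self subgroup_module_carrier]
lemmas modM = subgroup_moduleD[OF L M]
lemmas modX_grp = subgroup_module_grp[OF subgroup_self subgroup_module_carrier]
lemmas modM_grp = subgroup_module_grp[OF L M]

lemma bilinear_on_tensor_act_aux:
  "t \<in> space X \<boxtimes> space M \<Longrightarrow> bilinear_on (group_span (carrier G)) (group_span L)
     (\<lambda>h b. tensor_map (space X) (space M) (act X h) (act M b) t)"
  by (intro bilinear_on_tensor_map modX modM subspace_group_span)

lemma linear_on_tensor_act_left:
  "t \<in> space X \<boxtimes> space M \<Longrightarrow> linear_on (group_span (carrier G) \<boxtimes> group_span L)
     (\<lambda>w. tensor_act kG (kS L) X M w t)"
  unfolding tensor_act_def group_algebra_simps subgroup_algebra_simps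
  by (rule tensor_lift(2)[OF subspace_group_span subspace_group_span bilinear_on_tensor_act_aux])

lemma linear_on_tensor_act_right:
  "w \<in> group_span (carrier G) \<boxtimes> group_span L \<Longrightarrow> linear_on (space X \<boxtimes> space M)
     (tensor_act kG (kS L) X M w)"
  unfolding tensor_act_def[abs_def] group_algebra_simps subgroup_algebra_simps
  by (rule tensor_lift_linear_param[OF subspace_group_span subspace_group_span subspace_tensor_space
        bilinear_on_tensor_act_aux linear_on_tensor_map[OF modX(1) modM(1)]])
    (auto intro: bilinear_onD(1)[OF modX(3)] bilinear_onD(1)[OF modM(3)])

lemma tensor_act_tens:
  assumes "h \<in> group_span (carrier G)" "b \<in> group_span L" "x \<in> space X" "m \<in> space M"
  shows "tensor_act kG (kS L) X M (h \<odot> b) (x \<odot> m) = act X h x \<odot> act M b m"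
  unfolding tensor_act_def group_algebra_simps subgroup_algebra_simps
  using assms tensor_lift(3)[OF subspace_group_span subspace_group_span
      bilinear_on_tensor_act_aux[OF tens_in_tensor_space[OF assms(3,4)]] assms(1,2)]
    tensor_map_tens[OF modX(1) modM(1) bilinear_onD(1)[OF modX(3)] bilinear_onD(1)[OF modM(3)]]
  by simp

lemma tensor_act_in:
  assumes w: "w \<in> group_span (carrier G) \<boxtimes> group_span L" and t: "t \<in> space X \<boxtimes> space M"
  shows "tensor_act kG (kS L) X M w t \<in> space X \<boxtimes> space M"
proof (rule tensor_image[OF linear_on_tensor_act_right[OF w] subspace_tensor_space _ t])
  fix x m assume xm: "x \<in> space X" "m \<in> space M"
  show "tensor_act kG (kS L) X M w (x \<odot> m) \<in> space X \<boxtimes> space M"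
    by (rule tensor_image[OF linear_on_tensor_act_left[OF tens_in_tensor_space[OF xm]] subspace_tensor_space _ w])
      (simp add: xm tensor_act_tens tens_in_tensor_space modX(2) modM(2))
qed

lemma act_mod_grp_linear:
  "x \<in> L \<Longrightarrow> linear_on (space X \<boxtimes> space M)
    (act (act_mod kG (kS L) X M) (grp x))"
  using subgroup.subset[OF L]
  by (auto simp: act_mod_def comult_grp intro!: linear_on_tensor_act_right tens_in_tensor_space grp_in_group_span)

lemma act_mod_grp_tens:
  "x \<in> L \<Longrightarrow> y \<in> space X \<Longrightarrow> m \<in> space M \<Longrightarrow>
    act (act_mod kG (kS L) X M) (grp x) (y \<odot> m) =
    act X (grp x) y \<odot> act M (grp x) m"
  using subgroup.subset[OF L]
  by (auto simp: act_mod_def comult_grp tensor_act_tens grp_in_group_span)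

lemma is_left_module_act_mod:
  "is_left_module (kS L) (act_mod kG (kS L) X M)"
proof (rule subgroup_moduleI[OF L], unfold act_mod_space)
  let ?N = "act_mod kG (kS L) X M"
  have com: "comult kG \<in> group_span L \<rightarrow> group_span (carrier G) \<boxtimes> group_span L"
    using comult_in_tensor[OF subgroup.subset[OF L]] by blast
  show "vec.subspace (space X \<boxtimes> space M)" by (rule subspace_tensor_space)
  show "bilinear_on (group_span L) (space X \<boxtimes> space M) (act ?N)"
    unfolding act_mod_def left_mod.select_convs subgroup_algebra_simps
    by (rule bilinear_onI, rule linear_on_tensor_act_right)
      (use com in \<open>auto intro: linear_on_compose[OF linear_on_comult com linear_on_tensor_act_left]\<close>)
  note lin = act_mod_grp_linear and tens = act_mod_grp_tens
  have LG: "x \<in> carrier G" if "x \<in> L" for x using that subgroup.subset[OF L] by blast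
  show cl: "act ?N (grp x) t \<in> space X \<boxtimes> space M" if "x \<in> L" "t \<in> space X \<boxtimes> space M" for x t
    by (rule tensor_image[OF lin[OF that(1)] subspace_tensor_space _ that(2)])
      (use that LG in \<open>simp add: tens tens_in_tensor_space modX_grp(2) modM_grp(2)\<close>)
  show "act ?N (grp \<one>) t = t" if "t \<in> space X \<boxtimes> space M" for t
    by (rule tensor_eqI[OF lin linear_on_id _ that])
      (simp_all add: subgroup.one_closed[OF L] tens modX(4) modM(4))
  show "act ?N (grp (x \<otimes> y)) t = act ?N (grp x) (act ?N (grp y) t)"
    if "x \<in> L" "y \<in> L" "t \<in> space X \<boxtimes> space M" for x y t
    by (rule tensor_eqI[OF lin linear_on_compose[OF lin _ lin] _ that(3)])
      (use that cl LG in \<open>auto simp: tens modX(5) modM(5) modX_grp(2) modM_grp(2) subgroup.m_closed[OF L]\<close>)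
qed

end

text \<open>The tensor product of two modules over the group algebra is the case of the whole group,
  so the lemmas on \<open>act_mod\<close> apply to it.\<close>

lemma tensor_mod_eq: "tensor_mod kG = act_mod kG (kS (carrier G))"
  by (simp add: tensor_mod_def subgroup_algebra_def)

lemma is_left_module_tensor_mod:
  fixes X Y :: "('a, 'u, 'k::field) left_mod"
  assumes "is_left_module kG X" "is_left_module kG Y"
  shows "is_left_module kG (tensor_mod kG X Y)"
  using is_left_module_act_mod[OF subgroup_self assms(1) assms(2)[folded is_left_module_group_iff]]
  unfolding is_left_module_group_iff tensor_mod_eq .

lemma tensor_mod_space: "space (tensor_mod kG X Y) = space X \<boxtimes> space Y"
  by (simp add: tensor_mod_def act_mod_def)

lemma unit_mod_space: "space (unit_mod H) = coord_space {Triv}"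
  by (simp add: unit_mod_def coord_space_def)

lemma is_left_module_unit_mod:
  "is_left_module kG (unit_mod (kG :: ('a, 'k::field) hopf) :: ('a, 'u, 'k) left_mod)"
proof -
  let ?U = "unit_mod (kG :: ('a, 'k) hopf) :: ('a, 'u, 'k) left_mod"
  have "is_left_module (kS (carrier G)) ?U"
  proof (rule subgroup_moduleI[OF subgroup_self])
    show "bilinear_on (group_span (carrier G)) (space ?U) (act ?U)"
      by (simp add: unit_mod_def bilinear_on_def linear_on_scale linear_on_id linear_on_counit_scale)
  qed (simp_all add: unit_mod_def counit_grp)
  then show ?thesis by (simp add: is_left_module_group_iff)
qed

lemma bilinear_on_unitor: "bilinear_on V W (\<lambda>c m. scale (c Triv) m)"
  by (simp add: bilinear_on_def linear_on_scale linear_on_id linear_on_eval_scale)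

lemma unitor_props:
  fixes M :: "('a, 'u, 'k::field) left_mod" and H :: "('a, 'k) hopf"
  assumes "vec.subspace (space M)"
  shows "unitor H M \<in> extensional (coord_space {Triv} \<boxtimes> space M)"
    "linear_on (coord_space {Triv} \<boxtimes> space M) (unitor H M)"
    "c \<in> coord_space {Triv} \<Longrightarrow> m \<in> space M \<Longrightarrow> unitor H M (c \<odot> m) = scale (c Triv) m"
  unfolding unitor_def unit_mod_space
  using tensor_lift[OF subspace_coord_space assms bilinear_on_unitor] by auto

lemma tensor_map_mod_hom:
  fixes X X' M M' :: "('a, 'u, 'k::field) left_mod"
  assumes L: "subgroup L G"
    and X: "is_left_module kG X" and X': "is_left_module kG X'"
    and M: "is_left_module (kS L) M" and M': "is_left_module (kS L) M'"
    and f: "f \<in> mod_hom kG X X'" and g: "g \<in> mod_hom (kS L) M M'"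
  shows "tensor_map (space X) (space M) f g \<in> mod_hom (kS L)
    (act_mod kG (kS L) X M)
    (act_mod kG (kS L) X' M')"
proof (rule subgroup_mod_homI[OF L is_left_module_act_mod[OF L X M] is_left_module_act_mod[OF L X' M']],
    unfold act_mod_space)
  note sub = modX(1)[OF L X M] modM(1)[OF L X M]
  note t = tensor_map_extensional[OF sub mod_homD(3)[OF f] mod_homD(3)[OF g]]
    linear_on_tensor_map[OF sub mod_homD(3)[OF f] mod_homD(3)[OF g]]
    tensor_map_tens[OF sub mod_homD(3)[OF f] mod_homD(3)[OF g]]
    tensor_map_in[OF sub mod_homD(3)[OF f] mod_homD(3)[OF g]]
  show "tensor_map (space X) (space M) f g \<in> extensional (space X \<boxtimes> space M)" by (rule t(1))
  show "linear_on (space X \<boxtimes> space M) (tensor_map (space X) (space M) f g)" by (rule t(2))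
  show cl: "tensor_map (space X) (space M) f g m \<in> space X' \<boxtimes> space M'" if "m \<in> space X \<boxtimes> space M" for m
    by (rule t(4)) (use that mod_homD(2)[OF f] mod_homD(2)[OF g] in auto)
  fix x m assume x: "x \<in> L" and m: "m \<in> space X \<boxtimes> space M"
  have xG: "x \<in> carrier G" using x subgroup.subset[OF L] by blast
  let ?N = "act_mod kG (kS L) X M"
  let ?N' = "act_mod kG (kS L) X' M'"
  have a: "act ?N (grp x) \<in> space X \<boxtimes> space M \<rightarrow> space X \<boxtimes> space M"
    using subgroup_module_grp(3)[OF L is_left_module_act_mod[OF L X M] x] by (simp add: act_mod_space)
  show "tensor_map (space X) (space M) f g (act ?N (grp x) m) =
      act ?N' (grp x) (tensor_map (space X) (space M) f g m)"
    by (rule tensor_eqI[OF linear_on_compose[OF act_mod_grp_linear[OF L X M x] a t(2)]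
          linear_on_compose[OF t(2) _ act_mod_grp_linear[OF L X' M' x]] _ m])
      (use cl mod_hom_grp[OF f[folded mod_hom_group] xG] mod_hom_grp[OF g x]
        mod_homD(2)[OF f] mod_homD(2)[OF g] in
        \<open>auto simp: act_mod_grp_tens[OF L X M x] act_mod_grp_tens[OF L X' M' x] t(3)
          modX_grp(2)[OF L X M xG] modM_grp(2)[OF L X M x]\<close>)
qed

end

section \<open>Twisting modules by an inner automorphism\<close>

context finite_group
begin

definition conj_map :: "'a \<Rightarrow> ('a, 'k::field) vec \<Rightarrow> ('a, 'k) vec" where
  "conj_map x b = (\<Sum>y\<in>carrier G. scale (b (Base y)) (grp (x \<otimes> y \<otimes> inv x)))"

lemma linear_on_conj_map: "linear_on V (conj_map x)"
  unfolding conj_map_def[abs_def] by (intro linear_on_sum_fun linear_on_eval_scale)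

lemma conj_map_grp: "y \<in> carrier G \<Longrightarrow> conj_map x (grp y) = grp (x \<otimes> y \<otimes> inv x)"
  by (simp add: conj_map_def sum_grp_apply)

text \<open>Restriction along conjugation by \<open>x\<close>: modules over \<open>L\<close> become
  modules over \<open>L'\<close> as soon as this conjugation maps \<open>L'\<close> into
  \<open>L\<close>. For \<open>L'\<close> the conjugate of \<open>L\<close> under \<open>g\<close>,
  the right choice is therefore \<open>x = inv g\<close>.\<close>

definition twist_mod :: "'a \<Rightarrow> ('a, 'u, 'k::field) left_mod \<Rightarrow> ('a, 'u, 'k) left_mod" where
  "twist_mod x M = \<lparr>space = space M, act = (\<lambda>b. act M (conj_map x b))\<rparr>"

definition twist :: "'a \<Rightarrow> ('a, 'a, 'u, 'k::field) mod_functor" where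
  "twist x = \<lparr>ob = twist_mod x, ar = (\<lambda>M N f. f)\<rparr>"

lemma twist_simps [simp]:
  "space (twist_mod x M) = space M" "ob (twist x) = twist_mod x" "ar (twist x) M N f = f"
  by (simp_all add: twist_mod_def twist_def)

lemma twist_mod_grp:
  "y \<in> carrier G \<Longrightarrow> act (twist_mod x M) (grp y) = act M (grp (x \<otimes> y \<otimes> inv x))"
  by (simp add: twist_mod_def conj_map_grp)

context
  fixes L L' and x
  assumes L: "subgroup L G" and L': "subgroup L' G" and x: "x \<in> carrier G"
    and conj: "\<forall>y\<in>L'. x \<otimes> y \<otimes> inv x \<in> L"
begin

lemma is_left_module_twist:
  assumes M: "is_left_module (kS L) M"
  shows "is_left_module (kS L') (twist_mod x M)"
proof (rule subgroup_moduleI[OF L'])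
  note mM = subgroup_moduleD[OF L M] and gM = subgroup_module_grp[OF L M]
  have L'G: "y \<in> carrier G" if "y \<in> L'" for y using that subgroup.subset[OF L'] by blast
  have cm: "conj_map x \<in> group_span L' \<rightarrow> group_span L"
    by (rule Pi_I, rule group_span_image[OF linear_on_conj_map subspace_group_span])
      (simp_all add: L'G conj_map_grp conj grp_in_group_span)
  show "vec.subspace (space (twist_mod x M))" using mM(1) by simp
  show "bilinear_on (group_span L') (space (twist_mod x M)) (act (twist_mod x M))"
    unfolding twist_mod_def left_mod.select_convs
    by (rule bilinear_onI, rule bilinear_onD(1)[OF mM(3)])
      (use cm in \<open>auto intro: linear_on_compose[OF linear_on_conj_map cm bilinear_onD(2)[OF mM(3)]]\<close>)
  show "act (twist_mod x M) (grp y) m \<in> space (twist_mod x M)"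
    if "y \<in> L'" "m \<in> space (twist_mod x M)" for y m
    using that by (simp add: twist_mod_grp L'G gM(2) conj)
  show "act (twist_mod x M) (grp \<one>) m = m" if "m \<in> space (twist_mod x M)" for m
    using that x by (simp add: twist_mod_grp mM(4))
  show "act (twist_mod x M) (grp (y \<otimes> z)) m = act (twist_mod x M) (grp y) (act (twist_mod x M) (grp z) m)"
    if "y \<in> L'" "z \<in> L'" "m \<in> space (twist_mod x M)" for y z m
  proof -
    have "x \<otimes> (y \<otimes> z) \<otimes> inv x = (x \<otimes> y \<otimes> inv x) \<otimes> (x \<otimes> z \<otimes> inv x)"
      using that x L'G by (simp add: m_assoc inv_solve_left)
    then show ?thesis using that by (simp add: twist_mod_grp L'G conj mM(5))
  qed
qed

lemma mod_hom_twist: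
  assumes M: "is_left_module (kS L) M" and N: "is_left_module (kS L) N"
    and f: "f \<in> mod_hom (kS L) M N"
  shows "f \<in> mod_hom (kS L') (twist_mod x M) (twist_mod x N)"
  by (rule subgroup_mod_homI[OF L' is_left_module_twist[OF M] is_left_module_twist[OF N]])
    (use mod_homD(1-3)[OF f] mod_hom_grp[OF f] subgroup.subset[OF L'] conj
      in \<open>auto simp: twist_mod_grp subset_iff\<close>)

lemma is_linear_functor_twist:
  "is_linear_functor (kS L) (kS L') (twist x)"
  unfolding is_linear_functor_def by (auto simp: is_left_module_twist mod_hom_twist)

end

text \<open>Twisting forth and back restores the action on group elements, but the two actions may
  still differ as HOL functions. The round trip is therefore an isomorphism carried by the identity
  map, and not an equality of objects.\<close>

lemma mod_iso_mod_id:
  fixes M N :: "('a, 'u, 'k::field) left_mod"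
  assumes L: "subgroup L G"
    and M: "is_left_module (kS L) M" and N: "is_left_module (kS L) N"
    and sp: "space M = space N"
    and eq: "\<And>y m. y \<in> L \<Longrightarrow> m \<in> space M \<Longrightarrow> act M (grp y) m = act N (grp y) m"
  shows "mod_iso (kS L) M N (mod_id M)"
proof -
  have lin: "linear_on (space M) (mod_id M)"
    using mod_homD(3)[OF mod_hom_id[OF M]] .
  have 1: "mod_id M \<in> mod_hom (kS L) M N"
    by (rule subgroup_mod_homI[OF L M N _ _ lin])
      (auto simp: sp eq[unfolded sp] subgroup_module_grp(2)[OF L N])
  have 2: "mod_id M \<in> mod_hom (kS L) N M"
    unfolding sp by (rule subgroup_mod_homI[OF L N M _ _ lin[unfolded sp]])
      (use eq in \<open>auto simp: sp subgroup_module_grp(2)[OF L N]\<close>)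
  show ?thesis
    unfolding mod_iso_def using 1 2 by (auto simp: compose_def sp intro!: bexI[of _ "mod_id M"])
qed

lemma twist_twist:
  fixes M :: "('a, 'u, 'k::field) left_mod"
  assumes "x \<in> carrier G" "y \<in> carrier G"
  shows "act (twist_mod x (twist_mod (inv x) M)) (grp y) = act M (grp y)"
    "act (twist_mod (inv x) (twist_mod x M)) (grp y) = act M (grp y)"
proof -
  have "inv x \<otimes> (x \<otimes> y \<otimes> inv x) \<otimes> inv (inv x) = y" "x \<otimes> (inv x \<otimes> y \<otimes> inv (inv x)) \<otimes> inv x = y"
    using assms by (simp_all add: m_assoc) (simp_all add: m_assoc[symmetric])
  then show "act (twist_mod x (twist_mod (inv x) M)) (grp y) = act M (grp y)"
    "act (twist_mod (inv x) (twist_mod x M)) (grp y) = act M (grp y)"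
    using assms by (simp_all add: twist_mod_grp)
qed

lemma is_equivalence_twist:
  assumes L: "subgroup L G" and L': "subgroup L' G" and x: "x \<in> carrier G"
    and conj: "\<forall>y\<in>L'. x \<otimes> y \<otimes> inv x \<in> L"
    and conj': "\<forall>y\<in>L. inv x \<otimes> y \<otimes> x \<in> L'"
  shows "is_equivalence (kS L) (kS L')
    (twist x :: ('a, 'a, 'u, 'k::field) mod_functor)"
proof -
  have ix: "inv x \<in> carrier G" using x by simp
  have conj'': "\<forall>y\<in>L. inv x \<otimes> y \<otimes> inv (inv x) \<in> L'" using conj' x by simp
  note t1 = is_left_module_twist[OF L L' x conj] and t2 = is_left_module_twist[OF L' L ix conj'']
  have "nat_iso (kS L) (kS L) id_functor
      (comp_functor (twist (inv x)) (twist x)) (\<lambda>M :: ('a, 'u, 'k) left_mod. mod_id M)"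
    unfolding nat_iso_def id_functor_def comp_functor_def
    using subgroup.subset[OF L] x
    by (auto simp: twist_twist subset_iff t1 t2 mod_homD(2) intro!: mod_iso_mod_id[OF L] compose_eqI)
  moreover have "nat_iso (kS L') (kS L')
      (comp_functor (twist x) (twist (inv x))) id_functor (\<lambda>M :: ('a, 'u, 'k) left_mod. mod_id M)"
    unfolding nat_iso_def id_functor_def comp_functor_def
    using subgroup.subset[OF L'] x mod_iso_mod_id[OF L' t1[OF t2]]
    by (auto simp: twist_twist subset_iff mod_homD(2) intro!: compose_eqI)
  ultimately show ?thesis
    unfolding is_equivalence_def
    using is_linear_functor_twist[OF L L' x conj] is_linear_functor_twist[OF L' L ix conj''] by blast
qed

text \<open>After twisting the tensor product, \<open>y\<close> in \<open>L'\<close> acts on the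
  factor \<open>X\<close> through \<open>inv g \<otimes> y \<otimes> g\<close>; in the target it
  acts on \<open>X\<close> as itself. Acting by \<open>g\<close> intertwines the two. On
  \<open>M\<close> both actions coincide, hence the identity there.\<close>

definition twist_constraint ::
  "'a \<Rightarrow> ('a, 'u, 'k::field) left_mod \<Rightarrow> ('a, 'u, 'k) left_mod \<Rightarrow> ('u, 'k) vec \<Rightarrow> ('u, 'k) vec" where
  "twist_constraint g X M = tensor_map (space X) (space M) (act X (grp g)) (\<lambda>m. m)"

context
  fixes L L' and g
  assumes L: "subgroup L G" and L': "subgroup L' G" and g: "g \<in> carrier G"
    and conj: "\<forall>y\<in>L'. inv g \<otimes> y \<otimes> g \<in> L"
begin

lemma conj_inv: "\<forall>y\<in>L'. inv g \<otimes> y \<otimes> inv (inv g) \<in> L"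
  using conj g by simp

lemmas twist_module = is_left_module_twist[OF L L' inv_closed[OF g] conj_inv]

context
  fixes X M :: "('a, 'u, 'k::field) left_mod"
  assumes X: "is_left_module kG X" and M: "is_left_module (kS L) M"
begin

lemma twist_constraint_props:
  "h \<in> carrier G \<Longrightarrow> twist_constraint h X M \<in> extensional (space X \<boxtimes> space M)"
  "h \<in> carrier G \<Longrightarrow> linear_on (space X \<boxtimes> space M) (twist_constraint h X M)"
  "h \<in> carrier G \<Longrightarrow> y \<in> space X \<Longrightarrow> m \<in> space M \<Longrightarrow> twist_constraint h X M (y \<odot> m) = act X (grp h) y \<odot> m"
  "h \<in> carrier G \<Longrightarrow> t \<in> space X \<boxtimes> space M \<Longrightarrow> twist_constraint h X M t \<in> space X \<boxtimes> space M"
  unfolding twist_constraint_def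
  using tensor_map_extensional[OF modX(1)[OF L X M] modM(1)[OF L X M] modX_grp(1)[OF L X M] linear_on_id]
    linear_on_tensor_map[OF modX(1)[OF L X M] modM(1)[OF L X M] modX_grp(1)[OF L X M] linear_on_id]
    tensor_map_tens[OF modX(1)[OF L X M] modM(1)[OF L X M] modX_grp(1)[OF L X M] linear_on_id]
    tensor_map_in[OF modX(1)[OF L X M] modM(1)[OF L X M] modX_grp(1)[OF L X M] linear_on_id]
    modX_grp(2)[OF L X M]
  by auto

lemma mod_iso_twist_constraint:
  "mod_iso (kS L') (twist_mod (inv g) (act_mod kG (kS L) X M))
    (act_mod kG (kS L') X (twist_mod (inv g) M)) (twist_constraint g X M)"
    (is "mod_iso ?B' ?P ?Q _")
proof -
  note XM = is_left_module_act_mod[OF L X M] and c = twist_constraint_props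
    and TM = twist_module[OF M]
  note P = twist_module[OF XM] and Q = is_left_module_act_mod[OF L' X TM]
  have sp: "space ?P = space X \<boxtimes> space M" "space ?Q = space X \<boxtimes> space M"
    by (simp_all add: act_mod_space)
  have LG: "y \<in> carrier G" if "y \<in> L'" for y using that subgroup.subset[OF L'] by blast
  have lP: "linear_on (space X \<boxtimes> space M) (act ?P (grp y))"
    and iP: "act ?P (grp y) \<in> space X \<boxtimes> space M \<rightarrow> space X \<boxtimes> space M"
    and lQ: "linear_on (space X \<boxtimes> space M) (act ?Q (grp y))"
    and iQ: "act ?Q (grp y) \<in> space X \<boxtimes> space M \<rightarrow> space X \<boxtimes> space M" if "y \<in> L'" for y
    using subgroup_module_grp(1,3)[OF L' P that] subgroup_module_grp(1,3)[OF L' Q that] sp by simp_all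
  have tP: "act ?P (grp y) (z \<odot> m) = act X (grp (inv g \<otimes> y \<otimes> g)) z \<odot> act M (grp (inv g \<otimes> y \<otimes> g)) m"
    and tQ: "act ?Q (grp y) (z \<odot> m) = act X (grp y) z \<odot> act M (grp (inv g \<otimes> y \<otimes> g)) m"
    if "y \<in> L'" "z \<in> space X" "m \<in> space M" for y z m
    using that g LG by (simp_all add: twist_mod_grp act_mod_grp_tens[OF L X M] conj
        act_mod_grp_tens[OF L' X TM])
  have e1: "act X (grp g) (act X (grp (inv g \<otimes> y \<otimes> g)) z) = act X (grp y) (act X (grp g) z)"
    and e2: "act X (grp (inv g)) (act X (grp y) z) = act X (grp (inv g \<otimes> y \<otimes> g)) (act X (grp (inv g)) z)"
    if "y \<in> L'" "z \<in> space X" for y z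
  proof -
    have "g \<otimes> (inv g \<otimes> y \<otimes> g) = y \<otimes> g" "inv g \<otimes> y \<otimes> g \<otimes> inv g = inv g \<otimes> y"
      using g LG[OF that(1)] by (simp_all add: m_assoc) (simp_all add: m_assoc[symmetric])
    then show "act X (grp g) (act X (grp (inv g \<otimes> y \<otimes> g)) z) = act X (grp y) (act X (grp g) z)"
      "act X (grp (inv g)) (act X (grp y) z) = act X (grp (inv g \<otimes> y \<otimes> g)) (act X (grp (inv g)) z)"
      using that LG g by (simp_all add: modX(5)[OF L X M])
  qed
  have LL: "inv g \<otimes> y \<otimes> g \<in> carrier G" if "y \<in> L'" for y using LG[OF that] g by simp
  note gc = modX_grp(2)[OF L X M] modM_grp(2)[OF L X M]
  have f: "twist_constraint g X M \<in> mod_hom ?B' ?P ?Q"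
  proof (rule subgroup_mod_homI[OF L' P Q], unfold sp)
    fix y t assume y: "y \<in> L'" and t: "t \<in> space X \<boxtimes> space M"
    show "twist_constraint g X M (act ?P (grp y) t) = act ?Q (grp y) (twist_constraint g X M t)"
      by (rule tensor_eqI[OF linear_on_compose[OF lP iP c(2)] linear_on_compose[OF c(2) _ lQ] _ t])
        (use y g LL in \<open>auto simp: tP tQ c(3,4) gc conj e1\<close>)
  qed (use g c in auto)
  have f': "twist_constraint (inv g) X M \<in> mod_hom ?B' ?Q ?P"
  proof (rule subgroup_mod_homI[OF L' Q P], unfold sp)
    fix y t assume y: "y \<in> L'" and t: "t \<in> space X \<boxtimes> space M"
    show "twist_constraint (inv g) X M (act ?Q (grp y) t) = act ?P (grp y) (twist_constraint (inv g) X M t)"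
      by (rule tensor_eqI[OF linear_on_compose[OF lQ iQ c(2)] linear_on_compose[OF c(2) _ lP] _ t])
        (use y g LG in \<open>auto simp: tP tQ c(3,4) gc conj e2\<close>)
  qed (use g c in auto)
  have inv: "twist_constraint h X M (twist_constraint h' X M t) = t"
    if "h \<in> carrier G" "h' \<in> carrier G" "h \<otimes> h' = \<one>" "t \<in> space X \<boxtimes> space M" for h h' t
    by (rule tensor_eqI[OF linear_on_compose[OF c(2) _ c(2)] linear_on_id _ that(4)])
      (use that in \<open>auto simp: c(3,4) gc modX(4,5)[OF L X M]\<close>)
  show ?thesis
    unfolding mod_iso_def sp using f f' g
    by (auto simp: compose_def inv intro!: bexI[of _ "twist_constraint (inv g) X M"])
qed

text \<open>On \<open>y \<odot> m\<close> one side applies \<open>a'\<close> after \<open>g\<close>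
  to \<open>y\<close>, the other \<open>g\<close> after \<open>a\<close>; the relation between
  \<open>a\<close> and \<open>a'\<close> is what makes them agree.\<close>

lemma twist_constraint_braiding:
  assumes a: "a \<in> centralizer G L" and a': "a' \<in> carrier G" "a' \<otimes> g = g \<otimes> a"
    and t: "t \<in> space X \<boxtimes> space M"
  shows "module_braiding kG (kS L') (grp a' \<odot> grp \<one>) X (twist_mod (inv g) M)
      (twist_constraint g X M t) =
    twist_constraint g X M
      (module_braiding kG (kS L) (grp a \<odot> grp \<one>) X M t)"
proof -
  have aG: "a \<in> carrier G" using a by (simp add: centralizer_def)
  note c = twist_constraint_props and TM = twist_module[OF M]
  have K: "grp a \<odot> grp \<one> \<in> group_span (carrier G) \<boxtimes> group_span L"
    "grp a' \<odot> grp \<one> \<in> group_span (carrier G) \<boxtimes> group_span L'"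
    using aG a' L L' by (auto intro!: tens_in_tensor_space grp_in_group_span simp: subgroup.one_closed)
  note l = linear_on_tensor_act_right[OF L X M K(1)]
    linear_on_tensor_act_right[OF L' X TM K(2), unfolded twist_simps]
  have 1: "tensor_act kG (kS L) X M (grp a \<odot> grp \<one>) (y \<odot> m) = act X (grp a) y \<odot> m"
    "tensor_act kG (kS L') X (twist_mod (inv g) M) (grp a' \<odot> grp \<one>) (y \<odot> m) =
      act X (grp a') y \<odot> m" if "y \<in> space X" "m \<in> space M" for y m
    using that tensor_act_tens[OF L X M, of "grp a" "grp \<one>" y m]
      tensor_act_tens[OF L' X TM, of "grp a'" "grp \<one>" y m]
      modM(4)[OF L X M, of m] subgroup_moduleD(4)[OF L' TM, of m] aG a' L L'
    by (simp_all add: grp_in_group_span subgroup.one_closed)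
  have "tensor_act kG (kS L') X (twist_mod (inv g) M) (grp a' \<odot> grp \<one>) (twist_constraint g X M t) =
    twist_constraint g X M (tensor_act kG (kS L) X M (grp a \<odot> grp \<one>) t)"
    by (rule tensor_eqI[OF linear_on_compose[OF c(2) _ l(2)] linear_on_compose[OF l(1) _ c(2)] _ t])
      (use g aG a' tensor_act_in[OF L X M K(1)] in
        \<open>auto simp: 1 c(3,4) modX_grp(2)[OF L X M] modX(5)[OF L X M]\<close>)
  then show ?thesis
    using t c(4)[OF g t] by (simp add: module_braiding_def)
qed

end

text \<open>Naturality holds because module maps commute with \<open>g\<close>, the pentagon because
  \<open>g\<close> is group-like and so acts diagonally on a tensor product, the triangle because
  its counit is 1.\<close>

lemma is_module_functor_twist:
  "is_module_functor kG (kS L) (kS L')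
    (twist (inv g) :: ('a, 'a, 'u, 'k::field) mod_functor) (twist_constraint g)"
proof -
  let ?H = "kG :: ('a, 'k) hopf" and ?B = "kS L :: ('a, 'k) comodule_alg"
  note c = twist_constraint_props and gc = modX_grp(2)[OF L] modM_grp(2)[OF L]
  have nat: "twist_constraint g X' M' (tensor_map (space X) (space M) f k t) =
      tensor_map (space X) (space M) f k (twist_constraint g X M t)"
    if X: "is_left_module ?H X" and X': "is_left_module ?H X'"
      and M: "is_left_module ?B M" and M': "is_left_module ?B M'"
      and f: "f \<in> mod_hom ?H X X'" and k: "k \<in> mod_hom ?B M M'" and t: "t \<in> space X \<boxtimes> space M"
    for X X' M M' :: "('a, 'u, 'k) left_mod" and f k t
  proof -
    note tm = linear_on_tensor_map[OF modX(1)[OF L X M] modM(1)[OF L X M] mod_homD(3)[OF f] mod_homD(3)[OF k]]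
      tensor_map_tens[OF modX(1)[OF L X M] modM(1)[OF L X M] mod_homD(3)[OF f] mod_homD(3)[OF k]]
      tensor_map_in[OF modX(1)[OF L X M] modM(1)[OF L X M] mod_homD(3)[OF f] mod_homD(3)[OF k]]
    show ?thesis
      by (rule tensor_eqI[OF linear_on_compose[OF tm(1) _ c(2)[OF X' M' g]]
            linear_on_compose[OF c(2)[OF X M g] _ tm(1)] _ t])
        (use g c(4)[OF X M g] mod_homD(2)[OF f] mod_homD(2)[OF k] tm(3)[of "space X'" "space M'"]
          mod_hom_grp[OF f[folded mod_hom_group] g] gc[OF X M] in
          \<open>auto simp: tm(2) c(3)[OF X' M' g] c(3)[OF X M g]\<close>)
  qed
  have pent: "tensor_assoc (space X) (space Y) (space M) (twist_constraint g (tensor_mod ?H X Y) M t) =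
      tensor_map (space X) (space Y \<boxtimes> space M) (\<lambda>x. x) (twist_constraint g Y M)
        (twist_constraint g X (act_mod ?H ?B Y M) (tensor_assoc (space X) (space Y) (space M) t))"
    if X: "is_left_module ?H X" and Y: "is_left_module ?H Y" and M: "is_left_module ?B M"
      and t: "t \<in> (space X \<boxtimes> space Y) \<boxtimes> space M" for X Y M :: "('a, 'u, 'k) left_mod" and t
  proof -
    note XY = is_left_module_tensor_mod[OF X Y] and YM = is_left_module_act_mod[OF L Y M]
    note sub = modX(1)[OF L X M] modX(1)[OF L Y M] modM(1)[OF L X M]
    note as = linear_on_tensor_assoc[OF sub] tensor_assoc_in[OF sub] tensor_assoc_tens[OF sub]
    note c1 = c(2-4)[OF XY M g, unfolded tensor_mod_space] and c2 = c(2-4)[OF X YM g, unfolded act_mod_space]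
    note tm = linear_on_tensor_map[OF sub(1) subspace_tensor_space linear_on_id c(2)[OF Y M g]]
      tensor_map_tens[OF sub(1) subspace_tensor_space linear_on_id c(2)[OF Y M g]]
    have tg: "act (tensor_mod ?H X Y) (grp g) (x \<odot> y) = act X (grp g) x \<odot> act Y (grp g) y"
      if "x \<in> space X" "y \<in> space Y" for x y
      unfolding tensor_mod_eq
      using act_mod_grp_tens[OF subgroup_self X Y[folded is_left_module_group_iff] g] that by simp
    show ?thesis
      by (rule tensor_eqI3[OF linear_on_compose[OF c1(1) _ as(1)]
            linear_on_compose[OF linear_on_compose[OF as(1) _ c2(1)] _ tm(1)] _ t])
        (use c1(3) c2(3) as(2) gc[OF X M] gc[OF Y M] g in
          \<open>auto simp: c1(2) c2(2) as(3) tm(2) tg tens_in_tensor_space c(3)[OF Y M g]\<close>)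
  qed
  have tri: "unitor ?H (twist_mod (inv g) M) (twist_constraint g (unit_mod ?H) M t) = unitor ?H M t"
    if M: "is_left_module ?B M" and t: "t \<in> coord_space {Triv} \<boxtimes> space M"
    for M :: "('a, 'u, 'k) left_mod" and t
  proof -
    note U = is_left_module_unit_mod
    note sub = modM(1)[OF L U M]
    note u = unitor_props[OF sub, where H = ?H]
      unitor_props[of "twist_mod (inv g) M", where H = ?H, unfolded twist_simps, OF sub]
    note cU = c[OF U M g, unfolded unit_mod_space]
    have a: "act (unit_mod ?H) (grp g) y = y" for y :: "('u, 'k) vec"
      using g by (simp add: unit_mod_def counit_grp)
    show ?thesis
      by (rule tensor_eqI[OF linear_on_compose[OF cU(2) _ u(5)] u(2) _ t])
        (use cU(4) in \<open>auto simp: cU(3) a u(3,6)\<close>)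
  qed
  have tri_ext: "compose (coord_space {Triv} \<boxtimes> space M) (unitor ?H (twist_mod (inv g) M))
      (twist_constraint g (unit_mod ?H) M) = unitor ?H M"
    if M: "is_left_module ?B M" for M :: "('a, 'u, 'k) left_mod"
    by (rule extensionalityI[OF _ unitor_props(1)[OF subgroup_moduleD(1)[OF L M]]])
      (simp_all add: compose_def tri[OF M])
  show ?thesis
    unfolding is_module_functor_def twist_simps act_mod_space tensor_mod_space unit_mod_space
    by (intro conjI allI impI ballI compose_eqI is_linear_functor_twist[OF L L' inv_closed[OF g] conj_inv]
        mod_iso_twist_constraint nat)
      (simp_all add: pent tri_ext compose_eq)
qed

end

lemma braided_morita_equivalent_conjugate:
  assumes L: "subgroup L G" and g: "g \<in> carrier G" and a: "a \<in> centralizer G L"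
  defines "L' \<equiv> (\<lambda>l. g \<otimes> l \<otimes> inv g) ` L"
  assumes L': "subgroup L' G"
  shows "braided_morita_equivalent TYPE('u) (kG :: ('a, 'k::field) hopf)
    (kS L) (grp a \<odot> grp \<one>) (kS L') (grp (g \<otimes> a \<otimes> inv g) \<odot> grp \<one>)"
proof -
  have LG: "y \<in> carrier G" if "y \<in> L" for y using that subgroup.subset[OF L] by blast
  have aG: "a \<in> carrier G" using a by (simp add: centralizer_def)
  have e: "inv g \<otimes> (g \<otimes> y \<otimes> inv g) \<otimes> g = y" if "y \<in> carrier G" for y
    using that g by (simp add: m_assoc) (simp add: m_assoc[symmetric])
  have conj: "\<forall>y\<in>L'. inv g \<otimes> y \<otimes> g \<in> L" using LG e by (auto simp: L'_def)
  have conj2: "\<forall>y\<in>L. inv (inv g) \<otimes> y \<otimes> inv g \<in> L'" using g by (auto simp: L'_def)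
  have conj1: "\<forall>y\<in>L'. inv g \<otimes> y \<otimes> inv (inv g) \<in> L" using conj g by simp
  have a': "g \<otimes> a \<otimes> inv g \<in> carrier G" "g \<otimes> a \<otimes> inv g \<otimes> g = g \<otimes> a"
    using g aG by (simp_all add: m_assoc)
  show ?thesis
    unfolding braided_morita_equivalent_def
  proof (intro exI conjI allI impI)
    show "is_module_functor kG (kS L) (kS L')
      (twist (inv g) :: ('a, 'a, 'u, 'k) mod_functor) (twist_constraint g)"
      by (rule is_module_functor_twist[OF L L' g conj])
    show "is_equivalence (kS L) (kS L') (twist (inv g) :: ('a, 'a, 'u, 'k) mod_functor)"
      by (rule is_equivalence_twist[OF L L' inv_closed[OF g] conj1 conj2])
    show "compose (space (ob (twist (inv g)) (act_mod kG (kS L) X M)))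
        (module_braiding kG (kS L') (grp (g \<otimes> a \<otimes> inv g) \<odot> grp \<one>) X (ob (twist (inv g)) M))
        (twist_constraint g X M) =
      compose (space (ob (twist (inv g)) (act_mod kG (kS L) X M)))
        (twist_constraint g X M)
        (ar (twist (inv g)) (act_mod kG (kS L) X M)
          (act_mod kG (kS L) X M)
          (module_braiding kG (kS L) (grp a \<odot> grp \<one>) X M))"
      if "is_left_module kG X" "is_left_module (kS L) M"
      for X M :: "('a, 'u, 'k) left_mod"
      using twist_constraint_braiding[OF L L' g conj that a a']
      by (intro compose_eqI) (simp add: act_mod_space)
  qed
qed

end

section \<open>Equivalences are full and faithful\<close>

lemma mod_isoE:
  assumes "mod_iso A M N f"
  obtains f' where "f \<in> mod_hom A M N" "f' \<in> mod_hom A N M"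
    "\<And>m. m \<in> space M \<Longrightarrow> f' (f m) = m" "\<And>n. n \<in> space N \<Longrightarrow> f (f' n) = n"
proof -
  from assms obtain f' where f: "f \<in> mod_hom A M N" "f' \<in> mod_hom A N M"
    "compose (space M) f' f = mod_id M" "compose (space N) f f' = mod_id N"
    by (auto simp: mod_iso_def)
  show ?thesis
  proof (rule that[OF f(1,2)])
    show "f' (f m) = m" if "m \<in> space M" for m
      using fun_cong[OF f(3), of m] that by (simp add: compose_def)
    show "f (f' n) = n" if "n \<in> space N" for n
      using fun_cong[OF f(4), of n] that by (simp add: compose_def)
  qed
qed

lemma mod_hom_eqI:
  assumes "f \<in> mod_hom A M N" "h \<in> mod_hom A M N" "\<And>m. m \<in> space M \<Longrightarrow> f m = h m"
  shows "f = h"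
  using extensionalityI[OF mod_homD(1)[OF assms(1)] mod_homD(1)[OF assms(2)] assms(3)] .

text \<open>By naturality \<open>\<eta> N\<close> after \<open>f\<close> equals the image of
  \<open>f\<close> after \<open>\<eta> M\<close>, and \<open>\<eta> N\<close> is injective.\<close>

lemma faithful_of_unit:
  assumes nat: "nat_iso A A id_functor D \<eta>" and M: "is_left_module A M" and N: "is_left_module A N"
    and f: "f \<in> mod_hom A M N" and h: "h \<in> mod_hom A M N" and eq: "ar D M N f = ar D M N h"
  shows "f = h"
proof (rule mod_hom_eqI[OF f h])
  fix m assume m: "m \<in> space M"
  have "mod_iso A N (ob D N) (\<eta> N)" using nat N by (simp add: nat_iso_def id_functor_def)
  then obtain \<eta>' where \<eta>': "\<And>n. n \<in> space N \<Longrightarrow> \<eta>' (\<eta> N n) = n" by (rule mod_isoE) blast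
  have "compose (space M) (\<eta> N) k = compose (space M) (ar D M N k) (\<eta> M)" if "k \<in> mod_hom A M N" for k
    using nat M N that by (simp add: nat_iso_def id_functor_def)
  from compose_eqD[OF this[OF f] m] compose_eqD[OF this[OF h] m]
  have "\<eta> N (f m) = \<eta> N (h m)" using eq by simp
  then show "f m = h m" using \<eta>' mod_homD(2)[OF f m] mod_homD(2)[OF h m] by metis
qed

text \<open>Dual to the argument with the unit: here surjectivity of \<open>\<epsilon> M\<close> is
  what counts.\<close>

lemma faithful_of_counit:
  assumes nat: "nat_iso B B D id_functor \<epsilon>" and M: "is_left_module B M" and N: "is_left_module B N"
    and f: "f \<in> mod_hom B M N" and h: "h \<in> mod_hom B M N" and eq: "ar D M N f = ar D M N h"
  shows "f = h"
proof (rule mod_hom_eqI[OF f h])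
  fix m assume m: "m \<in> space M"
  have "mod_iso B (ob D M) M (\<epsilon> M)" using nat M by (simp add: nat_iso_def id_functor_def)
  then obtain \<epsilon>' where \<epsilon>': "\<epsilon>' \<in> mod_hom B M (ob D M)" "\<And>n. n \<in> space M \<Longrightarrow> \<epsilon> M (\<epsilon>' n) = n"
    by (rule mod_isoE) blast
  have "compose (space (ob D M)) (\<epsilon> N) (ar D M N k) = compose (space (ob D M)) k (\<epsilon> M)"
    if "k \<in> mod_hom B M N" for k
    using nat M N that by (simp add: nat_iso_def id_functor_def)
  from compose_eqD[OF this[OF f] mod_homD(2)[OF \<epsilon>'(1) m]] compose_eqD[OF this[OF h] mod_homD(2)[OF \<epsilon>'(1) m]]
  show "f m = h m" using eq \<epsilon>'(2)[OF m] by simp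
qed

lemma linear_functorD:
  assumes "is_linear_functor A B F" "is_left_module A M"
  shows "is_left_module B (ob F M)" "ar F M M (mod_id M) = mod_id (ob F M)"
    "is_left_module A N \<Longrightarrow> f \<in> mod_hom A M N \<Longrightarrow> ar F M N f \<in> mod_hom B (ob F M) (ob F N)"
    "is_left_module A N \<Longrightarrow> f \<in> mod_hom A M N \<Longrightarrow>
      ar F M N (\<lambda>m\<in>space M. scale c (f m)) = (\<lambda>m\<in>space (ob F M). scale c (ar F M N f m))"
    "is_left_module A N \<Longrightarrow> is_left_module A P \<Longrightarrow> f \<in> mod_hom A M N \<Longrightarrow> g \<in> mod_hom A N P \<Longrightarrow>
      w \<in> space (ob F M) \<Longrightarrow> ar F N P g (ar F M N f w) = ar F M P (compose (space M) g f) w"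
proof -
  show "is_left_module B (ob F M)" "ar F M M (mod_id M) = mod_id (ob F M)"
    using assms by (auto simp: is_linear_functor_def)
  have *: "\<forall>M N. is_left_module A M \<longrightarrow> is_left_module A N \<longrightarrow>
      ar F M N \<in> mod_hom A M N \<rightarrow> mod_hom B (ob F M) (ob F N) \<and>
      (\<forall>c. \<forall>f\<in>mod_hom A M N. ar F M N (\<lambda>m\<in>space M. scale c (f m)) =
        (\<lambda>m\<in>space (ob F M). scale c (ar F M N f m)))"
    using assms(1) unfolding is_linear_functor_def by meson
  show "ar F M N f \<in> mod_hom B (ob F M) (ob F N)" "ar F M N (\<lambda>m\<in>space M. scale c (f m)) =
      (\<lambda>m\<in>space (ob F M). scale c (ar F M N f m))"
    if "is_left_module A N" "f \<in> mod_hom A M N"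
    using * assms(2) that by blast+
  show "ar F N P g (ar F M N f w) = ar F M P (compose (space M) g f) w"
    if "is_left_module A N" "is_left_module A P" "f \<in> mod_hom A M N" "g \<in> mod_hom A N P"
      "w \<in> space (ob F M)"
  proof -
    have "ar F M P (compose (space M) g f) = compose (space (ob F M)) (ar F N P g) (ar F M N f)"
      using assms that(1-4) unfolding is_linear_functor_def by meson
    then show ?thesis using that(5) by (simp add: compose_eq)
  qed
qed

lemma equivalence_faithful:
  assumes "is_equivalence A B F" and "is_left_module A M" and "is_left_module A N"
    and "f \<in> mod_hom A M N" and "h \<in> mod_hom A M N" and "ar F M N f = ar F M N h"
  shows "f = h"
  using assms faithful_of_unit[of A "comp_functor _ F"]
  unfolding is_equivalence_def by (fastforce simp: comp_functor_def)

text \<open>\<open>is_equivalence\<close> does not include triangle identities between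
  \<open>\<eta>\<close> and \<open>\<epsilon>\<close>. A preimage is built from the unit, and
  faithfulness of \<open>F\<close> after \<open>E\<close>, taken from the counit, shows that it is
  correct.\<close>

lemma equivalence_full:
  assumes F: "is_equivalence A B F" and M: "is_left_module A M" and N: "is_left_module A N"
    and f: "f \<in> mod_hom B (ob F M) (ob F N)"
  obtains h where "h \<in> mod_hom A M N" "ar F M N h = f"
proof -
  from F obtain E \<eta> \<epsilon> where lF: "is_linear_functor A B F" and lE: "is_linear_functor B A E"
    and \<eta>: "nat_iso A A id_functor (comp_functor E F) \<eta>"
    and \<epsilon>: "nat_iso B B (comp_functor F E) id_functor \<epsilon>"
    by (auto simp: is_equivalence_def)
  have iso: "mod_iso A X (ob E (ob F X)) (\<eta> X)" if "is_left_module A X" for X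
    using \<eta> that by (simp add: nat_iso_def id_functor_def comp_functor_def)
  obtain \<eta>M where \<eta>M: "\<eta> M \<in> mod_hom A M (ob E (ob F M))" "\<eta>M \<in> mod_hom A (ob E (ob F M)) M"
      "\<And>n. n \<in> space (ob E (ob F M)) \<Longrightarrow> \<eta> M (\<eta>M n) = n" using iso[OF M] by (rule mod_isoE) blast
  obtain \<eta>N where \<eta>N: "\<eta>N \<in> mod_hom A (ob E (ob F N)) N"
      "\<And>n. n \<in> space (ob E (ob F N)) \<Longrightarrow> \<eta> N (\<eta>N n) = n" using iso[OF N] by (rule mod_isoE) blast
  note FM = linear_functorD(1)[OF lF M] and FN = linear_functorD(1)[OF lF N]
  note Ef = linear_functorD(3)[OF lE FM FN f]
  \<comment> \<open>Chosen so that naturality of \<open>\<eta>\<close> makes \<open>E\<close> agree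
    on the image of \<open>h\<close> under \<open>F\<close> and on \<open>f\<close>.\<close>
  define h where "h = compose (space M) \<eta>N (compose (space M) (ar E (ob F M) (ob F N) f) (\<eta> M))"
  have h: "h \<in> mod_hom A M N"
    unfolding h_def by (intro mod_hom_compose[OF M _ \<eta>N(1)] mod_hom_compose[OF M \<eta>M(1) Ef])
  note Fh = linear_functorD(3)[OF lF M N h]
  have "ar E (ob F M) (ob F N) (ar F M N h) = ar E (ob F M) (ob F N) f"
  proof (rule mod_hom_eqI[OF linear_functorD(3)[OF lE FM FN Fh] Ef])
    fix z assume z: "z \<in> space (ob E (ob F M))"
    let ?m = "\<eta>M z"
    have m: "?m \<in> space M" using mod_homD(2)[OF \<eta>M(2) z] .
    have "compose (space M) (\<eta> N) h = compose (space M) (ar E (ob F M) (ob F N) (ar F M N h)) (\<eta> M)"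
      using \<eta> M N h by (simp add: nat_iso_def id_functor_def comp_functor_def)
    from compose_eqD[OF this m]
    have "ar E (ob F M) (ob F N) (ar F M N h) z = \<eta> N (h ?m)" using \<eta>M(3)[OF z] by simp
    also have "\<dots> = ar E (ob F M) (ob F N) f z"
      using m \<eta>M(3)[OF z] mod_homD(2)[OF Ef z] by (simp add: h_def compose_eq \<eta>N(2))
    finally show "ar E (ob F M) (ob F N) (ar F M N h) z = ar E (ob F M) (ob F N) f z" .
  qed
  then have "ar (comp_functor F E) (ob F M) (ob F N) (ar F M N h) = ar (comp_functor F E) (ob F M) (ob F N) f"
    by (simp add: comp_functor_def)
  from faithful_of_counit[OF \<epsilon> FM FN Fh f this] show ?thesis using that h by blast
qed

section \<open>Recovering the conjugating element\<close>

context finite_group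
begin

text \<open>
  Think of \<open>W\<close> as an \<open>L'\<close>-equivariant bundle on \<open>G\<close> with fibres \<open>P x W\<close>. The hypotheses \<open>scal\<close> and
  \<open>transl\<close> say that it is simple, hence supported on one coset \<open>L' g\<close>, and that its endomorphisms
  over right translations come from \<open>L\<close>.
\<close>

lemma conjugate_of_components:
  fixes W :: "('a, 'u, 'k::field) left_mod" and P :: "'a \<Rightarrow> ('u, 'k) vec \<Rightarrow> ('u, 'k) vec"
  assumes L: "subgroup L G" and L': "subgroup L' G" and aG: "a \<in> carrier G" "a' \<in> carrier G"
    and W: "is_left_module (kS L') W"
    and Plin: "\<And>x. x \<in> carrier G \<Longrightarrow> linear_on (space W) (P x)"
    and Pin: "\<And>x w. x \<in> carrier G \<Longrightarrow> w \<in> space W \<Longrightarrow> P x w \<in> space W"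
    and orth: "\<And>x y w. x \<in> carrier G \<Longrightarrow> y \<in> carrier G \<Longrightarrow> w \<in> space W \<Longrightarrow>
      P y (P x w) = (if x = y then P x w else 0)"
    and equiv: "\<And>l x w. l \<in> L' \<Longrightarrow> x \<in> carrier G \<Longrightarrow> w \<in> space W \<Longrightarrow>
      P (l \<otimes> x) (act W (grp l) w) = act W (grp l) (P x w)"
    and scal: "\<And>f. f \<in> mod_hom (kS L') W W \<Longrightarrow>
      (\<And>x w. x \<in> carrier G \<Longrightarrow> w \<in> space W \<Longrightarrow> P x (f w) = f (P x w)) \<Longrightarrow>
      \<exists>c. \<forall>w\<in>space W. f w = scale c w"
    and transl: "\<And>f h w. f \<in> mod_hom (kS L') W W \<Longrightarrow> h \<in> carrier G \<Longrightarrow>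
      (\<And>x w. x \<in> carrier G \<Longrightarrow> w \<in> space W \<Longrightarrow> P (x \<otimes> inv h) (f w) = f (P x w)) \<Longrightarrow>
      w \<in> space W \<Longrightarrow> f w \<noteq> 0 \<Longrightarrow> h \<in> L"
    and transl': "\<And>h. h \<in> L \<Longrightarrow> \<exists>f. \<forall>w\<in>space W. f w \<in> space W \<and> (w \<noteq> 0 \<longrightarrow> f w \<noteq> 0) \<and>
      (\<forall>x\<in>carrier G. P (x \<otimes> inv h) (f w) = f (P x w))"
    and braid: "\<And>x w. x \<in> carrier G \<Longrightarrow> w \<in> space W \<Longrightarrow> P (a' \<otimes> x \<otimes> inv a) w = P x w"
    and g: "g \<in> carrier G" and w0: "w0 \<in> space W" "P g w0 \<noteq> 0"
  shows "L' = (\<lambda>l. g \<otimes> l \<otimes> inv g) ` L \<and> a' = g \<otimes> a \<otimes> inv g"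
proof -
  note mW = subgroup_moduleD[OF L' W] and gW = subgroup_module_grp[OF L' W]
  have L'G: "l \<in> carrier G" if "l \<in> L'" for l using that subgroup.subset[OF L'] by blast
  have LG: "l \<in> carrier G" if "l \<in> L" for l using that subgroup.subset[OF L] by blast
  have L'f: "finite L'" using fin subgroup.subset[OF L'] finite_subset by blast
  interpret L': subgroup L' G by fact
  \<comment> \<open>A nonzero vector in the single fibre over \<open>g\<close>.\<close>
  define w where "w = P g w0"
  have w: "w \<in> space W" "w \<noteq> 0" using Pin[OF g w0(1)] w0(2) by (auto simp: w_def)
  have Pw: "P x w = (if x = g then w else 0)" if "x \<in> carrier G" for x
    using orth[OF g that w0(1)] by (auto simp: w_def)
  have act0: "act W (grp l) 0 = 0" if "l \<in> L'" for l
    by (rule linear_on_zero[OF mW(1) gW(1)[OF that]])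
  have P0: "P x 0 = 0" if "x \<in> carrier G" for x by (rule linear_on_zero[OF mW(1) Plin[OF that]])

  \<comment> \<open>On the coset of \<open>g\<close> this is right translation by
    \<open>inv g \<otimes> l \<otimes> g\<close>, performed from the left: the conjugate of
    \<open>l\<close> under \<open>m\<close> takes the fibre over \<open>m \<otimes> g\<close> to the
    one over \<open>m \<otimes> l \<otimes> g\<close>. Fibres over other cosets are killed, and the
    sum over all \<open>m\<close> makes the map linear over \<open>L'\<close>.\<close>
  define T where "T l = (\<lambda>w\<in>space W. \<Sum>m\<in>L'. act W (grp (m \<otimes> l \<otimes> inv m)) (P (m \<otimes> g) w))" for l
  have T_in: "act W (grp (m \<otimes> l \<otimes> inv m)) (P (m \<otimes> g) v) \<in> space W"
    if "l \<in> L'" "m \<in> L'" "v \<in> space W" for l m v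
    using that g by (intro gW(2) Pin) (auto simp: L'G)
  have T_hom: "T l \<in> mod_hom (kS L') W W" if l: "l \<in> L'" for l
  proof (rule subgroup_mod_homI[OF L' W W])
    show cl: "T l v \<in> space W" if "v \<in> space W" for v
      using that T_in[OF l] by (auto simp: T_def intro!: vec.subspace_sum mW(1))
    have "linear_on (space W) (\<lambda>w. \<Sum>m\<in>L'. act W (grp (m \<otimes> l \<otimes> inv m)) (P (m \<otimes> g) w))"
      by (intro linear_on_sum_fun linear_on_compose[OF Plin _ gW(1)])
        (use l g in \<open>auto simp: L'G Pin\<close>)
    then show "linear_on (space W) (T l)"
      by (subst linear_on_cong[OF mW(1)]) (auto simp: T_def)
    fix n v assume n: "n \<in> L'" and v: "v \<in> space W"
    have nv: "act W (grp n) v \<in> space W" by (rule gW(2)[OF n v])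
    have "T l (act W (grp n) v) = (\<Sum>m\<in>L'. act W (grp (m \<otimes> l \<otimes> inv m)) (P (m \<otimes> g) (act W (grp n) v)))"
      using nv by (simp add: T_def)
    \<comment> \<open>Replacing \<open>m\<close> by \<open>n \<otimes> m\<close> absorbs the action
      of \<open>n\<close>.\<close>
    also have "\<dots> = (\<Sum>m\<in>L'. act W (grp (n \<otimes> m \<otimes> l \<otimes> inv (n \<otimes> m))) (P (n \<otimes> m \<otimes> g) (act W (grp n) v)))"
      by (rule sum.reindex_bij_witness[of _ "\<lambda>m. n \<otimes> m" "\<lambda>m. inv n \<otimes> m"])
        (use n L'G in \<open>simp_all add: m_assoc[symmetric]\<close>)
    also have "\<dots> = (\<Sum>m\<in>L'. act W (grp n) (act W (grp (m \<otimes> l \<otimes> inv m)) (P (m \<otimes> g) v)))"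
    proof (rule sum.cong[OF refl])
      fix m assume m: "m \<in> L'"
      have mg: "m \<otimes> g \<in> carrier G" using m g L'G by simp
      have "P (n \<otimes> m \<otimes> g) (act W (grp n) v) = act W (grp n) (P (m \<otimes> g) v)"
        using equiv[OF n mg v] n m g L'G by (simp add: m_assoc)
      moreover have "n \<otimes> m \<otimes> l \<otimes> inv (n \<otimes> m) \<otimes> n = n \<otimes> (m \<otimes> l \<otimes> inv m)"
        using n m l L'G by (simp add: inv_mult_group m_assoc)
      ultimately show "act W (grp (n \<otimes> m \<otimes> l \<otimes> inv (n \<otimes> m))) (P (n \<otimes> m \<otimes> g) (act W (grp n) v)) =
          act W (grp n) (act W (grp (m \<otimes> l \<otimes> inv m)) (P (m \<otimes> g) v))"
        using n m l Pin[OF mg v] by (simp add: mW(5))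
    qed
    also have "\<dots> = act W (grp n) (T l v)"
      using v by (simp add: T_def linear_on_sum[OF mW(1) gW(1)[OF n]] T_in[OF l])
    finally show "T l (act W (grp n) v) = act W (grp n) (T l v)" .
  qed (simp add: T_def)
  \<comment> \<open>\<open>w\<close> lies over \<open>g\<close>, so only the term with
    \<open>m \<otimes> g = g\<close> survives.\<close>
  have T_w: "T l w = act W (grp l) w" if l: "l \<in> L'" for l
  proof -
    have "T l w = (\<Sum>m\<in>L'. if m = \<one> then act W (grp l) w else 0)"
      unfolding T_def using w(1) l g L'G
      by (auto simp: Pw act0 intro!: sum.cong)
    then show ?thesis using L'f by simp
  qed
  have T_P: "P (x \<otimes> inv g \<otimes> l \<otimes> g) (T l v) = T l (P x v)"
    if l: "l \<in> L'" and x: "x \<in> carrier G" and v: "v \<in> space W" for l x v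
  proof -
    let ?y = "x \<otimes> inv g \<otimes> l \<otimes> g"
    have y: "?y \<in> carrier G" using x g l L'G by simp
    have "P ?y (T l v) = (\<Sum>m\<in>L'. P ?y (act W (grp (m \<otimes> l \<otimes> inv m)) (P (m \<otimes> g) v)))"
      using v by (simp add: T_def linear_on_sum[OF mW(1) Plin[OF y]] T_in[OF l])
    also have "\<dots> = (\<Sum>m\<in>L'. act W (grp (m \<otimes> l \<otimes> inv m)) (P (m \<otimes> g) (P x v)))"
    proof (rule sum.cong[OF refl])
      fix m assume m: "m \<in> L'"
      define k where "k = m \<otimes> l \<otimes> inv m"
      have k: "k \<in> L'" using m l by (simp add: k_def)
      have mg: "m \<otimes> g \<in> carrier G" using m g L'G by simp
      have ky: "inv k \<otimes> ?y \<in> carrier G" using k y L'G by simp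
      have "k \<otimes> (inv k \<otimes> ?y) = ?y" using k y L'G by (simp add: m_assoc[symmetric])
      then have "P ?y (act W (grp k) (P (m \<otimes> g) v)) = act W (grp k) (P (inv k \<otimes> ?y) (P (m \<otimes> g) v))"
        using equiv[OF k ky Pin[OF mg v]] by simp
      \<comment> \<open>By orthogonality both sides vanish unless \<open>x = m \<otimes> g\<close>,
        so it suffices that the two index conditions are equivalent.\<close>
      also have "P (inv k \<otimes> ?y) (P (m \<otimes> g) v) = P (m \<otimes> g) (P x v)"
      proof -
        have "inv k \<otimes> ?y = m \<otimes> g \<longleftrightarrow> ?y = k \<otimes> (m \<otimes> g)"
          unfolding eq_commute[of "inv k \<otimes> ?y"] by (rule inv_solve_left) (use k mg y L'G in auto)
        also have "k \<otimes> (m \<otimes> g) = m \<otimes> l \<otimes> g"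
          using m l g L'G by (simp add: k_def m_assoc) (simp add: m_assoc[symmetric])
        also have "?y = m \<otimes> l \<otimes> g \<longleftrightarrow> x \<otimes> inv g = m"
          using right_cancel[of "l \<otimes> g" "x \<otimes> inv g" m] x g l m L'G by (simp add: m_assoc)
        also have "\<dots> \<longleftrightarrow> x = m \<otimes> g"
          using x g m L'G by (auto simp: m_assoc)
        finally show ?thesis
          using orth[OF mg ky v] orth[OF x mg v] by auto
      qed
      finally show "P ?y (act W (grp (m \<otimes> l \<otimes> inv m)) (P (m \<otimes> g) v)) =
          act W (grp (m \<otimes> l \<otimes> inv m)) (P (m \<otimes> g) (P x v))" by (simp add: k_def)
    qed
    also have "\<dots> = T l (P x v)" using Pin[OF x v] by (simp add: T_def)
    finally show ?thesis .
  qed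

  \<comment> \<open>\<open>T \<one>\<close> is the projection to the fibres over the coset of
    \<open>g\<close>. It commutes with every \<open>P x\<close>, hence is a scalar by
    \<open>scal\<close>, and the scalar is 1 because \<open>w\<close> is fixed. So \<open>W\<close>
    has no fibres elsewhere.\<close>
  have "\<exists>c. \<forall>v\<in>space W. T \<one> v = scale c v"
  proof (rule scal[OF T_hom])
    show "P x (T \<one> v) = T \<one> (P x v)" if "x \<in> carrier G" "v \<in> space W" for x v
      using T_P[OF L'.one_closed that] that(1) g by (simp add: m_assoc)
  qed simp
  then obtain c where c: "\<And>v. v \<in> space W \<Longrightarrow> T \<one> v = scale c v" by blast
  have "scale c w = scale 1 w" using c[OF w(1)] T_w[OF L'.one_closed] mW(4)[OF w(1)] by simp
  then have "c = 1" using w(2) vec.scale_right_imp_eq by blast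
  then have T1: "T \<one> v = v" if "v \<in> space W" for v using c[OF that] by simp
  have sub1: "g \<otimes> h \<otimes> inv g \<in> L'" if h: "h \<in> L" for h
  proof -
    \<comment> \<open>\<open>transl'\<close> is applied to the inverse, so that \<open>f\<close>
      moves the fibre over \<open>x\<close> to the one over \<open>x \<otimes> h\<close>. Then
      \<open>f w\<close> lies over \<open>g \<otimes> h\<close>, which must belong to the supporting
      coset.\<close>
    have ih: "inv h \<in> L" using h by (simp add: subgroup.m_inv_closed[OF L])
    obtain f where f: "\<And>v. v \<in> space W \<Longrightarrow> f v \<in> space W" "f w \<noteq> 0"
      "\<And>x v. v \<in> space W \<Longrightarrow> x \<in> carrier G \<Longrightarrow> P (x \<otimes> inv (inv h)) (f v) = f (P x v)"
      using transl'[OF ih] w by blast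
    have gh: "g \<otimes> h \<in> carrier G" using g h LG by simp
    have fw: "P (g \<otimes> h) (f w) = f w" using f(3)[OF w(1) g] h LG Pw[OF g] by simp
    have "\<exists>m\<in>L'. m \<otimes> g = g \<otimes> h"
    proof (rule ccontr)
      assume no: "\<not> ?thesis"
      have "f w = P (g \<otimes> h) (T \<one> (f w))" using fw T1[OF f(1)[OF w(1)]] by simp
      also have "\<dots> = T \<one> (P (g \<otimes> h) (f w))"
        using T_P[OF L'.one_closed gh f(1)[OF w(1)]] gh g by (simp add: m_assoc)
      also have "\<dots> = (\<Sum>m\<in>L'. act W (grp (m \<otimes> \<one> \<otimes> inv m)) (P (m \<otimes> g) (P (g \<otimes> h) (f w))))"
        using Pin[OF gh f(1)[OF w(1)]] by (simp add: T_def)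
      also have "\<dots> = 0"
      proof (rule sum.neutral, rule ballI)
        fix m assume m: "m \<in> L'"
        have mg: "m \<otimes> g \<in> carrier G" using m g L'G by simp
        have "P (m \<otimes> g) (P (g \<otimes> h) (f w)) = 0"
          using orth[OF gh mg f(1)[OF w(1)]] no m by auto
        then show "act W (grp (m \<otimes> \<one> \<otimes> inv m)) (P (m \<otimes> g) (P (g \<otimes> h) (f w))) = 0"
          using act0[of "m \<otimes> \<one> \<otimes> inv m"] m by simp
      qed
      finally show False using f(2) by simp
    qed
    then obtain m where m: "m \<in> L'" "m \<otimes> g = g \<otimes> h" by blast
    have "g \<otimes> h \<otimes> inv g = m" using m(2)[symmetric] m(1) g L'G by (simp add: m_assoc)
    then show ?thesis using m(1) by simp
  qed
  have sub2: "\<exists>h\<in>L. l = g \<otimes> h \<otimes> inv g" if l: "l \<in> L'" for l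
  proof -
    \<comment> \<open>The outer inverse matches the convention of \<open>transl\<close>:
      \<open>T l\<close> shifts by \<open>inv g \<otimes> l \<otimes> g\<close>, which has to be
      written as \<open>inv h\<close>.\<close>
    define h where "h = inv (inv g \<otimes> l \<otimes> g)"
    have hG: "h \<in> carrier G" using l g L'G by (simp add: h_def)
    have "act W (grp (inv l)) (act W (grp l) w) = w"
      using l L'G w(1) by (simp add: mW(4,5))
    then have "T l w \<noteq> 0" using T_w[OF l] act0[of "inv l"] l w(2) by auto
    moreover have "P (x \<otimes> inv h) (T l v) = T l (P x v)" if "x \<in> carrier G" "v \<in> space W" for x v
      using T_P[OF l that] that(1) l g L'G by (simp add: h_def m_assoc)
    ultimately have "h \<in> L" using transl[OF T_hom[OF l] hG _ w(1)] by blast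
    then have "inv h \<in> L" by (rule subgroup.m_inv_closed[OF L])
    moreover have "l = g \<otimes> inv h \<otimes> inv g"
      using l g L'G by (simp add: h_def m_assoc) (simp add: m_assoc[symmetric])
    ultimately show ?thesis by blast
  qed
  have ag: "a' \<otimes> g \<otimes> inv a \<in> carrier G" using aG g by simp
  \<comment> \<open>By \<open>braid\<close> the component of \<open>w\<close> at this element is the
    one at \<open>g\<close>, hence nonzero, and \<open>g\<close> is the only point over which
    \<open>w\<close> lives.\<close>
  have "a' \<otimes> g \<otimes> inv a = g"
    using braid[OF g w(1)] Pw[OF g] Pw[OF ag] w(2) by (metis (full_types))
  then have "a' \<otimes> g \<otimes> inv a \<otimes> a \<otimes> inv g = g \<otimes> a \<otimes> inv g" by simp
  then have "a' = g \<otimes> a \<otimes> inv g" using aG g by (simp add: m_assoc)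
  then show ?thesis using sub1 sub2 by auto
qed

end

section \<open>Braided equivalences come from conjugation\<close>

context finite_group
begin

lemma tensor_assoc_mod_hom:
  fixes X Y M :: "('a, 'u, 'k::field) left_mod"
  assumes L: "subgroup L G" and X: "is_left_module kG X"
    and Y: "is_left_module kG Y" and M: "is_left_module (kS L) M"
  shows "tensor_assoc (space X) (space Y) (space M) \<in> mod_hom (kS L)
    (act_mod kG (kS L) (tensor_mod kG X Y) M)
    (act_mod kG (kS L) X (act_mod kG (kS L) Y M))"
    (is "_ \<in> mod_hom _ ?P ?Q")
proof -
  note XY = is_left_module_tensor_mod[OF X Y] and YM = is_left_module_act_mod[OF L Y M]
  note P = is_left_module_act_mod[OF L XY M] and Q = is_left_module_act_mod[OF L X YM]
  note sub = modX(1)[OF L X M] modX(1)[OF L Y M] modM(1)[OF L X M]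
  note as = linear_on_tensor_assoc[OF sub] tensor_assoc_in[OF sub] tensor_assoc_tens[OF sub]
  have sp: "space ?P = (space X \<boxtimes> space Y) \<boxtimes> space M" "space ?Q = space X \<boxtimes> space Y \<boxtimes> space M"
    by (simp_all add: act_mod_space tensor_mod_space)
  show ?thesis
  proof (rule subgroup_mod_homI[OF L P Q], unfold sp)
    fix x t assume x: "x \<in> L" and t: "t \<in> (space X \<boxtimes> space Y) \<boxtimes> space M"
    have xG: "x \<in> carrier G" using x subgroup.subset[OF L] by blast
    note aP = subgroup_module_grp[OF L P x, unfolded sp] and aQ = subgroup_module_grp[OF L Q x, unfolded sp]
    have tg: "act (tensor_mod kG X Y) (grp x) (y \<odot> z) = act X (grp x) y \<odot> act Y (grp x) z"
      if "y \<in> space X" "z \<in> space Y" for y z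
      unfolding tensor_mod_eq
      using act_mod_grp_tens[OF subgroup_self X Y[folded is_left_module_group_iff] xG] that by simp
    show "tensor_assoc (space X) (space Y) (space M) (act ?P (grp x) t) =
        act ?Q (grp x) (tensor_assoc (space X) (space Y) (space M) t)"
      by (rule tensor_eqI3[OF linear_on_compose[OF aP(1,3) as(1)] linear_on_compose[OF as(1) _ aQ(1)] _ t])
        (use as(2) in \<open>auto simp: act_mod_grp_tens[OF L XY M x] act_mod_grp_tens[OF L X YM x]
          act_mod_grp_tens[OF L Y M x] tensor_mod_space act_mod_space tens_in_tensor_space tg as(3)
          modX_grp(2)[OF L X M xG] modX_grp(2)[OF L Y M xG] modM_grp(2)[OF L X M x]\<close>)
  qed (use as tensor_assoc_extensional[OF sub] in auto)
qed

lemma unitor_mod_hom: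
  fixes M :: "('a, 'u, 'k::field) left_mod"
  assumes L: "subgroup L G" and M: "is_left_module (kS L) M"
  shows "unitor kG M \<in> mod_hom (kS L)
    (act_mod kG (kS L) (unit_mod kG) M) M"
    (is "_ \<in> mod_hom _ ?P _")
proof -
  note U = is_left_module_unit_mod
  note P = is_left_module_act_mod[OF L U M] and sub = subgroup_moduleD(1)[OF L M]
  note u = unitor_props[OF sub, where H = "kG"]
  have sp: "space ?P = coord_space {Triv} \<boxtimes> space M" by (simp add: act_mod_space unit_mod_space)
  show ?thesis
  proof (rule subgroup_mod_homI[OF L P M], unfold sp)
    show cl: "unitor kG M t \<in> space M" if "t \<in> coord_space {Triv} \<boxtimes> space M" for t
      by (rule tensor_image[OF u(2) sub _ that]) (simp add: u(3) vec.subspace_scale[OF sub])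
    fix x t assume x: "x \<in> L" and t: "t \<in> coord_space {Triv} \<boxtimes> space M"
    have xG: "x \<in> carrier G" using x subgroup.subset[OF L] by blast
    note aP = subgroup_module_grp[OF L P x, unfolded sp] and aM = subgroup_module_grp[OF L M x]
    have a: "act (unit_mod kG) (grp x) y = y" for y :: "('u, 'k) vec"
      using xG by (simp add: unit_mod_def counit_grp)
    show "unitor kG M (act ?P (grp x) t) = act M (grp x) (unitor kG M t)"
      by (rule tensor_eqI[OF linear_on_compose[OF aP(1,3) u(2)] linear_on_compose[OF u(2) _ aM(1)] _ t])
        (use cl in \<open>auto simp: act_mod_grp_tens[OF L U M x] unit_mod_space a u(3) aM(2) linear_onD(2)[OF aM(1)]\<close>)
  qed (use u in auto)
qed

text \<open>Only morphisms can be fed to a functor; here linearity over \<open>L\<close> comes from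
  \<open>a\<close> centralizing \<open>L\<close>.\<close>

lemma module_braiding_mod_hom:
  fixes X M :: "('a, 'u, 'k::field) left_mod"
  assumes L: "subgroup L G" and X: "is_left_module kG X"
    and M: "is_left_module (kS L) M" and a: "a \<in> centralizer G L"
  shows "module_braiding kG (kS L) (grp a \<odot> grp \<one>) X M \<in>
      mod_hom (kS L) (act_mod kG (kS L) X M)
        (act_mod kG (kS L) X M)"
    and "y \<in> space X \<Longrightarrow> m \<in> space M \<Longrightarrow>
      module_braiding kG (kS L) (grp a \<odot> grp \<one>) X M (y \<odot> m) = act X (grp a) y \<odot> m"
    and "linear_on (space X \<boxtimes> space M)
      (module_braiding kG (kS L) (grp a \<odot> grp \<one>) X M)"
proof -
  let ?e = "module_braiding kG (kS L) (grp a \<odot> grp \<one>) X M"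
  have aG: "a \<in> carrier G" and comm: "\<And>l. l \<in> L \<Longrightarrow> a \<otimes> l = l \<otimes> a"
    using a by (auto simp: centralizer_def)
  have K: "grp a \<odot> grp \<one> \<in> group_span (carrier G) \<boxtimes> group_span L"
    using aG subgroup.one_closed[OF L] by (auto intro!: tens_in_tensor_space grp_in_group_span)
  note P = is_left_module_act_mod[OF L X M]
  note lin = linear_on_tensor_act_right[OF L X M K] and in' = tensor_act_in[OF L X M K]
  show lin': "linear_on (space X \<boxtimes> space M) ?e"
    unfolding module_braiding_def
    by (subst linear_on_cong[OF subspace_tensor_space]) (auto intro: lin)
  have cl: "?e t \<in> space X \<boxtimes> space M" if "t \<in> space X \<boxtimes> space M" for t
    using that by (simp add: module_braiding_def in')
  show tens: "?e (y \<odot> m) = act X (grp a) y \<odot> m" if "y \<in> space X" "m \<in> space M" for y m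
    using that tensor_act_tens[OF L X M, of "grp a" "grp \<one>" y m] modM(4)[OF L X M] aG
      subgroup.one_closed[OF L]
    by (simp add: module_braiding_def tens_in_tensor_space grp_in_group_span)
  show "?e \<in> mod_hom (kS L) (act_mod kG (kS L) X M)
        (act_mod kG (kS L) X M)"
  proof (rule subgroup_mod_homI[OF L P P], unfold act_mod_space)
    fix x t assume x: "x \<in> L" and t: "t \<in> space X \<boxtimes> space M"
    have xG: "x \<in> carrier G" using x subgroup.subset[OF L] by blast
    note aP = subgroup_module_grp[OF L P x, unfolded act_mod_space]
    show "?e (act (act_mod kG (kS L) X M) (grp x) t) =
        act (act_mod kG (kS L) X M) (grp x) (?e t)"
      by (rule tensor_eqI[OF linear_on_compose[OF aP(1,3) lin'] linear_on_compose[OF lin' _ aP(1)] _ t])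
        (use cl x xG aG in \<open>auto simp: act_mod_grp_tens[OF L X M x] tens modX_grp(2)[OF L X M]
          modM_grp(2)[OF L X M] modX(5)[OF L X M] comm\<close>)
  qed (use cl lin' in \<open>auto simp: module_braiding_def\<close>)
qed

end

text \<open>
  \<open>\<iota>\<close> embeds \<open>G\<close> into the coordinates of the universe, and \<open>reg K\<close> is the regular module of \<open>K\<close>
  realised there, with basis \<open>e x\<close>.
\<close>

locale embedded_group = finite_group +
  fixes \<iota> :: "'a \<Rightarrow> 'u idx" and ty :: "'k::field itself"
  assumes inj: "inj_on \<iota> (carrier G)"
begin

definition e :: "'a \<Rightarrow> ('u, 'k) vec" where
  "e x = single (\<iota> x)"

definition reg :: "'a set \<Rightarrow> ('a, 'u, 'k) left_mod" where
  "reg K = \<lparr>space = coord_space (\<iota> ` K), act = (\<lambda>b v. \<Sum>g\<in>carrier G. \<Sum>x\<in>carrier G.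
     scale (b (Base g) * v (\<iota> x)) (e (g \<otimes> x)))\<rparr>"

text \<open>Linear extension from the basis \<open>e\<close>; the inverse of \<open>\<iota>\<close>
  turns a coordinate back into a group element.\<close>

definition gext :: "'a set \<Rightarrow> ('a \<Rightarrow> ('c \<Rightarrow> 'k)) \<Rightarrow> ('u, 'k) vec \<Rightarrow> ('c \<Rightarrow> 'k)" where
  "gext K f = lin_ext (\<iota> ` K) (\<lambda>p. f (the_inv_into (carrier G) \<iota> p))"

lemma iota_eq_iff: "x \<in> carrier G \<Longrightarrow> y \<in> carrier G \<Longrightarrow> \<iota> x = \<iota> y \<longleftrightarrow> x = y"
  using inj by (auto simp: inj_on_def)

lemma space_reg: "space (reg K) = coord_space (\<iota> ` K)"
  by (simp add: reg_def)

lemma e_in_reg: "x \<in> K \<Longrightarrow> e x \<in> space (reg K)"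
  by (simp add: e_def space_reg single_in_coord_space)

lemma e_apply: "x \<in> carrier G \<Longrightarrow> y \<in> carrier G \<Longrightarrow> e x (\<iota> y) = (if x = y then 1 else 0)"
  by (auto simp: e_def single_def iota_eq_iff)

lemma sum_e_apply: "x \<in> carrier G \<Longrightarrow> (\<Sum>y\<in>carrier G. scale (e x (\<iota> y)) (f y)) = f x"
proof -
  assume x: "x \<in> carrier G"
  have "(\<Sum>y\<in>carrier G. scale (e x (\<iota> y)) (f y)) = (\<Sum>y\<in>carrier G. if y = x then f x else 0)"
    by (rule sum.cong) (use x in \<open>auto simp: e_apply\<close>)
  then show ?thesis using fin x by simp
qed

lemma act_reg:
  assumes "g \<in> carrier G" "x \<in> carrier G"
  shows "act (reg K) (grp g) (e x) = e (g \<otimes> x)"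
proof -
  have "act (reg K) (grp g) (e x) = (\<Sum>g'\<in>carrier G. scale (grp g (Base g'))
      (\<Sum>y\<in>carrier G. scale (e x (\<iota> y)) (e (g' \<otimes> y))))"
    by (simp add: reg_def vec.scale_sum_right)
  also have "\<dots> = e (g \<otimes> x)" using assms by (simp add: sum_e_apply sum_grp_apply)
  finally show ?thesis .
qed

lemma reg_eqI:
  assumes "linear_on (space (reg K)) f" "linear_on (space (reg K)) h"
    and "\<And>x. x \<in> K \<Longrightarrow> f (e x) = h (e x)" and "v \<in> space (reg K)"
  shows "f v = h v"
  by (rule coord_space_eqI[OF assms(1,2)[unfolded space_reg] _ assms(4)[unfolded space_reg]])
    (use assms(3) in \<open>auto simp: e_def\<close>)

lemma bilinear_on_act_reg: "bilinear_on S T (act (reg K))"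
proof (rule bilinear_onI)
  have l: "linear_on S (\<lambda>x. scale (x p * c) y)" "linear_on T (\<lambda>x. scale (c * x q) y)"
    for S :: "('a, 'k) vec set" and T :: "('u, 'k) vec set" and p q c and y :: "('u, 'k) vec"
    by (simp_all add: linear_on_def scale_def fun_eq_iff algebra_simps)
  show "linear_on T (act (reg K) b)" for b
    unfolding reg_def left_mod.select_convs by (intro linear_on_sum_fun l)
  show "linear_on S (\<lambda>b. act (reg K) b v)" for v
    unfolding reg_def left_mod.select_convs by (intro linear_on_sum_fun l)
qed

lemma is_left_module_reg:
  assumes K: "subgroup K G"
  shows "is_left_module (kS K) (reg K)"
proof (rule subgroup_moduleI[OF K _ bilinear_on_act_reg])
  note l = bilinear_onD(1)[OF bilinear_on_act_reg UNIV_I]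
  interpret K: subgroup K G by fact
  have KG: "x \<in> carrier G" if "x \<in> K" for x using that by simp
  show "vec.subspace (space (reg K))" by (simp add: space_reg subspace_coord_space)
  then show "act (reg K) (grp x) v \<in> space (reg K)" if "x \<in> K" "v \<in> space (reg K)" for x v
    by (rule coord_space_image[OF l _ _ that(2)[unfolded space_reg]])
      (use that in \<open>auto simp: act_reg e_def[symmetric] e_in_reg\<close>)
  show "act (reg K) (grp \<one>) v = v" if "v \<in> space (reg K)" for v
    by (rule reg_eqI[OF l linear_on_id _ that]) (simp add: act_reg)
  show "act (reg K) (grp (x \<otimes> y)) v = act (reg K) (grp x) (act (reg K) (grp y) v)"
    if "x \<in> K" "y \<in> K" "v \<in> space (reg K)" for x y v
    by (rule reg_eqI[OF l linear_on_compose[OF l _ l[of UNIV]] _ that(3)])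
      (use that in \<open>auto simp: act_reg m_assoc\<close>)
qed

lemma is_left_module_reg_group: "is_left_module kG (reg (carrier G))"
  using is_left_module_reg[OF subgroup_self] by (simp add: is_left_module_group_iff)

lemma linear_on_gext: "linear_on (space (reg K)) (gext K f)"
  by (simp add: gext_def space_reg linear_on_lin_ext)

lemma gext_e: "K \<subseteq> carrier G \<Longrightarrow> x \<in> K \<Longrightarrow> gext K f (e x) = f x"
  using finite_subset[OF _ fin, of K] the_inv_into_f_f[OF inj, of x]
  by (auto simp: gext_def e_def lin_ext_single)

text \<open>Source of the structure maps below: the comultiplication and counit of the regular
  module of \<open>G\<close>, the coaction and the right translations are given on the basis, where
  linearity becomes an identity between group elements.\<close>

lemma gext_hom:
  assumes K: "subgroup K G" and N: "is_left_module (kS K) N"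
    and cl: "\<And>x. x \<in> K \<Longrightarrow> f x \<in> space N"
    and eq: "\<And>x y. x \<in> K \<Longrightarrow> y \<in> K \<Longrightarrow> act N (grp x) (f y) = f (x \<otimes> y)"
  shows "gext K f \<in> mod_hom (kS K) (reg K) N"
proof (rule subgroup_mod_homI[OF K is_left_module_reg[OF K] N _ _ linear_on_gext])
  interpret K: subgroup K G by fact
  have K_sub: "K \<subseteq> carrier G" by (rule K.subset)
  show "gext K f \<in> extensional (space (reg K))"
    by (simp add: gext_def space_reg lin_ext_extensional)
  show in_N: "gext K f v \<in> space N" if "v \<in> space (reg K)" for v
    unfolding gext_def
    by (rule lin_ext_in[OF subgroup_moduleD(1)[OF K N]])
      (use that cl K_sub the_inv_into_f_f[OF inj] in \<open>auto simp: space_reg\<close>)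
  fix x v assume x: "x \<in> K" and v: "v \<in> space (reg K)"
  note r = subgroup_module_grp[OF K is_left_module_reg[OF K] x] and n = subgroup_module_grp[OF K N x]
  show "gext K f (act (reg K) (grp x) v) = act N (grp x) (gext K f v)"
    by (rule reg_eqI[OF linear_on_compose[OF r(1,3) linear_on_gext] linear_on_compose[OF linear_on_gext _ n(1)] _ v])
      (use x in_N in \<open>auto simp: act_reg gext_e[OF K_sub] eq\<close>)
qed

lemma tensor_reg_expand:
  assumes t: "t \<in> space (reg (carrier G)) \<boxtimes> U"
  shows "t = (\<Sum>x\<in>carrier G. e x \<odot> slice (\<iota> x) t)"
  using tensor_coord_expand[of "\<iota> ` carrier G" t U] t fin inj
  by (simp add: space_reg e_def sum.reindex)

lemma tensor_map_reg:
  fixes k :: "('u, 'k) vec \<Rightarrow> ('u, 'k) vec"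
  assumes U: "vec.subspace U" and f: "linear_on (space (reg (carrier G))) f" and k: "linear_on U k"
    and t: "t \<in> space (reg (carrier G)) \<boxtimes> U"
  shows "tensor_map (space (reg (carrier G))) U f k t = (\<Sum>x\<in>carrier G. f (e x) \<odot> k (slice (\<iota> x) t))"
proof -
  have sub: "vec.subspace (space (reg (carrier G)))" by (simp add: space_reg subspace_coord_space)
  have m: "e x \<odot> slice (\<iota> x) t \<in> space (reg (carrier G)) \<boxtimes> U" if "x \<in> carrier G" for x
    using that by (intro tens_in_tensor_space e_in_reg slice_in[OF U t])
  have "tensor_map (space (reg (carrier G))) U f k t =
      tensor_map (space (reg (carrier G))) U f k (\<Sum>x\<in>carrier G. e x \<odot> slice (\<iota> x) t)"
    using tensor_reg_expand[OF t] by simp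
  also have "\<dots> = (\<Sum>x\<in>carrier G. tensor_map (space (reg (carrier G))) U f k (e x \<odot> slice (\<iota> x) t))"
    by (rule linear_on_sum[OF subspace_tensor_space linear_on_tensor_map[OF sub U f k] m])
  also have "\<dots> = (\<Sum>x\<in>carrier G. f (e x) \<odot> k (slice (\<iota> x) t))"
    by (rule sum.cong[OF refl])
      (simp add: tensor_map_tens[OF sub U f k] e_in_reg slice_in[OF U t])
  finally show ?thesis .
qed

text \<open>Reads off one coefficient after a relabelling of the basis; \<open>z\<close> is the only
  index that \<open>f\<close> sends to \<open>y\<close>.\<close>

lemma slice_sum:
  assumes y: "y \<in> carrier G" and z: "z \<in> carrier G"
    and f: "\<And>x. x \<in> carrier G \<Longrightarrow> f x \<in> carrier G" "\<And>x. x \<in> carrier G \<Longrightarrow> f x = y \<longleftrightarrow> x = z"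
  shows "slice (\<iota> y) (\<Sum>x\<in>carrier G. e (f x) \<odot> v x) = v z"
proof -
  have "slice (\<iota> y) (\<Sum>x\<in>carrier G. e (f x) \<odot> v x) = (\<Sum>x\<in>carrier G. slice (\<iota> y) (e (f x) \<odot> v x))"
    by (rule linear_on_sum[OF vec.subspace_UNIV linear_on_slice]) simp
  also have "\<dots> = (\<Sum>x\<in>carrier G. if x = z then v z else 0)"
    by (rule sum.cong[OF refl]) (auto simp: slice_tens e_apply f y)
  finally show ?thesis using fin z by simp
qed

end

section \<open>The grading transported along a braided equivalence\<close>

locale braided_equivalence = embedded_group G \<iota> ty for G (structure) and \<iota> :: "'a \<Rightarrow> 'u idx" and ty :: "'k::field itself" +
  fixes L L' :: "'a set" and a a' :: 'a and F :: "('a, 'a, 'u, 'k) mod_functor"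
    and s :: "('a, 'u, 'k) left_mod \<Rightarrow> ('a, 'u, 'k) left_mod \<Rightarrow> ('u, 'k) vec \<Rightarrow> ('u, 'k) vec"
  assumes L: "subgroup L G" and L': "subgroup L' G"
    and a: "a \<in> centralizer G L" and a': "a' \<in> centralizer G L'"
    and F_functor: "is_module_functor kG (kS L) (kS L') F s"
    and F_equivalence: "is_equivalence (kS L) (kS L') F"
    and F_braided: "\<And>X M. is_left_module kG X \<Longrightarrow> is_left_module (kS L) M \<Longrightarrow>
      compose (space (ob F (act_mod kG (kS L) X M)))
        (module_braiding kG (kS L') (grp a' \<odot> grp \<one>) X (ob F M)) (s X M) =
      compose (space (ob F (act_mod kG (kS L) X M))) (s X M)
        (ar F (act_mod kG (kS L) X M)
          (act_mod kG (kS L) X M)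
          (module_braiding kG (kS L) (grp a \<odot> grp \<one>) X M))"
begin

abbreviation "H \<equiv> kG :: ('a, 'k) hopf"
abbreviation "B \<equiv> kS L :: ('a, 'k) comodule_alg"
abbreviation "B' \<equiv> kS L' :: ('a, 'k) comodule_alg"
abbreviation "A \<equiv> reg (carrier G)"
abbreviation "V \<equiv> reg L"
abbreviation "AV \<equiv> act_mod H B A V"
abbreviation "W \<equiv> ob F V"
abbreviation "AW \<equiv> act_mod H B' A W"

lemma LG: "x \<in> L \<Longrightarrow> x \<in> carrier G" and L'G: "x \<in> L' \<Longrightarrow> x \<in> carrier G"
  using subgroup.subset[OF L] subgroup.subset[OF L'] by auto

lemma lin_functor: "is_linear_functor B B' F"
  using F_functor by (simp add: is_module_functor_def)

lemmas F_hom = linear_functorD(3)[OF lin_functor]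

lemma A: "is_left_module H A" and V: "is_left_module B V"
  by (rule is_left_module_reg_group is_left_module_reg[OF L])+

lemma AV: "is_left_module B AV" by (rule is_left_module_act_mod[OF L A V])

lemma W: "is_left_module B' W" by (rule linear_functorD(1)[OF lin_functor V])

lemma AW: "is_left_module B' AW" by (rule is_left_module_act_mod[OF L' A W])

lemma sub_A: "vec.subspace (space A)" and sub_V: "vec.subspace (space V)" and sub_W: "vec.subspace (space W)"
  using subgroup_moduleD(1)[OF L' W] by (simp_all add: space_reg subspace_coord_space)

lemma s_iso:
  "is_left_module H X \<Longrightarrow> is_left_module B M \<Longrightarrow> mod_iso B' (ob F (act_mod H B X M)) (act_mod H B' X (ob F M)) (s X M)"
  using F_functor by (simp add: is_module_functor_def)

lemma s_hom:
  "is_left_module H X \<Longrightarrow> is_left_module B M \<Longrightarrow> s X M \<in> mod_hom B' (ob F (act_mod H B X M)) (act_mod H B' X (ob F M))"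
  using s_iso by (simp add: mod_iso_def)

lemma s_natural:
  assumes "is_left_module H X" "is_left_module H X'" "is_left_module B M" "is_left_module B M'"
    and "f \<in> mod_hom H X X'" "g \<in> mod_hom B M M'" and "t \<in> space (ob F (act_mod H B X M))"
  shows "s X' M' (ar F (act_mod H B X M) (act_mod H B X' M') (tensor_map (space X) (space M) f g) t) =
    tensor_map (space X) (space (ob F M)) f (ar F M M' g) (s X M t)"
proof -
  have "compose (space (ob F (act_mod H B X M))) (s X' M')
       (ar F (act_mod H B X M) (act_mod H B X' M') (tensor_map (space X) (space M) f g)) =
     compose (space (ob F (act_mod H B X M)))
       (tensor_map (space X) (space (ob F M)) f (ar F M M' g)) (s X M)"
    using F_functor assms(1-6) unfolding is_module_functor_def by meson
  from compose_eqD[OF this assms(7)] show ?thesis .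
qed

lemma s_pentagon:
  assumes "is_left_module H X" "is_left_module H Y" "is_left_module B M"
    and "t \<in> space (ob F (act_mod H B (tensor_mod H X Y) M))"
  shows "tensor_assoc (space X) (space Y) (space (ob F M)) (s (tensor_mod H X Y) M t) =
    tensor_map (space X) (space (ob F (act_mod H B Y M))) (\<lambda>x. x) (s Y M)
      (s X (act_mod H B Y M) (ar F (act_mod H B (tensor_mod H X Y) M) (act_mod H B X (act_mod H B Y M))
        (tensor_assoc (space X) (space Y) (space M)) t))"
proof -
  let ?S = "space (ob F (act_mod H B (tensor_mod H X Y) M))"
  have "compose ?S (tensor_assoc (space X) (space Y) (space (ob F M))) (s (tensor_mod H X Y) M) =
    compose ?S (tensor_map (space X) (space (ob F (act_mod H B Y M))) (\<lambda>x. x) (s Y M))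
      (compose ?S (s X (act_mod H B Y M)) (ar F (act_mod H B (tensor_mod H X Y) M)
        (act_mod H B X (act_mod H B Y M)) (tensor_assoc (space X) (space Y) (space M))))"
    using F_functor assms(1-3) unfolding is_module_functor_def by meson
  from compose_eqD[OF this assms(4)] show ?thesis using assms(4) by (simp add: compose_eq)
qed

lemma s_triangle:
  assumes "is_left_module B M" and "t \<in> space (ob F (act_mod H B (unit_mod H) M))"
  shows "unitor H (ob F M) (s (unit_mod H) M t) = ar F (act_mod H B (unit_mod H) M) M (unitor H M) t"
proof -
  have "compose (space (ob F (act_mod H B (unit_mod H) M))) (unitor H (ob F M)) (s (unit_mod H) M) =
    ar F (act_mod H B (unit_mod H) M) M (unitor H M)"
    using F_functor assms(1) unfolding is_module_functor_def by meson
  from fun_cong[OF this, of t] show ?thesis using assms(2) by (simp add: compose_eq)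
qed

text \<open>The \<open>A\<close>-coaction of \<open>V\<close>, that is, its grading by \<open>G\<close>, and its transport along \<open>(F, s)\<close>.\<close>

definition \<sigma>\<^sub>0 :: "('u, 'k) vec \<Rightarrow> ('u, 'k) vec" where
  "\<sigma>\<^sub>0 = gext L (\<lambda>l. e l \<odot> e l)"

definition \<sigma> :: "('u, 'k) vec \<Rightarrow> ('u, 'k) vec" where
  "\<sigma> = compose (space W) (s A V) (ar F V AV \<sigma>\<^sub>0)"

text \<open>The inverse makes composition of translations follow the product of \<open>G\<close>.
  Being right translations, they commute with the left action; an \<open>h\<close> outside
  \<open>L\<close> acts on \<open>A\<close> but does not preserve the support of
  \<open>V\<close>.\<close>

definition right_transl :: "'a set \<Rightarrow> 'a \<Rightarrow> ('u, 'k) vec \<Rightarrow> ('u, 'k) vec" where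
  "right_transl K h = gext K (\<lambda>x. e (x \<otimes> inv h))"

text \<open>The candidate for the projection of \<open>W\<close> to degree \<open>x\<close>; that
  these maps are orthogonal idempotents with sum the identity has to be extracted from the axioms
  for \<open>s\<close>.\<close>

definition component :: "'a \<Rightarrow> ('u, 'k) vec \<Rightarrow> ('u, 'k) vec" where
  "component x w = slice (\<iota> x) (\<sigma> w)"

lemma \<sigma>\<^sub>0_e: "x \<in> L \<Longrightarrow> \<sigma>\<^sub>0 (e x) = e x \<odot> e x"
  by (simp add: \<sigma>\<^sub>0_def gext_e[OF subgroup.subset[OF L]])

lemma \<sigma>\<^sub>0_hom: "\<sigma>\<^sub>0 \<in> mod_hom B V AV"
  unfolding \<sigma>\<^sub>0_def
  by (rule gext_hom[OF L AV])
    (simp_all add: act_mod_space tens_in_tensor_space e_in_reg LG act_mod_grp_tens[OF L A V] act_reg)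

lemma \<sigma>_hom: "\<sigma> \<in> mod_hom B' W AW"
  unfolding \<sigma>_def
  by (rule mod_hom_compose[OF W F_hom[OF V AV \<sigma>\<^sub>0_hom] s_hom[OF A V]])

lemma \<sigma>_eq: "w \<in> space W \<Longrightarrow> \<sigma> w = s A V (ar F V AV \<sigma>\<^sub>0 w)"
  by (simp add: \<sigma>_def compose_eq)

lemma \<sigma>_in: "w \<in> space W \<Longrightarrow> \<sigma> w \<in> space A \<boxtimes> space W"
  using mod_homD(2)[OF \<sigma>_hom] by (simp add: act_mod_space)

lemma F\<sigma>\<^sub>0_in: "w \<in> space W \<Longrightarrow> ar F V AV \<sigma>\<^sub>0 w \<in> space (ob F AV)"
  by (rule mod_homD(2)[OF F_hom[OF V AV \<sigma>\<^sub>0_hom]])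

lemma component_in: "w \<in> space W \<Longrightarrow> component x w \<in> space W"
  unfolding component_def by (rule slice_in[OF sub_W \<sigma>_in])

lemma linear_on_component: "linear_on (space W) (component x)"
  unfolding component_def[abs_def]
  by (rule linear_on_compose[OF mod_homD(3)[OF \<sigma>_hom] _ linear_on_slice[of UNIV]]) simp

lemma \<sigma>_expand: "w \<in> space W \<Longrightarrow> \<sigma> w = (\<Sum>x\<in>carrier G. e x \<odot> component x w)"
  unfolding component_def by (rule tensor_reg_expand[OF \<sigma>_in])

lemma tensor_map_\<sigma>:
  "linear_on (space A) f \<Longrightarrow> linear_on (space W) k \<Longrightarrow> w \<in> space W \<Longrightarrow>
    tensor_map (space A) (space W) f k (\<sigma> w) = (\<Sum>x\<in>carrier G. f (e x) \<odot> k (component x w))"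
  for k :: "('u, 'k) vec \<Rightarrow> ('u, 'k) vec"
  unfolding component_def by (rule tensor_map_reg[OF sub_W _ _ \<sigma>_in])

lemma right_transl_e: "K \<subseteq> carrier G \<Longrightarrow> x \<in> K \<Longrightarrow> right_transl K h (e x) = e (x \<otimes> inv h)"
  by (simp add: right_transl_def gext_e)

lemma right_transl_hom: "subgroup K G \<Longrightarrow> h \<in> K \<Longrightarrow> right_transl K h \<in> mod_hom (kS K) (reg K) (reg K)"
  unfolding right_transl_def
  by (rule gext_hom[OF _ is_left_module_reg])
    (auto simp: e_in_reg act_reg subgroup.mem_carrier subgroup.m_closed subgroup.m_inv_closed m_assoc)

lemma right_transl_A: "h \<in> carrier G \<Longrightarrow> right_transl (carrier G) h \<in> mod_hom H A A"
  using right_transl_hom[OF subgroup_self] by (simp add: mod_hom_group)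

text \<open>\<open>\<sigma>\<close> is linear over \<open>L'\<close>, which acts diagonally on
  \<open>A \<boxtimes> W\<close> and moves \<open>e x\<close> to \<open>e (l \<otimes> x)\<close>;
  the coefficients of this basis vector are compared.\<close>

lemma component_equivariant:
  assumes l: "l \<in> L'" and x: "x \<in> carrier G" and w: "w \<in> space W"
  shows "component (l \<otimes> x) (act W (grp l) w) = act W (grp l) (component x w)"
proof -
  note g = subgroup_module_grp[OF L' W l] and gA = subgroup_module_grp[OF L' AW l, unfolded act_mod_space]
  have "\<sigma> (act W (grp l) w) = act AW (grp l) (\<sigma> w)" by (rule mod_hom_grp[OF \<sigma>_hom l w])
  also have "\<dots> = act AW (grp l) (\<Sum>x\<in>carrier G. e x \<odot> component x w)" by (simp only: \<sigma>_expand[OF w])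
  also have "\<dots> = (\<Sum>x\<in>carrier G. act AW (grp l) (e x \<odot> component x w))"
    by (rule linear_on_sum[OF subspace_tensor_space gA(1)])
      (simp add: tens_in_tensor_space e_in_reg component_in w)
  also have "\<dots> = (\<Sum>x\<in>carrier G. e (l \<otimes> x) \<odot> act W (grp l) (component x w))"
    by (rule sum.cong[OF refl])
      (simp add: act_mod_grp_tens[OF L' A W l] e_in_reg component_in w act_reg L'G[OF l])
  finally have "component (l \<otimes> x) (act W (grp l) w) =
      slice (\<iota> (l \<otimes> x)) (\<Sum>x\<in>carrier G. e (l \<otimes> x) \<odot> act W (grp l) (component x w))"
    by (simp add: component_def)
  also have "\<dots> = act W (grp l) (component x w)"
    by (rule slice_sum) (use x L'G[OF l] in auto)
  finally show ?thesis .
qed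

lemma F_compose:
  "is_left_module B M \<Longrightarrow> is_left_module B N \<Longrightarrow> is_left_module B P \<Longrightarrow> f \<in> mod_hom B M N \<Longrightarrow>
    g \<in> mod_hom B N P \<Longrightarrow> w \<in> space (ob F M) \<Longrightarrow> ar F N P g (ar F M N f w) = ar F M P (compose (space M) g f) w"
  using linear_functorD(5)[OF lin_functor] by blast

lemma s_injective:
  assumes "is_left_module H X" "is_left_module B M" "t \<in> space (ob F (act_mod H B X M))"
    "t' \<in> space (ob F (act_mod H B X M))" "s X M t = s X M t'"
  shows "t = t'"
proof -
  obtain r where "\<And>m. m \<in> space (ob F (act_mod H B X M)) \<Longrightarrow> r (s X M m) = m"
    using s_iso[OF assms(1,2)] by (rule mod_isoE) blast
  then show ?thesis using assms(3-5) by metis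
qed

lemma tens_hom:
  "f \<in> mod_hom H A X \<Longrightarrow> k \<in> mod_hom B V M \<Longrightarrow> is_left_module H X \<Longrightarrow> is_left_module B M \<Longrightarrow>
    tensor_map (space A) (space V) f k \<in> mod_hom B AV (act_mod H B X M)"
  by (rule tensor_map_mod_hom[OF L A _ V])

lemma tensor_map_V:
  fixes k :: "('u, 'k) vec \<Rightarrow> ('u, 'k) vec"
  assumes "linear_on (space A) f" "linear_on (space V) k" "x \<in> L"
  shows "tensor_map (space A) (space V) f k (e x \<odot> e x) = f (e x) \<odot> k (e x)"
  by (simp add: assms tensor_map_tens[OF sub_A sub_V] e_in_reg LG)

text \<open>Functoriality of \<open>F\<close> combined with naturality of \<open>s\<close> in both
  arguments: what a pair of morphisms does to the coaction of \<open>W\<close> is the image of what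
  it does to the coaction of \<open>V\<close>. An identity checked on the basis of \<open>V\<close>
  thereby reaches \<open>W\<close>.\<close>

lemma F_tensor_map:
  assumes f: "f \<in> mod_hom H A X" and k: "k \<in> mod_hom B V M"
    and X: "is_left_module H X" and M: "is_left_module B M" and w: "w \<in> space W"
  shows "tensor_map (space A) (space W) f (ar F V M k) (\<sigma> w) =
    s X M (ar F V (act_mod H B X M) (compose (space V) (tensor_map (space A) (space V) f k) \<sigma>\<^sub>0) w)"
  unfolding \<sigma>_eq[OF w] s_natural[OF A X V M f k F\<sigma>\<^sub>0_in[OF w], symmetric]
  by (simp only: F_compose[OF V AV is_left_module_act_mod[OF L X M] \<sigma>\<^sub>0_hom tens_hom[OF f k X M] w])

lemma V_hom_eqI:
  assumes "f \<in> mod_hom B V M" "k \<in> mod_hom B V M" "\<And>x. x \<in> L \<Longrightarrow> f (e x) = k (e x)"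
  shows "f = k"
  by (rule mod_hom_eqI[OF assms(1,2)], rule reg_eqI[OF mod_homD(3)[OF assms(1)] mod_homD(3)[OF assms(2)]])
    (use assms(3) in auto)

lemma F_id: "w \<in> space W \<Longrightarrow> ar F V V (mod_id V) w = w"
  using linear_functorD(2)[OF lin_functor V] by simp

text \<open>This is coassociativity of \<open>\<sigma>\<close> in coordinates, for the
  comultiplication \<open>?D\<close> of \<open>A\<close>. It holds for \<open>V\<close> by
  inspection, and the pentagon brings it to \<open>W\<close>.\<close>

lemma component_orthogonal:
  assumes x: "x \<in> carrier G" and y: "y \<in> carrier G" and w: "w \<in> space W"
  shows "component y (component x w) = (if x = y then component x w else 0)"
proof -
  let ?D = "gext (carrier G) (\<lambda>x. e x \<odot> e x)"
  let ?AA = "tensor_mod H A A"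
  have AA: "is_left_module H ?AA" by (rule is_left_module_tensor_mod[OF A A])
  note AAV = is_left_module_act_mod[OF L AA V] and A_AV = is_left_module_act_mod[OF L A AV]
  have act_AA: "act ?AA (grp x) (e y \<odot> e y) = e (x \<otimes> y) \<odot> e (x \<otimes> y)"
    if "x \<in> carrier G" "y \<in> carrier G" for x y
    unfolding tensor_mod_eq
    using that act_mod_grp_tens[OF subgroup_self A A[folded is_left_module_group_iff], of x "e y" "e y"]
    by (simp add: act_reg e_in_reg)
  have D: "?D \<in> mod_hom H A ?AA"
    unfolding mod_hom_group[symmetric]
    by (rule gext_hom[OF subgroup_self])
      (simp_all add: is_left_module_group_iff AA tensor_mod_space tens_in_tensor_space e_in_reg act_AA)
  have De: "?D (e x) = e x \<odot> e x" if "x \<in> carrier G" for x using that by (simp add: gext_e)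
  have idA: "mod_id A \<in> mod_hom H A A" and idV: "mod_id V \<in> mod_hom B V V"
    by (rule mod_hom_id[OF A] mod_hom_id[OF V])+
  note as = tensor_assoc_mod_hom[OF L A A V]
  let ?as = "tensor_assoc (space A) (space A) (space V)"
  let ?f = "compose (space V) (tensor_map (space A) (space V) (mod_id A) \<sigma>\<^sub>0) \<sigma>\<^sub>0"
  let ?g = "compose (space V) (tensor_map (space A) (space V) ?D (mod_id V)) \<sigma>\<^sub>0"
  have f: "?f \<in> mod_hom B V (act_mod H B A AV)"
    by (rule mod_hom_compose[OF V \<sigma>\<^sub>0_hom tens_hom[OF idA \<sigma>\<^sub>0_hom A AV]])
  have g: "?g \<in> mod_hom B V (act_mod H B ?AA V)"
    by (rule mod_hom_compose[OF V \<sigma>\<^sub>0_hom tens_hom[OF D idV AA V]])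
  \<comment> \<open>Coassociativity for \<open>V\<close>: both sides send \<open>e x\<close> to
    \<open>e x \<odot> e x \<odot> e x\<close>.\<close>
  have fg: "compose (space V) ?as ?g = ?f"
  proof (rule V_hom_eqI[OF mod_hom_compose[OF V g as] f])
    fix x assume x: "x \<in> L"
    show "compose (space V) ?as ?g (e x) = ?f (e x)"
      by (simp add: compose_eq e_in_reg x LG tensor_map_V[OF mod_homD(3)[OF idA] mod_homD(3)[OF \<sigma>\<^sub>0_hom]]
          tensor_map_V[OF mod_homD(3)[OF D] mod_homD(3)[OF idV]] De \<sigma>\<^sub>0_e
          tensor_assoc_tens[OF sub_A sub_A sub_V])
  qed
  have id_lin: "linear_on S (\<lambda>x. x)" for S :: "('u, 'k) vec set" by (rule linear_on_id)
  note F\<sigma>\<^sub>0 = F_hom[OF V AV \<sigma>\<^sub>0_hom]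
  note FAV = linear_functorD(1)[OF lin_functor AV]
  have sub_FAV: "vec.subspace (space (ob F AV))" by (rule subgroup_moduleD(1)[OF L' FAV])
  \<comment> \<open>The second \<open>\<sigma>\<close> is split into the image of
    \<open>\<sigma>\<^sub>0\<close> followed by \<open>s A V\<close>, the form in which the pentagon
    can be applied.\<close>
  have "tensor_map (space A) (space W) (\<lambda>x. x) \<sigma> (\<sigma> w) =
      tensor_map (space A) (space (ob F AV)) (\<lambda>x. x) (s A V)
        (tensor_map (space A) (space W) (mod_id A) (ar F V AV \<sigma>\<^sub>0) (\<sigma> w))"
  proof -
    have "tensor_map (space A) (space (ob F AV)) (\<lambda>x. x) (s A V)
        (tensor_map (space A) (space W) (mod_id A) (ar F V AV \<sigma>\<^sub>0) (\<sigma> w)) =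
      tensor_map (space A) (space W) (\<lambda>x. mod_id A x) (\<lambda>y. s A V (ar F V AV \<sigma>\<^sub>0 y)) (\<sigma> w)"
      by (rule tensor_map_comp[OF sub_A sub_W mod_homD(3)[OF idA] _ mod_homD(3)[OF F\<sigma>\<^sub>0] _ sub_A sub_FAV
            id_lin mod_homD(3)[OF s_hom[OF A V]] \<sigma>_in[OF w]])
        (use mod_homD(2)[OF F\<sigma>\<^sub>0] in auto)
    also have "tensor_map (space A) (space W) (\<lambda>x. mod_id A x) (\<lambda>y. s A V (ar F V AV \<sigma>\<^sub>0 y)) =
        tensor_map (space A) (space W) (\<lambda>x. x) \<sigma>"
      by (rule tensor_map_cong[OF sub_A sub_W, symmetric])
        (simp_all add: id_lin mod_homD(3)[OF \<sigma>_hom] \<sigma>_eq)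
    finally show ?thesis by (rule sym)
  qed
  also have "tensor_map (space A) (space W) (mod_id A) (ar F V AV \<sigma>\<^sub>0) (\<sigma> w) =
      s A AV (ar F V (act_mod H B A AV) ?f w)"
    by (rule F_tensor_map[OF idA \<sigma>\<^sub>0_hom A AV w])
  also have "ar F V (act_mod H B A AV) ?f w = ar F (act_mod H B ?AA V) (act_mod H B A AV) ?as (ar F V (act_mod H B ?AA V) ?g w)"
    by (simp only: F_compose[OF V AAV A_AV g as w] fg)
  also have "tensor_map (space A) (space (ob F AV)) (\<lambda>x. x) (s A V) (s A AV \<dots>) =
      tensor_assoc (space A) (space A) (space W) (s ?AA V (ar F V (act_mod H B ?AA V) ?g w))"
    by (rule s_pentagon[OF A A V, symmetric])
      (rule mod_homD(2)[OF F_hom[OF V AAV g] w])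
  also have "s ?AA V (ar F V (act_mod H B ?AA V) ?g w) = tensor_map (space A) (space W) ?D (ar F V V (mod_id V)) (\<sigma> w)"
    by (rule F_tensor_map[OF D idV AA V w, symmetric])
  also have "\<dots> = (\<Sum>x\<in>carrier G. ?D (e x) \<odot> ar F V V (mod_id V) (component x w))"
    by (rule tensor_map_\<sigma>[OF mod_homD(3)[OF D] mod_homD(3)[OF F_hom[OF V V idV]] w])
  also have "\<dots> = (\<Sum>x\<in>carrier G. (e x \<odot> e x) \<odot> component x w)"
    by (rule sum.cong[OF refl]) (simp add: De F_id component_in w)
  also have "tensor_assoc (space A) (space A) (space W) \<dots> =
      (\<Sum>x\<in>carrier G. tensor_assoc (space A) (space A) (space W) ((e x \<odot> e x) \<odot> component x w))"
    by (rule linear_on_sum[OF subspace_tensor_space linear_on_tensor_assoc[OF sub_A sub_A sub_W]])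
      (simp add: tens_in_tensor_space e_in_reg component_in w)
  also have "\<dots> = (\<Sum>x\<in>carrier G. e x \<odot> (e x \<odot> component x w))"
    by (rule sum.cong[OF refl])
      (simp add: tensor_assoc_tens[OF sub_A sub_A sub_W] e_in_reg component_in w)
  finally have "(\<Sum>x\<in>carrier G. e x \<odot> \<sigma> (component x w)) = (\<Sum>x\<in>carrier G. e x \<odot> (e x \<odot> component x w))"
    by (simp only: tensor_map_\<sigma>[OF id_lin mod_homD(3)[OF \<sigma>_hom] w])
  \<comment> \<open>Comparing coefficients of \<open>e x\<close> in the outer leg shows that
    \<open>component x w\<close> is homogeneous of degree \<open>x\<close>.\<close>
  then have "slice (\<iota> x) (\<Sum>x\<in>carrier G. e x \<odot> \<sigma> (component x w)) =
      slice (\<iota> x) (\<Sum>x\<in>carrier G. e x \<odot> (e x \<odot> component x w))" by simp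
  then have "\<sigma> (component x w) = e x \<odot> component x w"
    using slice_sum[OF x x, of "\<lambda>x. x"] by simp
  then have "component y (component x w) = slice (\<iota> y) (e x \<odot> component x w)"
    by (simp add: component_def)
  then show ?thesis using x y by (simp add: slice_tens e_apply)
qed

text \<open>The counit law. \<open>?E\<close>, which sends every basis vector to the generator of
  the unit object, is the counit of \<open>A\<close>, and the triangle axiom carries the law from
  \<open>V\<close> to \<open>W\<close>.\<close>

lemma sum_component:
  assumes w: "w \<in> space W"
  shows "(\<Sum>x\<in>carrier G. component x w) = w"
proof -
  let ?U = "unit_mod H :: ('a, 'u, 'k) left_mod"
  let ?E = "gext (carrier G) (\<lambda>x. single Triv) :: ('u, 'k) vec \<Rightarrow> ('u, 'k) vec"
  have U: "is_left_module H ?U" by (rule is_left_module_unit_mod)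
  note UV = is_left_module_act_mod[OF L U V]
  have E: "?E \<in> mod_hom H A ?U"
    unfolding mod_hom_group[symmetric]
    by (rule gext_hom[OF subgroup_self])
      (simp_all add: is_left_module_group_iff U unit_mod_space single_in_coord_space, simp add: unit_mod_def counit_grp)
  have Ee: "?E (e x) = single Triv" if "x \<in> carrier G" for x using that by (simp add: gext_e)
  have idV: "mod_id V \<in> mod_hom B V V" by (rule mod_hom_id[OF V])
  let ?g = "compose (space V) (tensor_map (space A) (space V) ?E (mod_id V)) \<sigma>\<^sub>0"
  have g: "?g \<in> mod_hom B V (act_mod H B ?U V)"
    by (rule mod_hom_compose[OF V \<sigma>\<^sub>0_hom tens_hom[OF E idV U V]])
  note u = unitor_mod_hom[OF L V]
  have ut: "unitor H M (single Triv \<odot> m) = m" if "vec.subspace (space M)" "m \<in> space M"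
    for M :: "('a, 'u, 'k) left_mod" and m
    using unitor_props(3)[OF that(1) single_in_coord_space that(2)] by (simp add: single_def)
  have gu: "compose (space V) (unitor H V) ?g = mod_id V"
    by (rule V_hom_eqI[OF mod_hom_compose[OF V g u] idV])
      (simp add: compose_eq e_in_reg LG tensor_map_V[OF mod_homD(3)[OF E] mod_homD(3)[OF idV]] Ee ut sub_V \<sigma>\<^sub>0_e)
  have m: "single Triv \<odot> component x w \<in> coord_space {Triv} \<boxtimes> space W" for x
    by (simp add: tens_in_tensor_space single_in_coord_space component_in w)
  have "w = ar F V V (compose (space V) (unitor H V) ?g) w" using gu F_id[OF w] by simp
  also have "\<dots> = ar F (act_mod H B ?U V) V (unitor H V) (ar F V (act_mod H B ?U V) ?g w)"
    by (rule F_compose[OF V UV V g u w, symmetric])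
  also have "\<dots> = unitor H W (s ?U V (ar F V (act_mod H B ?U V) ?g w))"
    by (rule s_triangle[OF V, symmetric]) (rule mod_homD(2)[OF F_hom[OF V UV g] w])
  also have "s ?U V (ar F V (act_mod H B ?U V) ?g w) = tensor_map (space A) (space W) ?E (ar F V V (mod_id V)) (\<sigma> w)"
    by (rule F_tensor_map[OF E idV U V w, symmetric])
  also have "\<dots> = (\<Sum>x\<in>carrier G. ?E (e x) \<odot> ar F V V (mod_id V) (component x w))"
    by (rule tensor_map_\<sigma>[OF mod_homD(3)[OF E] mod_homD(3)[OF F_hom[OF V V idV]] w])
  also have "\<dots> = (\<Sum>x\<in>carrier G. single Triv \<odot> component x w)"
    by (rule sum.cong[OF refl]) (simp add: Ee F_id component_in w)
  also have "unitor H W \<dots> = (\<Sum>x\<in>carrier G. unitor H W (single Triv \<odot> component x w))"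
    by (rule linear_on_sum[OF subspace_tensor_space unitor_props(2)[OF sub_W] m])
  also have "\<dots> = (\<Sum>x\<in>carrier G. component x w)"
    by (rule sum.cong[OF refl]) (simp add: ut sub_W component_in w)
  finally show ?thesis by (rule sym)
qed

text \<open>The image of \<open>k\<close> shifts degrees by \<open>inv h\<close> precisely when the
  two left sides agree for all \<open>w\<close>. The right sides move the question to morphisms from
  \<open>V\<close> to \<open>AV\<close>, where faithfulness of \<open>F\<close> can answer
  it.\<close>

lemma \<sigma>_intertwining:
  assumes k: "k \<in> mod_hom B V V" and h: "h \<in> carrier G" and w: "w \<in> space W"
  shows "tensor_map (space A) (space W) (right_transl (carrier G) h) (ar F V V k) (\<sigma> w) =
      s A V (ar F V AV (compose (space V) (tensor_map (space A) (space V) (right_transl (carrier G) h) k) \<sigma>\<^sub>0) w)"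
    and "\<sigma> (ar F V V k w) = s A V (ar F V AV (compose (space V) \<sigma>\<^sub>0 k) w)"
proof -
  show "tensor_map (space A) (space W) (right_transl (carrier G) h) (ar F V V k) (\<sigma> w) =
      s A V (ar F V AV (compose (space V) (tensor_map (space A) (space V) (right_transl (carrier G) h) k) \<sigma>\<^sub>0) w)"
    by (rule F_tensor_map[OF right_transl_A[OF h] k A V w])
  have "ar F V V k w \<in> space W" by (rule mod_homD(2)[OF F_hom[OF V V k] w])
  then show "\<sigma> (ar F V V k w) = s A V (ar F V AV (compose (space V) \<sigma>\<^sub>0 k) w)"
    by (simp add: \<sigma>_eq F_compose[OF V V AV k \<sigma>\<^sub>0_hom w])
qed

lemma tensor_map_right_transl:
  assumes h: "h \<in> carrier G" and k: "linear_on (space W) k" and w: "w \<in> space W"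
  shows "tensor_map (space A) (space W) (right_transl (carrier G) h) k (\<sigma> w) =
    (\<Sum>x\<in>carrier G. e (x \<otimes> inv h) \<odot> k (component x w))"
  unfolding tensor_map_\<sigma>[OF mod_homD(3)[OF right_transl_A[OF h]] k w]
  by (rule sum.cong[OF refl]) (simp add: right_transl_e)

lemma slice_right_transl:
  assumes h: "h \<in> carrier G" and x: "x \<in> carrier G"
  shows "slice (\<iota> (x \<otimes> inv h)) (\<Sum>x\<in>carrier G. e (x \<otimes> inv h) \<odot> v x) = v x"
  by (rule slice_sum) (use h x in auto)

text \<open>On \<open>V\<close>, translating \<open>e x\<close> and then applying the coaction is
  the same as translating both legs of \<open>e x \<odot> e x\<close>;
  \<open>\<sigma>_intertwining\<close> carries this to \<open>W\<close>.\<close>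

lemma component_right_transl:
  assumes h: "h \<in> L" and x: "x \<in> carrier G" and w: "w \<in> space W"
  shows "component (x \<otimes> inv h) (ar F V V (right_transl L h) w) = ar F V V (right_transl L h) (component x w)"
proof -
  let ?k = "right_transl L h"
  have k: "?k \<in> mod_hom B V V" by (rule right_transl_hom[OF L h])
  have hG: "h \<in> carrier G" using h LG by simp
  have xh: "x \<otimes> inv h \<in> L" if "x \<in> L" for x
    using that h L by (simp add: subgroup.m_closed subgroup.m_inv_closed)
  have "compose (space V) (tensor_map (space A) (space V) (right_transl (carrier G) h) ?k) \<sigma>\<^sub>0 =
      compose (space V) \<sigma>\<^sub>0 ?k"
    by (rule V_hom_eqI[OF mod_hom_compose[OF V \<sigma>\<^sub>0_hom tens_hom[OF right_transl_A[OF hG] k A V]]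
          mod_hom_compose[OF V k \<sigma>\<^sub>0_hom]])
      (simp add: compose_eq e_in_reg LG right_transl_e[OF subgroup.subset[OF L]] right_transl_e \<sigma>\<^sub>0_e xh
        tensor_map_V[OF mod_homD(3)[OF right_transl_A[OF hG]] mod_homD(3)[OF k]])
  then have "\<sigma> (ar F V V ?k w) = tensor_map (space A) (space W) (right_transl (carrier G) h) (ar F V V ?k) (\<sigma> w)"
    using \<sigma>_intertwining[OF k hG w] by simp
  also have "\<dots> = (\<Sum>x\<in>carrier G. e (x \<otimes> inv h) \<odot> ar F V V ?k (component x w))"
    by (rule tensor_map_right_transl[OF hG mod_homD(3)[OF F_hom[OF V V k]] w])
  finally show ?thesis by (simp add: component_def slice_right_transl[OF hG x])
qed

text \<open>Supplies the injectivity that \<open>conjugate_of_components\<close> asks of the degree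
  shifts.\<close>

lemma right_transl_inverse:
  assumes h: "h \<in> L" and w: "w \<in> space W"
  shows "ar F V V (right_transl L (inv h)) (ar F V V (right_transl L h) w) = w"
proof -
  have ih: "inv h \<in> L" by (rule subgroup.m_inv_closed[OF L h])
  note k = right_transl_hom[OF L h] and k' = right_transl_hom[OF L ih]
  have xh: "x \<otimes> inv h \<in> L" if "x \<in> L" for x
    using that ih L by (simp add: subgroup.m_closed)
  have "compose (space V) (right_transl L (inv h)) (right_transl L h) = mod_id V"
    by (rule V_hom_eqI[OF mod_hom_compose[OF V k k'] mod_hom_id[OF V]])
      (use h in \<open>simp add: compose_eq e_in_reg right_transl_e[OF subgroup.subset[OF L]] xh LG m_assoc\<close>)
  then show ?thesis using F_compose[OF V V V k k' w] F_id[OF w] by simp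
qed

text \<open>Fullness and faithfulness of \<open>F\<close> turn \<open>f\<close> into an endomorphism of the explicit module \<open>V\<close>.\<close>

lemma translation_hom:
  assumes f: "f \<in> mod_hom B' W W" and h: "h \<in> carrier G"
    and comm: "\<And>x w. x \<in> carrier G \<Longrightarrow> w \<in> space W \<Longrightarrow> component (x \<otimes> inv h) (f w) = f (component x w)"
  shows "\<exists>c. (h \<notin> L \<longrightarrow> c = 0) \<and> (h = \<one> \<or> h \<notin> L \<longrightarrow> (\<forall>w\<in>space W. f w = scale c w))"
proof -
  obtain k where k: "k \<in> mod_hom B V V" "ar F V V k = f"
    by (rule equivalence_full[OF F_equivalence V V f])
  let ?f = "compose (space V) (tensor_map (space A) (space V) (right_transl (carrier G) h) k) \<sigma>\<^sub>0"
  let ?g = "compose (space V) \<sigma>\<^sub>0 k"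
  have hom: "?f \<in> mod_hom B V AV" "?g \<in> mod_hom B V AV"
    by (rule mod_hom_compose[OF V \<sigma>\<^sub>0_hom tens_hom[OF right_transl_A[OF h] k(1) A V]]
        mod_hom_compose[OF V k(1) \<sigma>\<^sub>0_hom])+
  \<comment> \<open>By \<open>comm\<close> the two images agree after \<open>s A V\<close>, which is
    injective.\<close>
  have "ar F V AV ?f = ar F V AV ?g"
  proof (rule mod_hom_eqI[OF F_hom[OF V AV hom(1)] F_hom[OF V AV hom(2)]])
    fix w assume w: "w \<in> space W"
    have fw: "f w \<in> space W" by (rule mod_homD(2)[OF f w])
    have "\<sigma> (f w) = (\<Sum>y\<in>carrier G. e y \<odot> component y (f w))" by (rule \<sigma>_expand[OF fw])
    also have "\<dots> = (\<Sum>x\<in>carrier G. e (x \<otimes> inv h) \<odot> component (x \<otimes> inv h) (f w))"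
      by (rule sum.reindex_bij_witness[of _ "\<lambda>x. x \<otimes> inv h" "\<lambda>x. x \<otimes> h"])
        (use h in \<open>simp_all add: m_assoc\<close>)
    also have "\<dots> = (\<Sum>x\<in>carrier G. e (x \<otimes> inv h) \<odot> f (component x w))"
      by (rule sum.cong[OF refl]) (simp add: comm w)
    also have "\<dots> = tensor_map (space A) (space W) (right_transl (carrier G) h) f (\<sigma> w)"
      by (rule tensor_map_right_transl[OF h mod_homD(3)[OF f] w, symmetric])
    finally have "s A V (ar F V AV ?f w) = s A V (ar F V AV ?g w)"
      using \<sigma>_intertwining[OF k(1) h w] k(2) by simp
    then show "ar F V AV ?f w = ar F V AV ?g w"
      by (rule s_injective[OF A V mod_homD(2)[OF F_hom[OF V AV hom(1)] w]
            mod_homD(2)[OF F_hom[OF V AV hom(2)] w]])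
  qed
  then have fg: "?f = ?g" by (rule equivalence_faithful[OF F_equivalence V AV hom])
  have one: "\<one> \<in> L" by (rule subgroup.one_closed[OF L])
  let ?v = "k (e \<one>)"
  have v: "?v \<in> space V" using mod_homD(2)[OF k(1) e_in_reg[OF one]] .
  \<comment> \<open>At \<open>e \<one>\<close> the equation \<open>?f = ?g\<close> says that
    \<open>?v\<close> is homogeneous of degree \<open>inv h\<close>: a multiple of
    \<open>e (inv h)\<close> if that element is in \<open>L\<close>, and zero otherwise.\<close>
  have "\<sigma>\<^sub>0 ?v = e (inv h) \<odot> ?v"
    using fun_cong[OF fg, of "e \<one>"] h
    by (simp add: compose_eq e_in_reg one tensor_map_V[OF mod_homD(3)[OF right_transl_A[OF h]] mod_homD(3)[OF k(1)]]
        right_transl_e \<sigma>\<^sub>0_e)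
  moreover have "\<sigma>\<^sub>0 v = (\<Sum>x\<in>L. scale (v (\<iota> x)) (e x \<odot> e x))" if "v \<in> space V" for v
    by (rule reg_eqI[OF mod_homD(3)[OF \<sigma>\<^sub>0_hom] linear_on_sum_fun[OF linear_on_eval_scale] _ that])
      (simp add: \<sigma>\<^sub>0_e e_apply LG if_distrib[of "\<lambda>c. scale c _"] finite_subset[OF subgroup.subset[OF L] fin] cong: if_cong)
  ultimately have "slice (\<iota> (inv h)) (e (inv h) \<odot> ?v) =
      slice (\<iota> (inv h)) (\<Sum>x\<in>L. scale (?v (\<iota> x)) (e x \<odot> e x))" using v by simp
  also have "\<dots> = (\<Sum>x\<in>L. slice (\<iota> (inv h)) (scale (?v (\<iota> x)) (e x \<odot> e x)))"
    by (rule linear_on_sum[OF vec.subspace_UNIV linear_on_slice]) simp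
  also have "\<dots> = (\<Sum>x\<in>L. if x = inv h then scale (?v (\<iota> (inv h))) (e (inv h)) else 0)"
    by (rule sum.cong[OF refl])
      (use h in \<open>auto simp: linear_onD(2)[OF linear_on_slice[of UNIV]] slice_tens e_apply LG\<close>)
  also have "\<dots> = (if inv h \<in> L then scale (?v (\<iota> (inv h))) (e (inv h)) else 0)"
    using finite_subset[OF subgroup.subset[OF L] fin] by simp
  finally have v_eq: "?v = (if inv h \<in> L then scale (?v (\<iota> (inv h))) (e (inv h)) else 0)"
    using h by (simp add: slice_tens e_apply)
  \<comment> \<open>For \<open>h\<close> outside \<open>L\<close> the vector \<open>?v\<close> is
    zero, and for \<open>h = \<one>\<close> it is a multiple of \<open>e \<one>\<close>. As
    \<open>e \<one>\<close> generates \<open>V\<close>, the endomorphism \<open>k\<close> is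
    multiplication by \<open>c\<close> in both cases.\<close>
  define c where "c = (if h \<in> L then ?v (\<iota> (inv h)) else 0)"
  have "f w = scale c w" if hc: "h = \<one> \<or> h \<notin> L" and w: "w \<in> space W" for w
  proof -
    have "inv h \<in> L \<longleftrightarrow> h \<in> L"
      using h L inv_inv[OF h] by (metis subgroup.m_inv_closed)
    then have v1: "?v = scale c (e \<one>)"
      using v_eq hc by (auto simp: c_def)
    let ?k = "\<lambda>m\<in>space V. scale c (mod_id V m)"
    have idV: "mod_id V \<in> mod_hom B V V" by (rule mod_hom_id[OF V])
    have k_e: "k (e x) = scale c (e x)" if x: "x \<in> L" for x
    proof -
      note r = subgroup_module_grp(1)[OF L V x]
      have "k (e x) = k (act V (grp x) (e \<one>))" using x by (simp add: act_reg LG)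
      also have "\<dots> = act V (grp x) ?v" by (rule mod_hom_grp[OF k(1) x e_in_reg[OF one]])
      also have "\<dots> = scale c (act V (grp x) (e \<one>))"
        using linear_onD(2)[OF r e_in_reg[OF one], of c] v1 by simp
      also have "\<dots> = scale c (e x)" using x by (simp add: act_reg LG)
      finally show ?thesis .
    qed
    have kv: "k v = scale c v" if "v \<in> space V" for v
      by (rule reg_eqI[OF mod_homD(3)[OF k(1)] linear_on_scale[OF linear_on_id] k_e that])
    have "k = ?k"
      by (rule extensionalityI[OF mod_homD(1)[OF k(1)]]) (simp_all add: kv)
    \<comment> \<open>Linearity of \<open>F\<close> on morphisms takes the scalar back to
      \<open>W\<close>.\<close>
    then have "f = ar F V V ?k" using k(2) by simp
    also have "\<dots> = (\<lambda>m\<in>space W. scale c (ar F V V (mod_id V) m))"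
      by (rule linear_functorD(4)[OF lin_functor V V idV])
    finally show ?thesis using w F_id[OF w] by simp
  qed
  then show ?thesis by (intro exI[of _ c]) (auto simp: c_def)
qed

text \<open>Left multiplication by \<open>a\<close> on \<open>A\<close> need not be linear over
  \<open>H\<close>, so naturality of \<open>s\<close> does not apply to it. On the vectors
  \<open>e l \<odot> e l\<close> it coincides with right multiplication, as \<open>a\<close>
  centralizes \<open>L\<close>, and that is a morphism. On \<open>W\<close> the braiding multiplies
  by \<open>a'\<close> from the left; the coefficients of \<open>e (a' \<otimes> x)\<close> are
  compared.\<close>

lemma component_braided:
  assumes x: "x \<in> carrier G" and w: "w \<in> space W"
  shows "component (a' \<otimes> x \<otimes> inv a) w = component x w"
proof -
  let ?c = "module_braiding H B (grp a \<odot> grp \<one>) A V"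
  let ?c' = "module_braiding H B' (grp a' \<odot> grp \<one>) A W"
  have aG: "a \<in> carrier G" "a' \<in> carrier G" using a a' by (auto simp: centralizer_def)
  have ia: "inv a \<in> carrier G" using aG by simp
  note c = module_braiding_mod_hom[OF L A V a] and c' = module_braiding_mod_hom[OF L' A W a']
  have idV: "mod_id V \<in> mod_hom B V V" by (rule mod_hom_id[OF V])
  note R = right_transl_A[OF ia]
  let ?g = "compose (space V) (tensor_map (space A) (space V) (right_transl (carrier G) (inv a)) (mod_id V)) \<sigma>\<^sub>0"
  have cg: "compose (space V) ?c \<sigma>\<^sub>0 = ?g"
  proof (rule V_hom_eqI[OF mod_hom_compose[OF V \<sigma>\<^sub>0_hom c(1)] mod_hom_compose[OF V \<sigma>\<^sub>0_hom tens_hom[OF R idV A V]]])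
    fix l assume l: "l \<in> L"
    have "a \<otimes> l = l \<otimes> a" using a l by (simp add: centralizer_def)
    then show "compose (space V) ?c \<sigma>\<^sub>0 (e l) = ?g (e l)"
      using l aG by (simp add: compose_eq e_in_reg \<sigma>\<^sub>0_e c(2) LG act_reg right_transl_e
          tensor_map_V[OF mod_homD(3)[OF R] mod_homD(3)[OF idV]])
  qed
  have "compose (space (ob F AV)) ?c' (s A V) = compose (space (ob F AV)) (s A V) (ar F AV AV ?c)"
    by (rule F_braided[OF A V])
  from compose_eqD[OF this F\<sigma>\<^sub>0_in[OF w]]
  have "?c' (\<sigma> w) = s A V (ar F AV AV ?c (ar F V AV \<sigma>\<^sub>0 w))" by (simp add: \<sigma>_eq[OF w])
  also have "\<dots> = s A V (ar F V AV ?g w)" by (simp only: F_compose[OF V AV AV \<sigma>\<^sub>0_hom c(1) w] cg)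
  also have "\<dots> = tensor_map (space A) (space W) (right_transl (carrier G) (inv a)) (ar F V V (mod_id V)) (\<sigma> w)"
    by (rule F_tensor_map[OF R idV A V w, symmetric])
  also have "\<dots> = (\<Sum>x\<in>carrier G. e (x \<otimes> inv (inv a)) \<odot> ar F V V (mod_id V) (component x w))"
    by (rule tensor_map_right_transl[OF ia mod_homD(3)[OF F_hom[OF V V idV]] w])
  also have "\<dots> = (\<Sum>x\<in>carrier G. e (x \<otimes> a) \<odot> component x w)"
    using aG by (simp add: F_id component_in w)
  finally have eq: "?c' (\<sigma> w) = (\<Sum>x\<in>carrier G. e (x \<otimes> a) \<odot> component x w)" .
  have "?c' (\<sigma> w) = ?c' (\<Sum>x\<in>carrier G. e x \<odot> component x w)" by (simp only: \<sigma>_expand[OF w])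
  also have "\<dots> = (\<Sum>x\<in>carrier G. ?c' (e x \<odot> component x w))"
    by (rule linear_on_sum[OF subspace_tensor_space c'(3)])
      (simp add: tens_in_tensor_space e_in_reg component_in w)
  also have "\<dots> = (\<Sum>x\<in>carrier G. e (a' \<otimes> x) \<odot> component x w)"
    by (rule sum.cong[OF refl]) (simp add: c'(2) e_in_reg component_in w act_reg aG)
  finally have "slice (\<iota> (a' \<otimes> x)) (\<Sum>x\<in>carrier G. e (x \<otimes> a) \<odot> component x w) =
      slice (\<iota> (a' \<otimes> x)) (\<Sum>x\<in>carrier G. e (a' \<otimes> x) \<odot> component x w)" using eq by simp
  also have "slice (\<iota> (a' \<otimes> x)) (\<Sum>x\<in>carrier G. e (a' \<otimes> x) \<odot> component x w) = component x w"
    by (rule slice_sum) (use x aG in auto)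
  also have "slice (\<iota> (a' \<otimes> x)) (\<Sum>x\<in>carrier G. e (x \<otimes> a) \<odot> component x w) = component (a' \<otimes> x \<otimes> inv a) w"
    by (rule slice_sum) (use x aG in \<open>auto simp: inv_solve_right\<close>)
  finally show ?thesis .
qed

text \<open>If \<open>W\<close> were zero, \<open>F\<close> would identify the zero and the identity
  endomorphism of \<open>V\<close>, against faithfulness.\<close>

lemma nontrivial: "\<exists>w\<in>space W. w \<noteq> 0"
proof (rule ccontr)
  assume "\<not> ?thesis"
  then have W0: "w = 0" if "w \<in> space W" for w using that by blast
  have idV: "mod_id V \<in> mod_hom B V V" by (rule mod_hom_id[OF V])
  have one: "\<one> \<in> L" by (rule subgroup.one_closed[OF L])
  let ?z = "\<lambda>m\<in>space V. scale 0 (mod_id V m)"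
  have z: "?z \<in> mod_hom B V V"
    by (rule subgroup_mod_homI[OF L V V])
      (auto simp: linear_on_def vec.subspace_add[OF sub_V] vec.subspace_scale[OF sub_V] vec.subspace_0[OF sub_V]
        subgroup_module_grp(2)[OF L V] linear_on_zero[OF sub_V subgroup_module_grp(1)[OF L V]])
  have "ar F V V ?z = ar F V V (mod_id V)"
    by (rule mod_hom_eqI[OF F_hom[OF V V z] F_hom[OF V V idV]])
      (metis W0 mod_homD(2) F_hom[OF V V z] F_hom[OF V V idV])
  then have "?z = mod_id V" by (rule equivalence_faithful[OF F_equivalence V V z idV])
  from fun_cong[OF this, of "e \<one>"] have "e \<one> = 0" by (simp add: e_in_reg one)
  then have "e \<one> (\<iota> \<one>) = 0" by simp
  then show False by (simp add: e_apply)
qed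

text \<open>Any degree \<open>g\<close> that occurs in \<open>W\<close> can serve as the conjugating
  element, and one occurs because the components of a nonzero vector add up to it.\<close>

lemma conjugate: "\<exists>g\<in>carrier G. L' = (\<lambda>l. g \<otimes> l \<otimes> inv g) ` L \<and> a' = g \<otimes> a \<otimes> inv g"
proof -
  obtain w where w: "w \<in> space W" "w \<noteq> 0" using nontrivial by blast
  have "\<exists>g\<in>carrier G. component g w \<noteq> 0"
    using sum_component[OF w(1)] w(2) sum.neutral[of "carrier G" "\<lambda>x. component x w"] by auto
  then obtain g where g: "g \<in> carrier G" "component g w \<noteq> 0" by blast
  have "L' = (\<lambda>l. g \<otimes> l \<otimes> inv g) ` L \<and> a' = g \<otimes> a \<otimes> inv g"
  proof (rule conjugate_of_components[OF L L' _ _ W linear_on_component component_in component_orthogonal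
        component_equivariant _ _ _ component_braided g(1) w(1) g(2)])
    show "a \<in> carrier G" "a' \<in> carrier G" using a a' by (auto simp: centralizer_def)
    show "\<exists>c. \<forall>w\<in>space W. f w = scale c w" if "f \<in> mod_hom B' W W"
      "\<And>x w. x \<in> carrier G \<Longrightarrow> w \<in> space W \<Longrightarrow> component x (f w) = f (component x w)" for f
      using translation_hom[OF that(1) one_closed] that(2) by auto
    show "h \<in> L" if f: "f \<in> mod_hom B' W W" "h \<in> carrier G"
      "\<And>x w. x \<in> carrier G \<Longrightarrow> w \<in> space W \<Longrightarrow> component (x \<otimes> inv h) (f w) = f (component x w)"
      and "w \<in> space W" "f w \<noteq> 0" for f h w
      using translation_hom[OF f] that(4,5) by force
    fix h assume h: "h \<in> L"
    let ?f = "ar F V V (right_transl L h)"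
    note f = F_hom[OF V V right_transl_hom[OF L h]]
    have ih: "inv h \<in> L" by (rule subgroup.m_inv_closed[OF L h])
    note f' = F_hom[OF V V right_transl_hom[OF L ih]]
    have "?f w \<noteq> 0" if "w \<in> space W" "w \<noteq> 0" for w
      using right_transl_inverse[OF h that(1)] that(2) linear_on_zero[OF sub_W mod_homD(3)[OF f']] by metis
    then show "\<exists>f. \<forall>w\<in>space W. f w \<in> space W \<and> (w \<noteq> 0 \<longrightarrow> f w \<noteq> 0) \<and>
        (\<forall>x\<in>carrier G. component (x \<otimes> inv h) (f w) = f (component x w))"
      using mod_homD(2)[OF f] component_right_transl[OF h] by (intro exI[of _ ?f]) blast
  qed
  then show ?thesis using g(1) by blast
qed

end

text \<open>Nested pairs over \<open>Triv\<close> make \<open>'u idx\<close> infinite for every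
  \<open>'u\<close>, so each universe has room for the regular modules of a finite group.\<close>

lemma ex_embedding_idx:
  assumes "finite A"
  shows "\<exists>\<iota> :: 'a \<Rightarrow> 'u idx. inj_on \<iota> A"
proof -
  define c :: "nat \<Rightarrow> 'u idx" where "c = rec_nat Triv (\<lambda>_. Node Triv)"
  have "c m = c n \<longrightarrow> m = n" for m n
  proof (induction m arbitrary: n)
    case 0
    show ?case by (cases n) (simp_all add: c_def)
  next
    case (Suc m)
    then show ?case by (cases n) (simp_all add: c_def)
  qed
  then have "inj c" by (simp add: inj_def)
  moreover obtain f :: "'a \<Rightarrow> nat" where "inj_on f A"
    using finite_imp_inj_to_nat_seg[OF assms] by blast
  ultimately have "inj_on (c \<circ> f) A" by (intro comp_inj_on) (auto intro: inj_on_subset)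
  then show ?thesis by blast
qed

theorem theorem1p4:
  fixes G :: "('g, 'm) monoid_scheme" and u :: 'g
    and H :: "('g, 'k::{alg_closed_field, field_char_0}) hopf"
    and R :: "('g, 'k) vec"
  assumes "group G" and "finite (carrier G)"
    and "u \<in> center G" and "u \<otimes>\<^bsub>G\<^esub> u = \<one>\<^bsub>G\<^esub>"
    and "H = group_algebra G" and "R = R_matrix G u"
  shows "{B. left_coideal_subalgebra H B} = {group_span L | L. subgroup L G} \<and>
          (\<forall>L. subgroup L G \<longrightarrow>
           {K. K_matrix H R (subgroup_algebra G L) K} =
           {grp a \<odot> grp \<one>\<^bsub>G\<^esub> | a. a \<in> centralizer G L}) \<and>
          (\<forall>L L' a a'. subgroup L G \<longrightarrow> subgroup L' G \<longrightarrow>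
           a \<in> centralizer G L \<longrightarrow> a' \<in> centralizer G L' \<longrightarrow>
           (braided_morita_equivalent TYPE('u) H
              (subgroup_algebra G L) (grp a \<odot> grp \<one>\<^bsub>G\<^esub>)
              (subgroup_algebra G L') (grp a' \<odot> grp \<one>\<^bsub>G\<^esub>) \<longleftrightarrow>
            (\<exists>g\<in>carrier G. L' = (\<lambda>l. g \<otimes>\<^bsub>G\<^esub> l \<otimes>\<^bsub>G\<^esub> inv\<^bsub>G\<^esub> g) ` L \<and>
                           a' = g \<otimes>\<^bsub>G\<^esub> a \<otimes>\<^bsub>G\<^esub> inv\<^bsub>G\<^esub> g)))"
proof -
  interpret group G by fact
  interpret finite_group G by unfold_locales fact
  interpret group_with_involution G u by unfold_locales fact+
  show ?thesis
    unfolding assms(5,6)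
  proof (intro conjI allI impI)
    show "{B. left_coideal_subalgebra (group_algebra G :: ('g, 'k) hopf) B} = {group_span L | L. subgroup L G}"
      using left_coideal_subalgebra_form left_coideal_subalgebra_group_span by blast
    show "{K. K_matrix (group_algebra G :: ('g, 'k) hopf) (R_matrix G u) (subgroup_algebra G L) K} =
        {grp a \<odot> grp \<one>\<^bsub>G\<^esub> | a. a \<in> centralizer G L}" if "subgroup L G" for L
      using K_matrix_form[OF that] K_matrix_grp[OF that] by blast
  next
    fix L L' a a'
    assume L: "subgroup L G" and L': "subgroup L' G"
      and a: "a \<in> centralizer G L" and a': "a' \<in> centralizer G L'"
    show "braided_morita_equivalent TYPE('u) (group_algebra G :: ('g, 'k) hopf)
        (subgroup_algebra G L) (grp a \<odot> grp \<one>\<^bsub>G\<^esub>)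
        (subgroup_algebra G L') (grp a' \<odot> grp \<one>\<^bsub>G\<^esub>) \<longleftrightarrow>
      (\<exists>g\<in>carrier G. L' = (\<lambda>l. g \<otimes>\<^bsub>G\<^esub> l \<otimes>\<^bsub>G\<^esub> inv\<^bsub>G\<^esub> g) ` L \<and>
        a' = g \<otimes>\<^bsub>G\<^esub> a \<otimes>\<^bsub>G\<^esub> inv\<^bsub>G\<^esub> g)" (is "?equiv \<longleftrightarrow> ?conj")
    proof
      assume ?conj
      then show ?equiv
        using braided_morita_equivalent_conjugate[OF L _ a] L' by blast
    next
      assume ?equiv
      then obtain F :: "('g, 'g, 'u, 'k) mod_functor" and s where
        F: "is_module_functor (group_algebra G) (subgroup_algebra G L) (subgroup_algebra G L') F s"
          "is_equivalence (subgroup_algebra G L) (subgroup_algebra G L') F"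
        and F': "\<forall>X M. is_left_module (group_algebra G) X \<longrightarrow> is_left_module (subgroup_algebra G L) M \<longrightarrow>
          compose (space (ob F (act_mod (group_algebra G) (subgroup_algebra G L) X M)))
            (module_braiding (group_algebra G) (subgroup_algebra G L') (grp a' \<odot> grp \<one>\<^bsub>G\<^esub>) X (ob F M)) (s X M) =
          compose (space (ob F (act_mod (group_algebra G) (subgroup_algebra G L) X M))) (s X M)
            (ar F (act_mod (group_algebra G) (subgroup_algebra G L) X M)
              (act_mod (group_algebra G) (subgroup_algebra G L) X M)
              (module_braiding (group_algebra G) (subgroup_algebra G L) (grp a \<odot> grp \<one>\<^bsub>G\<^esub>) X M))"
        unfolding braided_morita_equivalent_def by blast
      obtain \<iota> :: "'g \<Rightarrow> 'u idx" where "inj_on \<iota> (carrier G)"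
        using ex_embedding_idx[OF fin] by blast
      then interpret braided_equivalence G \<iota> "TYPE('k)" L L' a a' F s
        by intro_locales (use L L' a a' F F' in
          \<open>auto intro!: embedded_group_axioms.intro braided_equivalence_axioms.intro\<close>)
      show ?conj by (rule conjugate)
    qed
  qed
qed

end
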